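(* Under the standing assumptions (A1)–(A5) listed in the context, there exists $r_0>0$ such that for any $r\in(0,r_0)$ the following holds. (i) There exists a unique solution $(\bar u^r,\bar\mu^r)\in(0,\infty)^d\times\mathcal{P}([d])$ of the stationary discounted mean field game system $$-r\bar u^r_x+H(x,\Delta_x\bar u^r)+F(x,\bar\mu^r)=0,\qquad \sum_{y\in[d]}\bar\mu^r_y\gamma^*_x(y,\Delta_y\bar u^r)=0,\qquad x\in[d].$$ Additionally, there is a positive constant $C$ such that for any $r\in(0,r_0)$, $|r\bar u^r|\le C$ and for any $x\in[d]$, $\bar\mu^r_x\ge C^{-1}$. (ii) There exists a unique solution $(\bar\varrho,\bar u,\bar\mu)\in\mathbb{R}\times\mathcal{M}_0\times\mathcal{P}([d])$ of the ergodic mean field game system $$-\bar\varrho+H(x,\Delta_x\bar u)+F(x,\bar\mu)=0,\qquad \sum_{y\in[d]}\bar\mu_y\gamma^*_x(y,\Delta_y\bar u)=0,\qquad x\in[d].\qquad(\mathrm{MFG}_0)$$ Moreover, there exists $C>0$ such that for any $r\in(0,r_0)$, $$\max_{x\in[d]}|r\bar u^r_x-\bar\varrho|+\Big(\sum_{x\in[d]}|\Delta_x(\bar u^r-\bar u)|^2\Big)^{1/2}+|\bar\mu^r-\bar\mu|\le Cr^{1/2}.$$ Together with (i), $\bar\mu_x>0$ for any $x\in[d]$. (iii) From the solution of $(\mathrm{MFG}_0)$ one can naturally construct a stationary ergodic mean field equilibrium $(\bar\alpha,\mu)$, where $\bar\alpha_{xy}:=\gamma^*_y(x,\Delta_x\bar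 u)$ and $\mu$ is the flow of distributions of the jump process of the representative player $(X^{\bar\alpha}_t)_{t\ge0}$ on $[d]$. Conversely, any stationary ergodic mean field equilibrium $(\tilde\alpha,\tilde\mu)$ corresponds to the unique solution $(\bar\varrho,\bar u,\bar\mu)$ of $(\mathrm{MFG}_0)$, in the sense that $\tilde\alpha$ is of the form $\tilde\alpha_{xy}=\gamma^*_y(x,\Delta_x\bar u)$, the flow of distributions satisfies $\tilde\mu(t)\to\bar\mu$ as $t\to\infty$, and $\bar\varrho$ is the value of playing the equilibrium $(\tilde\alpha,\tilde\mu)$, that is, $\bar\varrho=J_0(\tilde\alpha,\tilde\mu)$.
   Context: Notation. $d\ge2$ is a fixed integer, $[d]=\{1,\dots,d\}$, $|\cdot|$ is the Euclidean norm, $\mathcal{P}([d])=\{\eta\in[0,\infty)^d:\sum_x\eta_x=1\}$, $\mathcal{M}_0=\{m\in\mathbb{R}^d:\sum_x m_x=0\}$. For $p\in\mathbb{R}^d$, $\Delta_xp=(p_y-p_x)_{y\in[d]}$. With $(e_i)$ the standard basis of $\mathbb{R}^d$ and $e_{yz}=e_z-e_y$, a function $K:\mathcal{P}([d])\to\mathbb{R}$ is differentiable if for any distinct $y,z\in[d]$ there is a function $D^\eta_{yz}K$ with $D^\eta_{yz}K(\eta)=\lim_{h\to0^+}\frac{K(\eta+he_{yz})-K(\eta)}{h}$; $D^\eta K=(D^\eta_{yz}K)_{y,z}$, and $\mathcal{C}^1(\mathcal{P}([d]))$ is the set of continuously differentiable $K$. Data and standing assumptions. $f(x,a)$ and $F(x,\eta)$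 ($x\in[d]$, $\eta\in\mathcal{P}([d])$) are real-valued measurable running costs, and $f(x,a)$ does not depend on $a_x$. (A1) The action set is $\mathbb{A}=[\mathfrak{a}_l,\mathfrak{a}_u]$ with $0<\mathfrak{a}_l<\mathfrak{a}_u<\infty$. A rate vector at $x$ is $a\in\mathbb{R}^d$ with $a_y\in\mathbb{A}$ for $y\ne x$ and $a_x=-\sum_{y\ne x}a_y$. The Hamiltonian is $H(x,p)=\inf_a\{f(x,a)+a\cdot p\}$, the infimum being over rate vectors at $x$. (A2) For each $(x,p)\in[d]\times\mathbb{R}^d$ there is a unique minimizing rate vector $\gamma^*(x,p)=\arg\min_a\{f(x,a)+a\cdot p\}$, and $\gamma^*$ is measurable; $\gamma^*_y(x,p)$ is its $y$-th component. (A3) For any $x\in[d]$, $F(x,\cdot)\in\mathcal{C}^1(\mathcal{P}([d]))$ and $D^\eta F(x,\cdot)$ is Lipschitz. (A4) $\sum_x(F(x,\eta)-F(x,\hat\eta))(\eta_x-\hat\eta_x)\ge0$ for all $\eta,\hat\eta\in\mathcal{P}([d])$. (A5) $H$ is $\mathcal{C}^2$ with respect to $p$. Moreover, on any compact set $[-K,K]$ (of values of $p$), $D_pH$ and $D^2_{pp}H$ (gradient and Hessian in $p$) are Lipschitz in $p$ and there exists $C_{2,H}>0$ such that $D^2_{pp}H(x,p)\le-C_{2,H}$. Controls and equilibria. A stationary Markovian control is a map $\alpha:[d]\to\mathbb{R}^d$ with $\alpha(x)=(\alpha_{xy})_{y\in[d]}$ a rate vector at $x$ (equivalently, a transition-rate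 matrix with off-diagonal rates in $\mathbb{A}$); $\mathcal{A}_s$ is the set of these. Given $\alpha\in\mathcal{A}_s$, $X^\alpha$ is the continuous-time Markov jump process of the representative player on $[d]$, with $X^\alpha_0=x_0$ a fixed state, that jumps from $x$ to $y\ne x$ at rate $\alpha_{xy}$. For a flow $\mu:[0,\infty)\to\mathcal{P}([d])$ the ergodic cost is $$J_0(\alpha,\mu)=\limsup_{T\to\infty}\frac1T\,\mathbb{E}\Big[\int_0^T\{f(X^\alpha_t,\alpha(X^\alpha_t))+F(X^\alpha_t,\mu(t))\}dt\Big].$$ A pair $(\tilde\alpha,\tilde\mu)\in\mathcal{A}_s\times\mathcal{C}^1([0,\infty),\mathcal{P}([d]))$ is a stationary ergodic mean field equilibrium (starting at $x_0$) if $X^{\tilde\alpha}_0=x_0$, the law of $X^{\tilde\alpha}_t$ is $\tilde\mu(t)$ for all $t\ge0$, and $J_0(\tilde\alpha,\tilde\mu)=\min_{\alpha'\in\mathcal{A}_s}J_0(\alpha',\tilde\mu)$.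
   Formalization: In (i), unique solvability is for ū^r in R^d; ū^r in (0,∞)^d is asserted only if f+F>0 or ϱ̄>0 (it fails for very negative costs); in (A5), D²H≤−C is asked only for q with q_x=0 (H ignores constants in p); in (A3), D_yz is the limit only where η_y>0. *)

theory Defs
  imports "HOL-Probability.Probability"
begin

text \<open>The state space is a finite type \<open>'d\<close>; vectors in \<open>\<real>\<^sup>d\<close> are elements of
  \<open>real ^ 'd\<close>. The action set is the interval \<open>{al..au}\<close>.\<close>

definition prob_simplex :: "(real ^ 'd::finite) set" where
  "prob_simplex = {\<eta>. (\<forall>x. 0 \<le> \<eta> $ x) \<and> (\<Sum>x\<in>UNIV. \<eta> $ x) = 1}"

definition zero_sum :: "(real ^ 'd::finite) set" where
  "zero_sum = {m. (\<Sum>x\<in>UNIV. m $ x) = 0}"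

definition Delta :: "'d::finite \<Rightarrow> real ^ 'd \<Rightarrow> real ^ 'd" where
  "Delta x p = (\<chi> y. p $ y - p $ x)"


subsection \<open>Derivatives on the simplex\<close>

text \<open>The one-sided difference quotient in direction \<open>e\<^sub>z - e\<^sub>y\<close> only makes sense at points
  \<open>\<eta>\<close> with \<open>\<eta> $ y > 0\<close>, since otherwise \<open>\<eta> + h (e\<^sub>z - e\<^sub>y)\<close> leaves the simplex for every
  \<open>h > 0\<close>; at the remaining boundary points \<open>D y z\<close> is only constrained by the
  regularity that is demanded of it on the whole simplex.\<close>

definition has_simplex_deriv ::
  "(real ^ 'd::finite \<Rightarrow> real) \<Rightarrow> ('d \<Rightarrow> 'd \<Rightarrow> real ^ 'd \<Rightarrow> real) \<Rightarrow> bool" where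
  "has_simplex_deriv K D \<longleftrightarrow>
     (\<forall>y z. \<forall>\<eta>\<in>prob_simplex. y \<noteq> z \<longrightarrow> 0 < \<eta> $ y \<longrightarrow>
        ((\<lambda>h. (K (\<eta> + h *\<^sub>R (axis z 1 - axis y 1)) - K \<eta>) / h) \<longlongrightarrow> D y z \<eta>) (at_right 0))"

definition C1_simplex_lipschitz :: "(real ^ 'd::finite \<Rightarrow> real) \<Rightarrow> bool" where
  "C1_simplex_lipschitz K \<longleftrightarrow>
     (\<exists>D. has_simplex_deriv K D \<and>
        (\<forall>y z. y \<noteq> z \<longrightarrow> continuous_on prob_simplex (D y z)) \<and>
        (\<exists>L. \<forall>y z. y \<noteq> z \<longrightarrow> L-lipschitz_on prob_simplex (D y z)))"


subsection \<open>Hamiltonian\<close>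

definition rate_vectors :: "real \<Rightarrow> real \<Rightarrow> 'd::finite \<Rightarrow> (real ^ 'd) set" where
  "rate_vectors al au x =
     {a. (\<forall>y. y \<noteq> x \<longrightarrow> a $ y \<in> {al..au}) \<and> a $ x = - (\<Sum>y\<in>UNIV - {x}. a $ y)}"

text \<open>The domain of \<open>f x\<close>: the diagonal entry is unconstrained, and \<open>f x\<close> ignores it.\<close>

definition action_domain :: "real \<Rightarrow> real \<Rightarrow> 'd::finite \<Rightarrow> (real ^ 'd) set" where
  "action_domain al au x = {a. \<forall>y. y \<noteq> x \<longrightarrow> a $ y \<in> {al..au}}"

definition hamiltonian ::
  "real \<Rightarrow> real \<Rightarrow> ('d::finite \<Rightarrow> real ^ 'd \<Rightarrow> real) \<Rightarrow> 'd \<Rightarrow> real ^ 'd \<Rightarrow> real" where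
  "hamiltonian al au f x p = (INF a\<in>rate_vectors al au x. f x a + a \<bullet> p)"

definition is_opt_rate ::
  "real \<Rightarrow> real \<Rightarrow> ('d::finite \<Rightarrow> real ^ 'd \<Rightarrow> real) \<Rightarrow> 'd \<Rightarrow> real ^ 'd \<Rightarrow> real ^ 'd \<Rightarrow> bool" where
  "is_opt_rate al au f x p a \<longleftrightarrow>
     is_arg_min (\<lambda>b. f x b + b \<bullet> p) (\<lambda>b. b \<in> rate_vectors al au x) a"

definition opt_rate ::
  "real \<Rightarrow> real \<Rightarrow> ('d::finite \<Rightarrow> real ^ 'd \<Rightarrow> real) \<Rightarrow> 'd \<Rightarrow> real ^ 'd \<Rightarrow> real ^ 'd" where
  "opt_rate al au f x p = (THE a. is_opt_rate al au f x p a)"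

text \<open>Regularity and strict concavity of a Hamiltonian \<open>H\<close>, with gradient \<open>DH\<close> and Hessian \<open>D2H\<close>
  in \<open>p\<close>. Since rate vectors sum to zero, \<open>H x\<close> is invariant under adding constants to \<open>p\<close>, so
  its Hessian annihilates the constant vectors and cannot be negative definite on all of
  \<open>\<real>\<^sup>d\<close>. As \<open>H x\<close> is only evaluated at vectors \<open>\<Delta>\<^sub>x u\<close>, whose \<open>x\<close>-th entry is \<open>0\<close>, the bound
  \<open>D2H x p \<le> - C\<close> is read as an inequality of quadratic forms on \<open>{q. q $ x = 0}\<close>.\<close>

definition regular_hamiltonian :: "('d::finite \<Rightarrow> real ^ 'd \<Rightarrow> real) \<Rightarrow> bool" where
  "regular_hamiltonian H \<longleftrightarrow>
     (\<exists>(DH :: 'd \<Rightarrow> real ^ 'd \<Rightarrow> real ^ 'd) (D2H :: 'd \<Rightarrow> real ^ 'd \<Rightarrow> real ^ 'd ^ 'd).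
        (\<forall>x p. (H x has_derivative (\<lambda>q. DH x p \<bullet> q)) (at p)) \<and>
        (\<forall>x p. (DH x has_derivative (\<lambda>q. D2H x p *v q)) (at p)) \<and>
        (\<forall>x. continuous_on UNIV (D2H x)) \<and>
        (\<forall>K>0.
           (\<exists>L. \<forall>x. L-lipschitz_on (cbox (vec (- K)) (vec K)) (DH x)) \<and>
           (\<exists>L. \<forall>x. L-lipschitz_on (cbox (vec (- K)) (vec K)) (D2H x)) \<and>
           (\<exists>C>0. \<forall>x. \<forall>p\<in>cbox (vec (- K)) (vec K). \<forall>q.
              q $ x = 0 \<longrightarrow> q \<bullet> (D2H x p *v q) \<le> - C * (norm q)\<^sup>2)))"


subsection \<open>Mean field game systems\<close>

text \<open>Solutions of the discounted system are taken in \<open>\<real>\<^sup>d \<times> P([d])\<close>; the sign of \<open>u\<close> is a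
  separate matter, because adding a constant \<open>c\<close> to the running cost adds \<open>c / r\<close> to \<open>u\<close>.\<close>

definition discounted_mfg ::
  "real \<Rightarrow> real \<Rightarrow> ('d::finite \<Rightarrow> real ^ 'd \<Rightarrow> real) \<Rightarrow> ('d \<Rightarrow> real ^ 'd \<Rightarrow> real) \<Rightarrow>
   real \<Rightarrow> real ^ 'd \<Rightarrow> real ^ 'd \<Rightarrow> bool" where
  "discounted_mfg al au f F r u \<mu> \<longleftrightarrow>
     \<mu> \<in> prob_simplex \<and>
     (\<forall>x. - r * u $ x + hamiltonian al au f x (Delta x u) + F x \<mu> = 0) \<and>
     (\<forall>x. (\<Sum>y\<in>UNIV. \<mu> $ y * opt_rate al au f y (Delta y u) $ x) = 0)"

definition ergodic_mfg ::
  "real \<Rightarrow> real \<Rightarrow> ('d::finite \<Rightarrow> real ^ 'd \<Rightarrow> real) \<Rightarrow> ('d \<Rightarrow> real ^ 'd \<Rightarrow> real) \<Rightarrow>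
   real \<Rightarrow> real ^ 'd \<Rightarrow> real ^ 'd \<Rightarrow> bool" where
  "ergodic_mfg al au f F \<rho> u \<mu> \<longleftrightarrow>
     u \<in> zero_sum \<and> \<mu> \<in> prob_simplex \<and>
     (\<forall>x. - \<rho> + hamiltonian al au f x (Delta x u) + F x \<mu> = 0) \<and>
     (\<forall>x. (\<Sum>y\<in>UNIV. \<mu> $ y * opt_rate al au f y (Delta y u) $ x) = 0)"


subsection \<open>Jump processes and equilibria\<close>

definition controls :: "real \<Rightarrow> real \<Rightarrow> ('d::finite \<Rightarrow> real ^ 'd) set" where
  "controls al au = {\<alpha>. \<forall>x. \<alpha> x \<in> rate_vectors al au x}"

definition history :: "'w measure \<Rightarrow> (real \<Rightarrow> 'w \<Rightarrow> 'd) \<Rightarrow> real \<Rightarrow> 'w set set" where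
  "history M X t =
     sigma_sets (space M) {X s -` B \<inter> space M | s B. 0 \<le> s \<and> s \<le> t}"

text \<open>\<open>X\<close> is a continuous-time Markov jump process started at \<open>x0\<close> with jump rates \<open>\<alpha>\<close>: its paths
  are right-continuous with left limits for the discrete topology (hence step functions), and it
  has the Markov property with a time-homogeneous transition function \<open>P\<close> satisfying
  \<open>P h x y = (if x = y then 1 else 0) + h * \<alpha> x $ y + o(h)\<close> as \<open>h\<close> decreases to \<open>0\<close>.\<close>

definition markov_jump_process ::
  "'w measure \<Rightarrow> (real \<Rightarrow> 'w \<Rightarrow> 'd::finite) \<Rightarrow> ('d \<Rightarrow> real ^ 'd) \<Rightarrow> 'd \<Rightarrow> bool" where
  "markov_jump_process M X \<alpha> x0 \<longleftrightarrow>
     prob_space M \<and>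
     (\<forall>t\<ge>0. X t \<in> measurable M (count_space UNIV)) \<and>
     (\<forall>\<omega>\<in>space M. \<forall>t\<ge>0. \<forall>\<^sub>F s in at_right t. X s \<omega> = X t \<omega>) \<and>
     (\<forall>\<omega>\<in>space M. \<forall>t>0. \<exists>z. \<forall>\<^sub>F s in at_left t. X s \<omega> = z) \<and>
     (AE \<omega> in M. X 0 \<omega> = x0) \<and>
     (\<exists>P :: real \<Rightarrow> 'd \<Rightarrow> 'd \<Rightarrow> real.
        (\<forall>x y. ((\<lambda>h. (P h x y - (if x = y then 1 else 0)) / h) \<longlongrightarrow> \<alpha> x $ y) (at_right 0)) \<and>
        (\<forall>t\<ge>0. \<forall>h>0. \<forall>A\<in>history M X t. \<forall>x y.
           measure M (A \<inter> {\<omega>\<in>space M. X t \<omega> = x \<and> X (t + h) \<omega> = y}) =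
           measure M (A \<inter> {\<omega>\<in>space M. X t \<omega> = x}) * P h x y))"

definition law_flow :: "'w measure \<Rightarrow> (real \<Rightarrow> 'w \<Rightarrow> 'd::finite) \<Rightarrow> real \<Rightarrow> real ^ 'd" where
  "law_flow M X t = (\<chi> x. measure M {\<omega>\<in>space M. X t \<omega> = x})"

definition ergodic_cost ::
  "('d::finite \<Rightarrow> real ^ 'd \<Rightarrow> real) \<Rightarrow> ('d \<Rightarrow> real ^ 'd \<Rightarrow> real) \<Rightarrow>
   'w measure \<Rightarrow> (real \<Rightarrow> 'w \<Rightarrow> 'd) \<Rightarrow> ('d \<Rightarrow> real ^ 'd) \<Rightarrow> (real \<Rightarrow> real ^ 'd) \<Rightarrow> ereal" where
  "ergodic_cost f F M X \<alpha> \<mu> =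
     Limsup at_top (\<lambda>T::real. ereal ((1 / T) *
       (\<integral>\<omega>. (LINT t:{0..T}|lborel. f (X t \<omega>) (\<alpha> (X t \<omega>)) + F (X t \<omega>) (\<mu> t)) \<partial>M)))"

definition C1_flow :: "(real \<Rightarrow> real ^ 'd::finite) \<Rightarrow> bool" where
  "C1_flow \<mu> \<longleftrightarrow>
     (\<forall>t\<ge>0. \<mu> t \<in> prob_simplex) \<and>
     (\<exists>\<mu>'. (\<forall>t\<ge>0. (\<mu> has_vector_derivative \<mu>' t) (at t within {0..})) \<and>
           continuous_on {0..} \<mu>')"

text \<open>The representative player's processes are given as a family: for each control \<open>\<alpha>\<close>, the
  process \<open>X \<alpha>\<close> lives on the probability space \<open>M \<alpha>\<close>.\<close>

definition player_processes ::
  "real \<Rightarrow> real \<Rightarrow> (('d::finite \<Rightarrow> real ^ 'd) \<Rightarrow> 'w measure) \<Rightarrow>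
   (('d \<Rightarrow> real ^ 'd) \<Rightarrow> real \<Rightarrow> 'w \<Rightarrow> 'd) \<Rightarrow> 'd \<Rightarrow> bool" where
  "player_processes al au M X x0 \<longleftrightarrow>
     (\<forall>\<alpha>\<in>controls al au. markov_jump_process (M \<alpha>) (X \<alpha>) \<alpha> x0)"

text \<open>The initial condition \<open>X\<^sub>0 = x0\<close> is part of \<open>player_processes\<close>.\<close>

definition ergodic_equilibrium ::
  "real \<Rightarrow> real \<Rightarrow> ('d::finite \<Rightarrow> real ^ 'd \<Rightarrow> real) \<Rightarrow> ('d \<Rightarrow> real ^ 'd \<Rightarrow> real) \<Rightarrow>
   (('d \<Rightarrow> real ^ 'd) \<Rightarrow> 'w measure) \<Rightarrow> (('d \<Rightarrow> real ^ 'd) \<Rightarrow> real \<Rightarrow> 'w \<Rightarrow> 'd) \<Rightarrow>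
   ('d \<Rightarrow> real ^ 'd) \<Rightarrow> (real \<Rightarrow> real ^ 'd) \<Rightarrow> bool" where
  "ergodic_equilibrium al au f F M X \<alpha> \<mu> \<longleftrightarrow>
     \<alpha> \<in> controls al au \<and> C1_flow \<mu> \<and>
     (\<forall>t\<ge>0. law_flow (M \<alpha>) (X \<alpha>) t = \<mu> t) \<and>
     (\<forall>\<alpha>'\<in>controls al au.
        ergodic_cost f F (M \<alpha>) (X \<alpha>) \<alpha> \<mu> \<le> ergodic_cost f F (M \<alpha>') (X \<alpha>') \<alpha>' \<mu>)"

end

theory Submission
  imports Defs
begin

text \<open>
  The two systems are treated as one. Writing \<open>u = v + \<rho> / r\<close> with \<open>v\<close> zero-sum turns the
  discounted system into \<open>r v\<^sub>x + \<rho> = H(x, \<Delta>\<^sub>x v) + F(x, \<mu>)\<close> with \<open>\<mu>\<close> invariant for the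
  feedback rates of \<open>v\<close>; for \<open>r = 0\<close> this is the ergodic system (\<open>solves_mfg\<close>). All transition
  rates lie in \<open>[al, au]\<close> with \<open>al > 0\<close>, so every pair of states communicates at rate at least
  \<open>al\<close>. Comparison with the complete graph therefore gives explicit constants everywhere: the
  maximum principle bounds the oscillation of \<open>v\<close> uniformly in \<open>r\<close> (\<open>solves_mfg_osc\<close>),
  invariant distributions are bounded below (\<open>invariant_dist_lower_bound\<close>), and they depend
  Lipschitz continuously on the rates (\<open>invariant_dist_stability\<close>).

  Existence for each \<open>r \<ge> 0\<close> is one application of Brouwer's theorem to \<open>v\<close> and \<open>\<mu>\<close> jointly
  (\<open>solves_mfg_exists\<close>). It needs continuity of \<open>F\<close>, and the convergence rate needs a
  Lipschitz bound; both are extracted from the one-sided derivatives by moving mass between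
  coordinates (\<open>C1_simplex_imp_l1_lipschitz\<close>).

  For uniqueness and for the limit \<open>r \<rightarrow> 0\<close>, the equations of two solutions are subtracted and
  paired with \<open>\<mu> - \<mu>'\<close> (\<open>mfg_duality_estimate\<close>). The gradient of \<open>H\<close> is the optimal rate by
  the envelope theorem, so strict concavity of \<open>H\<close> yields \<open>k * \<Sum> |\<Delta>\<^sub>x (v - v')|\<^sup>2 \<le> \<langle>r v - r'
  v', \<mu> - \<mu>'\<rangle>\<close> with \<open>k > 0\<close> independent of \<open>r\<close>. As \<open>\<mu> - \<mu>'\<close> is controlled by the gradients,
  the right-hand side for \<open>r = r'\<close> is absorbed when \<open>r\<close> is small, and for \<open>r' = 0\<close> it shows
  that the distance is even \<open>O(r)\<close>, which is stronger than the rate claimed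
  (\<open>mfg_uniform_estimates\<close>).

  For the equilibria, the law of the jump process solves the forward equation, and its
  relative variance decays exponentially (\<open>law_flow_tendsto_invariant\<close>). Hence the ergodic
  cost of a control is the average of the running cost under its invariant distribution, with
  the population at its limit (\<open>ergodic_cost_eq_average\<close>). By the verification identity
  (\<open>average_cost_gap\<close>), the controls that minimize this average are exactly the optimal
  feedback of the Hamilton-Jacobi equation, which gives both directions of the correspondence.
\<close>

section \<open>Probability vectors and rate matrices\<close>

lemma prob_simplexD:
  assumes "\<mu> \<in> prob_simplex"
  shows "0 \<le> \<mu> $ x" "(\<Sum>x\<in>UNIV. \<mu> $ x) = 1" "\<mu> $ x \<le> 1"
proof -
  show 0: "0 \<le> \<mu> $ x" and 1: "(\<Sum>x\<in>UNIV. \<mu> $ x) = 1" for x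
    using assms by (auto simp: prob_simplex_def)
  show "\<mu> $ x \<le> 1"
    using member_le_sum[of x UNIV "\<lambda>x. \<mu> $ x"] 0 1 by auto
qed

lemma compact_prob_simplex: "compact (prob_simplex :: (real ^ 'd::finite) set)"
proof -
  have "bounded (prob_simplex :: (real ^ 'd) set)"
  proof (rule boundedI)
    fix \<mu> :: "real ^ 'd" assume \<mu>: "\<mu> \<in> prob_simplex"
    have "norm \<mu> \<le> (\<Sum>x\<in>UNIV. \<bar>\<mu> $ x\<bar>)" by (rule norm_le_l1_cart)
    then show "norm \<mu> \<le> 1" using prob_simplexD[OF \<mu>] by simp
  qed
  moreover have "closed (prob_simplex :: (real ^ 'd) set)"
    unfolding prob_simplex_def
    by (intro closed_Collect_conj closed_Collect_all closed_Collect_le closed_Collect_eq continuous_intros)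
  ultimately show ?thesis by (simp add: compact_eq_bounded_closed)
qed

lemma convex_prob_simplex: "convex prob_simplex"
  unfolding convex_def prob_simplex_def
  by (auto simp: sum.distrib sum_distrib_left[symmetric])

lemma axis_in_prob_simplex: "axis x 1 \<in> prob_simplex"
  by (auto simp: prob_simplex_def axis_def)

lemma prob_simplex_diff_zero_sum:
  "\<mu> \<in> prob_simplex \<Longrightarrow> \<mu>' \<in> prob_simplex \<Longrightarrow> \<mu> - \<mu>' \<in> zero_sum"
  by (simp add: prob_simplex_def zero_sum_def sum_subtractf)

definition invariant_dist :: "('d::finite \<Rightarrow> real ^ 'd) \<Rightarrow> real ^ 'd \<Rightarrow> bool" where
  "invariant_dist \<alpha> \<mu> \<longleftrightarrow> \<mu> \<in> prob_simplex \<and> (\<forall>x. (\<Sum>y\<in>UNIV. \<mu> $ y * \<alpha> y $ x) = 0)"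

lemma rate_vector_sum_zero:
  assumes "a \<in> rate_vectors al au x"
  shows "(\<Sum>y\<in>UNIV. a $ y) = 0"
proof -
  have "(\<Sum>y\<in>UNIV. a $ y) = a $ x + (\<Sum>y\<in>UNIV - {x}. a $ y)"
    by (simp add: sum.remove)
  then show ?thesis using assms by (simp add: rate_vectors_def)
qed

text \<open>Because the entries of a rate vector sum to zero, the product with \<open>w\<close> only sees the
  differences of \<open>w\<close>. In particular the passage from \<open>w\<close> to \<open>Delta x w\<close> does not change it.\<close>

lemma rate_dot_eq_diff:
  assumes "a \<in> rate_vectors al au x"
  shows "a \<bullet> w = (\<Sum>y\<in>UNIV - {x}. a $ y * (w $ y - w $ x))"
proof -
  have "(\<Sum>y\<in>UNIV - {x}. a $ y * (w $ y - w $ x)) = (\<Sum>y\<in>UNIV. a $ y * (w $ y - w $ x))"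
    by (simp add: sum.remove[of UNIV x])
  also have "\<dots> = a \<bullet> w - (\<Sum>y\<in>UNIV. a $ y) * w $ x"
    by (simp add: inner_vec_def algebra_simps sum_subtractf sum_distrib_left sum_distrib_right)
  finally show ?thesis using rate_vector_sum_zero[OF assms] by simp
qed

lemma rate_dot_Delta:
  assumes "a \<in> rate_vectors al au x"
  shows "a \<bullet> Delta x w = a \<bullet> w"
  unfolding rate_dot_eq_diff[OF assms] by (simp add: Delta_def)

text \<open>A quantitative maximum principle: at a maximum of \<open>w\<close> every term \<open>a $ y * (w $ y - w $ x)\<close>
  is nonpositive, and replacing the rate \<open>a $ y\<close> by its lower bound \<open>al\<close> can only increase it.
  The bound is the action of the complete graph with all rates equal to \<open>al\<close>, so it is
  explicit.\<close>

lemma rate_dot_at_max: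
  assumes a: "a \<in> rate_vectors al au x" and max: "\<And>y. w $ y \<le> w $ x"
  shows "a \<bullet> w \<le> al * ((\<Sum>y\<in>UNIV. w $ y) - real CARD('d) * w $ (x :: 'd::finite))"
proof -
  have "a \<bullet> w \<le> (\<Sum>y\<in>UNIV - {x}. al * (w $ y - w $ x))"
    unfolding rate_dot_eq_diff[OF a] using a max
    by (intro sum_mono mult_right_mono_neg) (auto simp: rate_vectors_def)
  also have "\<dots> = (\<Sum>y\<in>UNIV. al * (w $ y - w $ x))"
    by (simp add: sum.remove[of UNIV x])
  also have "\<dots> = al * ((\<Sum>y\<in>UNIV. w $ y) - real CARD('d) * w $ x)"
    by (simp add: sum_distrib_left[symmetric] sum_subtractf)
  finally show ?thesis .
qed

lemma rate_dot_at_min: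
  assumes a: "a \<in> rate_vectors al au x" and min: "\<And>y. w $ x \<le> w $ y"
  shows "al * ((\<Sum>y\<in>UNIV. w $ y) - real CARD('d) * w $ (x :: 'd::finite)) \<le> a \<bullet> w"
  using rate_dot_at_max[OF a, of "- w"] min by (simp add: sum_negf algebra_simps)

text \<open>The one-sided bound needed away from a maximum: the complete-graph part of the rates acts on
  zero-sum vectors as multiplication by \<open>- al * CARD('d)\<close>, and the rest has rates at most
  \<open>au - al\<close>. That the coefficient of \<open>b\<close> is \<open>au - al\<close> rather than \<open>au\<close> is what later keeps the
  oscillation under control.\<close>

lemma rate_dot_le:
  assumes a: "a \<in> rate_vectors al au x" and w: "w \<in> zero_sum" and le: "\<And>y. w $ y \<le> b"
    and au: "al \<le> au"
  shows "a \<bullet> w \<le> real CARD('d) * ((au - al) * b - au * w $ (x :: 'd::finite))"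
proof -
  have "a \<bullet> w = (\<Sum>y\<in>UNIV - {x}. (a $ y - al) * (w $ y - w $ x)) + (\<Sum>y\<in>UNIV - {x}. al * (w $ y - w $ x))"
    unfolding rate_dot_eq_diff[OF a] by (simp add: sum.distrib[symmetric] algebra_simps)
  also have "(\<Sum>y\<in>UNIV - {x}. (a $ y - al) * (w $ y - w $ x)) \<le> (\<Sum>y\<in>UNIV - {x}. (au - al) * (b - w $ x))"
  proof (rule sum_mono)
    fix y assume y: "y \<in> UNIV - {x}"
    have ay: "0 \<le> a $ y - al" "a $ y - al \<le> au - al" using a y by (auto simp: rate_vectors_def)
    have "(a $ y - al) * (w $ y - w $ x) \<le> (a $ y - al) * (b - w $ x)"
      using ay le by (intro mult_left_mono) (auto simp: diff_right_mono)
    also have "\<dots> \<le> (au - al) * (b - w $ x)"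
      using ay le by (intro mult_right_mono) auto
    finally show "(a $ y - al) * (w $ y - w $ x) \<le> (au - al) * (b - w $ x)" .
  qed
  also have "\<dots> \<le> (\<Sum>y\<in>(UNIV :: 'd set). (au - al) * (b - w $ x))"
    using au le by (intro sum_mono2) auto
  also have "(\<Sum>y\<in>UNIV - {x}. al * (w $ y - w $ x)) = (\<Sum>y\<in>UNIV. al * (w $ y - w $ x))"
    by (simp add: sum.remove[of UNIV x])
  also have "\<dots> = al * ((\<Sum>y\<in>UNIV. w $ y) - real CARD('d) * w $ x)"
    by (simp add: sum_distrib_left[symmetric] sum_subtractf)
  also have "(\<Sum>y\<in>UNIV. w $ y) = 0" using w by (simp add: zero_sum_def)
  finally show ?thesis by (simp add: algebra_simps)
qed

lemma rate_dot_ge: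
  assumes a: "a \<in> rate_vectors al au x" and w: "w \<in> zero_sum" and ge: "\<And>y. b \<le> w $ y"
    and au: "al \<le> au"
  shows "real CARD('d) * ((au - al) * b - au * w $ (x :: 'd::finite)) \<le> a \<bullet> w"
proof -
  have "- w \<in> zero_sum" using w by (simp add: zero_sum_def sum_negf)
  from rate_dot_le[OF a this, of "- b"] ge au show ?thesis by (simp add: algebra_simps)
qed

lemma exit_rate_le:
  assumes a: "a \<in> rate_vectors al au x" and au: "0 \<le> au"
  shows "- (real CARD('d) * au) \<le> a $ (x :: 'd::finite)"
proof -
  have "(\<Sum>y\<in>UNIV - {x}. a $ y) \<le> (\<Sum>y\<in>UNIV - {x}. au)"
    using a by (intro sum_mono) (auto simp: rate_vectors_def)
  also have "\<dots> \<le> (\<Sum>y\<in>(UNIV :: 'd set). au)" using au by (intro sum_mono2) auto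
  finally show ?thesis using a by (simp add: rate_vectors_def)
qed

lemma norm_rate_vector_le:
  assumes a: "a \<in> rate_vectors al au (x :: 'd::finite)" and al: "0 \<le> al" "al \<le> au"
  shows "norm a \<le> 2 * real CARD('d) * au"
proof -
  have "norm a \<le> (\<Sum>y\<in>UNIV. \<bar>a $ y\<bar>)" by (rule norm_le_l1_cart)
  also have "\<dots> = \<bar>a $ x\<bar> + (\<Sum>y\<in>UNIV - {x}. \<bar>a $ y\<bar>)" by (simp add: sum.remove)
  also have "(\<Sum>y\<in>UNIV - {x}. \<bar>a $ y\<bar>) = (\<Sum>y\<in>UNIV - {x}. a $ y)"
    using a al by (intro sum.cong refl) (auto simp: rate_vectors_def intro!: abs_of_nonneg order_trans[OF al(1)])
  also have "\<dots> = - a $ x" using a by (simp add: rate_vectors_def)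
  also have "\<bar>a $ x\<bar> = - a $ x"
  proof -
    have "0 \<le> (\<Sum>y\<in>UNIV - {x}. a $ y)"
      using a al by (intro sum_nonneg) (auto simp: rate_vectors_def intro: order_trans[OF al(1)])
    then show ?thesis using a by (simp add: rate_vectors_def)
  qed
  finally show ?thesis using exit_rate_le[OF a] al by simp
qed

lemma controls_offdiag:
  assumes "\<alpha> \<in> controls al au" "y \<noteq> x"
  shows "al \<le> \<alpha> y $ x" "\<alpha> y $ x \<le> au"
  using assms by (auto simp: controls_def rate_vectors_def)

lemma sum_generator_zero:
  assumes "\<alpha> \<in> controls al au"
  shows "(\<Sum>x\<in>UNIV. \<Sum>y\<in>UNIV. m $ y * \<alpha> y $ x) = 0"
proof -
  have "(\<Sum>x\<in>UNIV. \<Sum>y\<in>UNIV. m $ y * \<alpha> y $ x) = (\<Sum>y\<in>UNIV. m $ y * (\<Sum>x\<in>UNIV. \<alpha> y $ x))"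
    by (subst sum.swap) (simp add: sum_distrib_left)
  also have "\<dots> = 0"
    using assms rate_vector_sum_zero by (intro sum.neutral ballI) (fastforce simp: controls_def)
  finally show ?thesis .
qed

text \<open>Summation by parts: the generator acting on \<open>w\<close>, averaged over \<open>m\<close>, is \<open>w\<close> paired with the
  adjoint generator acting on \<open>m\<close>.\<close>

lemma generator_duality:
  fixes \<alpha> :: "'d::finite \<Rightarrow> real ^ 'd"
  shows "(\<Sum>y\<in>UNIV. m $ y * (\<alpha> y \<bullet> w)) = (\<Sum>x\<in>UNIV. w $ x * (\<Sum>y\<in>UNIV. m $ y * \<alpha> y $ x))"
  unfolding inner_vec_def sum_distrib_left
  by (subst sum.swap) (simp add: algebra_simps)

lemma invariant_dist_dot:
  assumes "\<alpha> \<in> controls al au" "invariant_dist \<alpha> \<mu>"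
  shows "(\<Sum>x\<in>UNIV. \<mu> $ x * (\<alpha> x \<bullet> Delta x w)) = 0"
proof -
  have "(\<Sum>x\<in>UNIV. \<mu> $ x * (\<alpha> x \<bullet> Delta x w)) = (\<Sum>x\<in>UNIV. \<mu> $ x * (\<alpha> x \<bullet> w))"
    using assms(1) rate_dot_Delta by (intro sum.cong refl) (fastforce simp: controls_def)
  then show ?thesis
    using assms(2) by (simp add: generator_duality invariant_dist_def)
qed

text \<open>One explicit Euler step of the forward equation. The step size keeps the diagonal of the
  transition matrix nonnegative, because exit rates are at most \<open>CARD('d) * au\<close>.\<close>

lemma euler_step_in_simplex:
  fixes \<alpha> :: "'d::finite \<Rightarrow> real ^ 'd"
  assumes \<alpha>: "\<alpha> \<in> controls al au" and \<mu>: "\<mu> \<in> prob_simplex"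
    and al: "0 \<le> al" "0 \<le> au" and e: "0 \<le> e" "e * (real CARD('d) * au) \<le> 1"
  shows "(\<chi> x. \<mu> $ x + e * (\<Sum>y\<in>UNIV. \<mu> $ y * \<alpha> y $ x)) \<in> prob_simplex"
proof -
  have "0 \<le> \<mu> $ x + e * (\<Sum>y\<in>UNIV. \<mu> $ y * \<alpha> y $ x)" for x
  proof -
    have ax: "\<alpha> y \<in> rate_vectors al au y" for y using \<alpha> by (simp add: controls_def)
    have "0 \<le> (\<Sum>y\<in>UNIV - {x}. \<mu> $ y * \<alpha> y $ x)"
      using al prob_simplexD(1)[OF \<mu>]
      by (auto intro!: sum_nonneg mult_nonneg_nonneg intro: order_trans[OF al(1) controls_offdiag(1)[OF \<alpha>]])
    then have "\<mu> $ x * \<alpha> x $ x \<le> (\<Sum>y\<in>UNIV. \<mu> $ y * \<alpha> y $ x)"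
      by (simp add: sum.remove[of UNIV x])
    moreover have "\<mu> $ x * - (real CARD('d) * au) \<le> \<mu> $ x * \<alpha> x $ x"
      using exit_rate_le[OF ax al(2)] prob_simplexD(1)[OF \<mu>] by (intro mult_left_mono) auto
    ultimately have "e * (\<mu> $ x * - (real CARD('d) * au)) \<le> e * (\<Sum>y\<in>UNIV. \<mu> $ y * \<alpha> y $ x)"
      using e by (intro mult_left_mono) auto
    moreover have "\<mu> $ x * (e * (real CARD('d) * au)) \<le> \<mu> $ x * 1"
      using e prob_simplexD(1)[OF \<mu>] by (intro mult_left_mono) auto
    ultimately show ?thesis by (simp add: algebra_simps)
  qed
  moreover have "(\<Sum>x\<in>UNIV. \<mu> $ x + e * (\<Sum>y\<in>UNIV. \<mu> $ y * \<alpha> y $ x)) = 1"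
    using sum_generator_zero[OF \<alpha>, of \<mu>] prob_simplexD(2)[OF \<mu>]
    by (simp add: sum.distrib sum_distrib_left[symmetric])
  ultimately show ?thesis by (simp add: prob_simplex_def)
qed

text \<open>Invariant distributions are the fixed points of the Euler step, which Brouwer provides.\<close>

lemma invariant_dist_exists:
  fixes \<alpha> :: "'d::finite \<Rightarrow> real ^ 'd"
  assumes \<alpha>: "\<alpha> \<in> controls al au" and al: "0 \<le> al" "0 < au"
  obtains \<mu> where "invariant_dist \<alpha> \<mu>"
proof -
  define e where "e = 1 / (real CARD('d) * au)"
  have e: "0 < e" "e * (real CARD('d) * au) \<le> 1" using al by (auto simp: e_def)
  let ?T = "\<lambda>\<mu> :: real ^ 'd. \<chi> x. \<mu> $ x + e * (\<Sum>y\<in>UNIV. \<mu> $ y * \<alpha> y $ x)"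
  obtain \<mu> where \<mu>: "\<mu> \<in> prob_simplex" "?T \<mu> = \<mu>"
  proof (rule brouwer[of "prob_simplex :: (real ^ 'd) set" ?T])
    show "continuous_on prob_simplex ?T" by (intro continuous_intros)
    show "?T \<in> prob_simplex \<rightarrow> prob_simplex"
      using euler_step_in_simplex[OF \<alpha> _ al(1) _ _ e(2)] e al by auto
  qed (use compact_prob_simplex convex_prob_simplex axis_in_prob_simplex in auto)
  from \<mu>(2) e(1) have "invariant_dist \<alpha> \<mu>"
    using \<mu>(1) by (auto simp: vec_eq_iff invariant_dist_def)
  then show ?thesis by (rule that)
qed

text \<open>Balance of flow at \<open>x\<close>: mass enters at rate at least \<open>al\<close> from everywhere else and leaves at
  rate at most \<open>CARD('d) * au\<close>.\<close>

lemma invariant_dist_lower_bound: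
  fixes \<alpha> :: "'d::finite \<Rightarrow> real ^ 'd"
  assumes \<alpha>: "\<alpha> \<in> controls al au" and \<mu>: "invariant_dist \<alpha> \<mu>" and al: "0 < al" "0 \<le> au"
  shows "al / (al + real CARD('d) * au) \<le> \<mu> $ x"
proof -
  have \<mu>s: "\<mu> \<in> prob_simplex" using \<mu> by (simp add: invariant_dist_def)
  have ax: "\<alpha> y \<in> rate_vectors al au y" for y using \<alpha> by (simp add: controls_def)
  have "al * (1 - \<mu> $ x) = (\<Sum>y\<in>UNIV - {x}. \<mu> $ y * al)"
    using prob_simplexD(2)[OF \<mu>s] by (simp add: sum.remove[of UNIV x] sum_distrib_right[symmetric])
  also have "\<dots> \<le> (\<Sum>y\<in>UNIV - {x}. \<mu> $ y * \<alpha> y $ x)"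
    using controls_offdiag(1)[OF \<alpha>] prob_simplexD(1)[OF \<mu>s]
    by (auto intro!: sum_mono mult_left_mono)
  also have "\<dots> = \<mu> $ x * - \<alpha> x $ x"
    using \<mu> by (simp add: invariant_dist_def sum.remove[of UNIV x] eq_neg_iff_add_eq_0 add.commute)
  also have "\<dots> \<le> \<mu> $ x * (real CARD('d) * au)"
    using exit_rate_le[OF ax al(2), of x] prob_simplexD(1)[OF \<mu>s] by (intro mult_left_mono) auto
  finally have "al \<le> \<mu> $ x * (al + real CARD('d) * au)" by (simp add: algebra_simps)
  moreover have "0 < al + real CARD('d) * au" using al by (simp add: add_pos_nonneg)
  ultimately show ?thesis by (simp add: divide_le_eq)
qed

text \<open>Testing the adjoint generator with the signs of \<open>m\<close> gives a spectral gap in \<open>\<ell>\<^sup>1\<close>: for each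
  \<open>y\<close> the vector \<open>m $ y * sgn (m $ x)\<close> has its maximum at \<open>x = y\<close>, so the maximum principle
  applies, and the sum over \<open>y\<close> of the remaining mean terms vanishes since \<open>m\<close> is zero-sum.\<close>

lemma l1_generator_lower_bound:
  fixes \<alpha> :: "'d::finite \<Rightarrow> real ^ 'd"
  assumes \<alpha>: "\<alpha> \<in> controls al au" and m: "m \<in> zero_sum"
  shows "al * real CARD('d) * (\<Sum>x\<in>UNIV. \<bar>m $ x\<bar>) \<le> (\<Sum>x\<in>UNIV. \<bar>\<Sum>y\<in>UNIV. m $ y * \<alpha> y $ x\<bar>)"
proof -
  let ?s = "\<chi> x. sgn (m $ x)"
  have ax: "\<alpha> y \<in> rate_vectors al au y" for y using \<alpha> by (simp add: controls_def)
  have row: "m $ y * (\<alpha> y \<bullet> ?s) \<le> m $ y * (al * (\<Sum>x\<in>UNIV. ?s $ x)) - al * real CARD('d) * \<bar>m $ y\<bar>" for y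
  proof -
    have "m $ y * sgn (m $ x) \<le> \<bar>m $ y\<bar>" for x by (auto simp: sgn_if)
    then have "\<alpha> y \<bullet> (m $ y *\<^sub>R ?s) \<le>
        al * ((\<Sum>x\<in>UNIV. (m $ y *\<^sub>R ?s) $ x) - real CARD('d) * (m $ y *\<^sub>R ?s) $ y)"
      by (intro rate_dot_at_max[OF ax]) (simp add: abs_sgn)
    then show ?thesis by (simp add: sum_distrib_left[symmetric] algebra_simps abs_sgn)
  qed
  have "(\<Sum>y\<in>UNIV. m $ y * (\<alpha> y \<bullet> ?s)) \<le>
      (\<Sum>y\<in>UNIV. m $ y * (al * (\<Sum>x\<in>UNIV. ?s $ x)) - al * real CARD('d) * \<bar>m $ y\<bar>)"
    by (intro sum_mono row)
  also have "\<dots> = - (al * real CARD('d) * (\<Sum>x\<in>UNIV. \<bar>m $ x\<bar>))"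
    using m by (simp add: sum_subtractf sum_distrib_left[symmetric] sum_distrib_right[symmetric] zero_sum_def)
  finally have "al * real CARD('d) * (\<Sum>x\<in>UNIV. \<bar>m $ x\<bar>) \<le> - (\<Sum>y\<in>UNIV. m $ y * (\<alpha> y \<bullet> ?s))"
    by linarith
  also have "\<dots> \<le> (\<Sum>x\<in>UNIV. \<bar>\<Sum>y\<in>UNIV. m $ y * \<alpha> y $ x\<bar>)"
    unfolding generator_duality sum_negf[symmetric]
    by (intro sum_mono) (auto simp: sgn_if)
  finally show ?thesis .
qed

text \<open>The difference of two invariant distributions is zero-sum, and the generator of the first
  sends it to a source term made of the differences of the rates. The \<open>\<ell>\<^sup>1\<close> gap turns this
  into a Lipschitz bound; for equal rates it is uniqueness.\<close>

lemma invariant_dist_stability: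
  fixes \<alpha> \<beta> :: "'d::finite \<Rightarrow> real ^ 'd"
  assumes \<alpha>: "\<alpha> \<in> controls al au" "invariant_dist \<alpha> \<mu>" and \<beta>: "invariant_dist \<beta> \<nu>"
    and al: "0 < al" and d: "\<And>x. norm (\<alpha> x - \<beta> x) \<le> d"
  shows "(\<Sum>x\<in>UNIV. \<bar>\<mu> $ x - \<nu> $ x\<bar>) \<le> d / al"
proof -
  have \<mu>: "\<mu> \<in> prob_simplex" and \<nu>: "\<nu> \<in> prob_simplex" using \<alpha> \<beta> by (auto simp: invariant_dist_def)
  have "al * real CARD('d) * (\<Sum>x\<in>UNIV. \<bar>(\<mu> - \<nu>) $ x\<bar>)
      \<le> (\<Sum>x\<in>UNIV. \<bar>\<Sum>y\<in>UNIV. (\<mu> - \<nu>) $ y * \<alpha> y $ x\<bar>)"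
    by (rule l1_generator_lower_bound[OF \<alpha>(1) prob_simplex_diff_zero_sum[OF \<mu> \<nu>]])
  also have "\<dots> \<le> (\<Sum>x\<in>(UNIV::'d set). d)"
  proof (rule sum_mono)
    fix x
    have "(\<Sum>y\<in>UNIV. (\<mu> - \<nu>) $ y * \<alpha> y $ x) = - (\<Sum>y\<in>UNIV. \<nu> $ y * (\<alpha> y - \<beta> y) $ x)"
      using \<alpha>(2) \<beta> by (simp add: invariant_dist_def algebra_simps sum_subtractf)
    also have "\<bar>\<dots>\<bar> \<le> (\<Sum>y\<in>UNIV. \<bar>\<nu> $ y * (\<alpha> y - \<beta> y) $ x\<bar>)" by (simp add: sum_abs)
    also have "\<dots> \<le> (\<Sum>y\<in>UNIV. \<nu> $ y * d)"
      using prob_simplexD(1)[OF \<nu>] order_trans[OF component_le_norm_cart d]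
      by (auto simp: abs_mult intro!: sum_mono mult_left_mono)
    also have "\<dots> = d" using prob_simplexD(2)[OF \<nu>] by (simp add: sum_distrib_right[symmetric])
    finally show "\<bar>\<Sum>y\<in>UNIV. (\<mu> - \<nu>) $ y * \<alpha> y $ x\<bar> \<le> d" .
  qed
  finally show ?thesis using al by (simp add: field_simps)
qed

lemma max_min_component:
  fixes v :: "real ^ 'd::finite"
  obtains x z where "\<And>y. v $ y \<le> v $ x" "\<And>y. v $ z \<le> v $ y"
proof -
  have "(\<lambda>y. v $ y) ` UNIV \<noteq> {}" "finite ((\<lambda>y. v $ y) ` (UNIV :: 'd set))" by auto
  from Max_in[OF this(2,1)] Min_in[OF this(2,1)]
  obtain x z where "v $ x = Max (($) v ` UNIV)" "v $ z = Min (($) v ` UNIV)" by force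
  then show ?thesis using that[of x z] by simp
qed

lemma zero_sum_sign:
  fixes v :: "real ^ 'd::finite"
  assumes v: "v \<in> zero_sum"
  shows "(\<And>y. v $ y \<le> b) \<Longrightarrow> 0 \<le> b" "(\<And>y. b \<le> v $ y) \<Longrightarrow> b \<le> 0"
proof -
  have 0: "(\<Sum>y\<in>UNIV. v $ y) = 0" using v by (simp add: zero_sum_def)
  show "0 \<le> b" if "\<And>y. v $ y \<le> b"
    using sum_bounded_above[of UNIV "\<lambda>y. v $ y" b] 0 that by (simp add: zero_le_mult_iff)
  show "b \<le> 0" if "\<And>y. b \<le> v $ y"
    using sum_bounded_below[of UNIV b "\<lambda>y. v $ y"] 0 that by (simp add: mult_le_0_iff)
qed

lemma Delta_add_const: "Delta x (v + vec c) = Delta x v"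
  by (simp add: Delta_def vec_eq_iff)

section \<open>The Hamiltonian and its minimizing rates\<close>

text \<open>The assumptions on the control problem of the representative player; the coupling cost \<open>F\<close>
  enters only in the individual results.\<close>

locale rate_control =
  fixes al au :: real and f :: "'d::finite \<Rightarrow> real ^ 'd \<Rightarrow> real"
  assumes al: "0 < al" "al < au"
    and unique_opt: "\<And>x p. \<exists>!a. is_opt_rate al au f x p a"
    and regular: "regular_hamiltonian (hamiltonian al au f)"
begin

abbreviation "H \<equiv> hamiltonian al au f"
abbreviation "\<gamma> \<equiv> opt_rate al au f"
abbreviation "feedback u \<equiv> (\<lambda>x. \<gamma> x (Delta x u))"

lemma au_pos: "0 < au"
  using al by simp

lemma opt_rate: "is_opt_rate al au f x p (\<gamma> x p)"
  unfolding opt_rate_def by (rule theI'[OF unique_opt])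

lemma opt_rate_in: "\<gamma> x p \<in> rate_vectors al au x"
  using opt_rate by (auto simp: is_opt_rate_def is_arg_min_def)

lemma feedback_controls: "feedback u \<in> controls al au"
  by (simp add: controls_def opt_rate_in)

lemma opt_rate_le:
  "b \<in> rate_vectors al au x \<Longrightarrow> f x (\<gamma> x p) + \<gamma> x p \<bullet> p \<le> f x b + b \<bullet> p"
  using opt_rate[of x p] by (fastforce simp: is_opt_rate_def is_arg_min_def)

lemma H_eq: "H x p = f x (\<gamma> x p) + \<gamma> x p \<bullet> p"
  unfolding hamiltonian_def
  by (rule cInf_eq_minimum) (use opt_rate_in opt_rate_le in auto)

lemma H_le: "b \<in> rate_vectors al au x \<Longrightarrow> H x p \<le> f x b + b \<bullet> p"
  unfolding H_eq by (rule opt_rate_le)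

lemma H_eq_imp_opt_rate:
  assumes a: "a \<in> rate_vectors al au x" and eq: "f x a + a \<bullet> p = H x p"
  shows "a = \<gamma> x p"
proof -
  have "is_opt_rate al au f x p a"
    using a eq H_le by (force simp: is_opt_rate_def is_arg_min_def not_less)
  then show ?thesis using opt_rate unique_opt by blast
qed

text \<open>An optimal rate for \<open>p\<close> is admissible for \<open>q\<close>: as an infimum of affine functions, the
  Hamiltonian lies below its tangents, whose slopes are the optimal rates.\<close>

lemma H_supergradient: "H x q \<le> H x p + \<gamma> x p \<bullet> (q - p)"
  using H_le[OF opt_rate_in, of x q p] by (simp add: H_eq[of x p] inner_diff_right)

lemma H_lipschitz: "\<bar>H x p - H x q\<bar> \<le> 2 * real CARD('d) * au * norm (p - q)"
proof -
  have le: "H x p - H x q \<le> 2 * real CARD('d) * au * norm (p - q)" for p q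
  proof -
    have "H x p - H x q \<le> \<gamma> x q \<bullet> (p - q)" using H_supergradient[of x p q] by simp
    also have "\<dots> \<le> norm (\<gamma> x q) * norm (p - q)" by (rule norm_cauchy_schwarz)
    also have "\<dots> \<le> 2 * real CARD('d) * au * norm (p - q)"
      using norm_rate_vector_le[OF opt_rate_in] al by (intro mult_right_mono) auto
    finally show ?thesis .
  qed
  from le[of p q] le[of q p] show ?thesis by (simp add: norm_minus_commute abs_le_iff)
qed

lemma continuous_H: "continuous_on S (H x)"
proof -
  have "(2 * real CARD('d) * au)-lipschitz_on UNIV (H x)"
    using H_lipschitz al by (intro lipschitz_onI) (auto simp: dist_norm)
  then show ?thesis
    using lipschitz_on_continuous_on continuous_on_subset by blast
qed

text \<open>Envelope theorem: \<open>H x q - \<gamma> x p \<bullet> q\<close> is maximal at \<open>q = p\<close>, so its derivative there is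
  zero. Hence the regularity assumed of the gradient of \<open>H\<close> is regularity of the optimal
  rates.\<close>

lemma gradient_H_eq_opt_rate:
  assumes "(H x has_derivative (\<lambda>q. D \<bullet> q)) (at p)"
  shows "D = \<gamma> x p"
proof -
  have "((\<lambda>q. H x q - \<gamma> x p \<bullet> q) has_derivative (\<lambda>q. D \<bullet> q - \<gamma> x p \<bullet> q)) (at p)"
    by (intro derivative_intros assms)
  moreover have "\<forall>q\<in>UNIV. H x q - \<gamma> x p \<bullet> q \<le> H x p - \<gamma> x p \<bullet> p"
    using H_supergradient[of x _ p] by (auto simp: inner_diff_right algebra_simps)
  ultimately have "(\<lambda>q. D \<bullet> q - \<gamma> x p \<bullet> q) = (\<lambda>q. 0)"
    by (intro differential_zero_maxmin[of p UNIV]) auto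
  then have "(D - \<gamma> x p) \<bullet> (D - \<gamma> x p) = 0"
    by (metis inner_diff_left)
  then show ?thesis by simp
qed

lemma regular_opt_rate:
  obtains D2H :: "'d \<Rightarrow> real ^ 'd \<Rightarrow> real ^ 'd ^ 'd"
  where "\<And>x p. (H x has_derivative (\<lambda>q. \<gamma> x p \<bullet> q)) (at p)"
    "\<And>x p. (\<gamma> x has_derivative (\<lambda>q. D2H x p *v q)) (at p)"
    "\<And>K. 0 < K \<Longrightarrow> \<exists>L. \<forall>x. L-lipschitz_on (cbox (vec (- K)) (vec K)) (\<gamma> x)"
    "\<And>K. 0 < K \<Longrightarrow> \<exists>C>0. \<forall>x. \<forall>p\<in>cbox (vec (- K)) (vec K). \<forall>q.
              q $ x = 0 \<longrightarrow> q \<bullet> (D2H x p *v q) \<le> - C * (norm q)\<^sup>2"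
proof -
  obtain DH :: "'d \<Rightarrow> real ^ 'd \<Rightarrow> real ^ 'd" and D2H :: "'d \<Rightarrow> real ^ 'd \<Rightarrow> real ^ 'd ^ 'd"
    where D: "\<forall>x p. (H x has_derivative (\<lambda>q. DH x p \<bullet> q)) (at p)"
      and D2: "\<forall>x p. (DH x has_derivative (\<lambda>q. D2H x p *v q)) (at p)"
      and K: "\<forall>K>0. (\<exists>L. \<forall>x. L-lipschitz_on (cbox (vec (- K)) (vec K)) (DH x)) \<and>
           (\<exists>L. \<forall>x. L-lipschitz_on (cbox (vec (- K)) (vec K)) (D2H x)) \<and>
           (\<exists>C>0. \<forall>x. \<forall>p\<in>cbox (vec (- K)) (vec K). \<forall>q.
              q $ x = 0 \<longrightarrow> q \<bullet> (D2H x p *v q) \<le> - C * (norm q)\<^sup>2)"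
    using regular unfolding regular_hamiltonian_def by blast
  have "DH x p = \<gamma> x p" for x p using D gradient_H_eq_opt_rate by blast
  then have "DH = \<gamma>" by (intro ext)
  with D D2 K that show ?thesis by blast
qed

lemma opt_rate_lipschitz:
  assumes "0 < K"
  shows "\<exists>L. \<forall>x. L-lipschitz_on (cbox (vec (- K)) (vec K)) (\<gamma> x)"
proof (rule regular_opt_rate)
  assume "\<And>K. 0 < K \<Longrightarrow> \<exists>L. \<forall>x. L-lipschitz_on (cbox (vec (- K)) (vec K)) (\<gamma> x)"
  from this[OF assms] show ?thesis .
qed

lemma continuous_opt_rate: "continuous_on S (\<gamma> x)"
proof (rule regular_opt_rate)
  fix D2H :: "'d \<Rightarrow> real ^ 'd \<Rightarrow> real ^ 'd ^ 'd"
  assume "\<And>x p. (\<gamma> x has_derivative (\<lambda>q. D2H x p *v q)) (at p)"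
  then show ?thesis
    by (intro continuous_at_imp_continuous_on) (blast intro: has_derivative_continuous)
qed

text \<open>Second-order Taylor bound. It is only available for \<open>p\<close> and \<open>q\<close> with vanishing \<open>x\<close>-th entry,
  since strict concavity is assumed for such directions; the vectors \<open>Delta x u\<close> qualify.\<close>

lemma H_strictly_concave:
  assumes K: "0 < K"
  obtains C where "0 < C"
    "\<And>x p q. p \<in> cbox (vec (- K)) (vec K) \<Longrightarrow> q \<in> cbox (vec (- K)) (vec K) \<Longrightarrow> p $ x = 0 \<Longrightarrow> q $ x = 0 \<Longrightarrow>
       H x q \<le> H x p + \<gamma> x p \<bullet> (q - p) - C / 2 * (norm (q - p))\<^sup>2"
proof (rule regular_opt_rate)
  fix D2H :: "'d \<Rightarrow> real ^ 'd \<Rightarrow> real ^ 'd ^ 'd"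
  assume D: "\<And>x p. (H x has_derivative (\<lambda>q. \<gamma> x p \<bullet> q)) (at p)"
    and D2: "\<And>x p. (\<gamma> x has_derivative (\<lambda>q. D2H x p *v q)) (at p)"
    and CK: "\<And>K. 0 < K \<Longrightarrow> \<exists>C>0. \<forall>x. \<forall>p\<in>cbox (vec (- K)) (vec K). \<forall>q.
              q $ x = 0 \<longrightarrow> q \<bullet> (D2H x p *v q) \<le> - C * (norm q)\<^sup>2"
  from CK[OF K] obtain C where C: "0 < C"
    and neg: "\<And>x p q. p\<in>cbox (vec (- K)) (vec K) \<Longrightarrow>
              q $ x = 0 \<Longrightarrow> q \<bullet> (D2H x p *v q) \<le> - C * (norm q)\<^sup>2" by blast
  have "H x q \<le> H x p + \<gamma> x p \<bullet> (q - p) - C / 2 * (norm (q - p))\<^sup>2"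
    if p: "p \<in> cbox (vec (- K)) (vec K)" "p $ x = 0" and q: "q \<in> cbox (vec (- K)) (vec K)" "q $ x = 0"
    for x p q
  proof -
    let ?d = "q - p"
    let ?l = "\<lambda>t. p + t *\<^sub>R ?d"
    let ?g = "\<lambda>t. H x (?l t) - t * (\<gamma> x p \<bullet> ?d) + C / 2 * t\<^sup>2 * (norm ?d)\<^sup>2"
    let ?g' = "\<lambda>t. \<gamma> x (?l t) \<bullet> ?d - \<gamma> x p \<bullet> ?d + C * t * (norm ?d)\<^sup>2"
    let ?g'' = "\<lambda>t. (D2H x (?l t) *v ?d) \<bullet> ?d + C * (norm ?d)\<^sup>2"
    have l: "(?l has_derivative (\<lambda>s. s *\<^sub>R ?d)) (at t)" for t
      by (auto intro!: derivative_eq_intros)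
    have H': "((\<lambda>t. H x (?l t)) has_derivative (\<lambda>s. \<gamma> x (?l t) \<bullet> (s *\<^sub>R ?d))) (at t)" for t
      by (rule has_derivative_compose[OF l D])
    have g': "(?g has_real_derivative ?g' t) (at t)" for t
      unfolding has_field_derivative_def
      by (rule derivative_eq_intros H' refl)+ (auto simp: fun_eq_iff algebra_simps)
    have \<gamma>': "((\<lambda>t. \<gamma> x (?l t)) has_derivative (\<lambda>s. D2H x (?l t) *v (s *\<^sub>R ?d))) (at t)" for t
      by (rule has_derivative_compose[OF l D2])
    have g'': "(?g' has_real_derivative ?g'' t) (at t)" for t
      unfolding has_field_derivative_def
      by (rule derivative_eq_intros \<gamma>' refl)+
        (simp add: fun_eq_iff matrix_vector_mult_scaleR distrib_left mult.commute mult.left_commute)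
    have box: "?l t \<in> cbox (vec (- K)) (vec K)" if "0 \<le> t" "t \<le> 1" for t
    proof -
      have "?l t = (1 - t) *\<^sub>R p + t *\<^sub>R q" by (simp add: algebra_simps)
      then show ?thesis using convex_box(1) p q that by (metis convexD_alt)
    qed
    have g''_le: "?g'' t \<le> 0" if "0 \<le> t" "t \<le> 1" for t
      using neg[OF box[OF that], of ?d x] p q by (simp add: inner_commute)
    have g'_le: "?g' t \<le> 0" if t: "0 \<le> t" "t \<le> 1" for t
    proof -
      have "?g' t \<le> ?g' 0"
      proof (rule DERIV_nonpos_imp_nonincreasing[OF t(1), where f = ?g'])
        fix s assume "0 \<le> s" "s \<le> t"
        then show "\<exists>y. (?g' has_real_derivative y) (at s) \<and> y \<le> 0"
          using g''[of s] g''_le[of s] t by (intro exI[of _ "?g'' s"]) simp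
      qed
      then show ?thesis by simp
    qed
    have "?g 1 \<le> ?g 0"
    proof (rule DERIV_nonpos_imp_nonincreasing[where f = ?g])
      fix s :: real assume "0 \<le> s" "s \<le> 1"
      then show "\<exists>y. (?g has_real_derivative y) (at s) \<and> y \<le> 0"
        using g'[of s] g'_le[of s] by (intro exI[of _ "?g' s"]) simp
    qed simp
    then show ?thesis by simp
  qed
  with C show ?thesis by (rule that)
qed

text \<open>Comparison with zero gradient, where the second summand is in a form to which the maximum
  principle applies.\<close>

lemma H_Delta_le: "H x (Delta x v) \<le> H x 0 + \<gamma> x 0 \<bullet> v"
  using H_supergradient[of x "Delta x v" 0] by (simp add: rate_dot_Delta[OF opt_rate_in])

lemma H_Delta_ge: "H x 0 + feedback v x \<bullet> v \<le> H x (Delta x v)"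
  using H_supergradient[of x 0 "Delta x v"] by (simp add: rate_dot_Delta[OF opt_rate_in])

section \<open>One system for all discount rates\<close>

text \<open>The value function is split into its zero-sum part \<open>v\<close> and the constant \<open>\<rho> / r\<close>. In these
  unknowns the system still makes sense for \<open>r = 0\<close>, where it is the ergodic one, so that
  existence, a priori bounds and comparison can be proved once for all \<open>r \<ge> 0\<close>.\<close>

definition solves_mfg ::
    "('d \<Rightarrow> real ^ 'd \<Rightarrow> real) \<Rightarrow> real \<Rightarrow> real \<Rightarrow> real ^ 'd \<Rightarrow> real ^ 'd \<Rightarrow> bool" where
  "solves_mfg F r \<rho> v \<mu> \<longleftrightarrow> v \<in> zero_sum \<and>
     (\<forall>x. r * v $ x + \<rho> = H x (Delta x v) + F x \<mu>) \<and> invariant_dist (feedback v) \<mu>"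

lemma ergodic_mfg_iff: "ergodic_mfg al au f F \<rho> u \<mu> \<longleftrightarrow> solves_mfg F 0 \<rho> u \<mu>"
  by (auto simp: ergodic_mfg_def solves_mfg_def invariant_dist_def algebra_simps)

lemma discounted_mfg_iff:
  assumes r: "0 < r"
  shows "discounted_mfg al au f F r u \<mu> \<longleftrightarrow> (\<exists>\<rho> v. u = v + vec (\<rho> / r) \<and> solves_mfg F r \<rho> v \<mu>)"
proof
  assume *: "discounted_mfg al au f F r u \<mu>"
  define c where "c = (\<Sum>x\<in>UNIV. u $ x) / real CARD('d)"
  define v where "v = u - vec c"
  have u: "u = v + vec c" by (simp add: v_def)
  have "v \<in> zero_sum" by (simp add: v_def zero_sum_def sum_subtractf c_def)
  moreover have "r * v $ x + r * c = H x (Delta x v) + F x \<mu>" for x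
  proof -
    have "r * u $ x = H x (Delta x u) + F x \<mu>"
      using * by (auto simp: discounted_mfg_def algebra_simps add_eq_0_iff2)
    then show ?thesis unfolding u Delta_add_const by (simp add: algebra_simps)
  qed
  moreover have "invariant_dist (feedback v) \<mu>"
    using * unfolding discounted_mfg_def u Delta_add_const by (simp add: invariant_dist_def)
  ultimately have "solves_mfg F r (r * c) v \<mu>" by (simp add: solves_mfg_def)
  moreover have "u = v + vec (r * c / r)" using u r by simp
  ultimately show "\<exists>\<rho> v. u = v + vec (\<rho> / r) \<and> solves_mfg F r \<rho> v \<mu>" by blast
next
  assume "\<exists>\<rho> v. u = v + vec (\<rho> / r) \<and> solves_mfg F r \<rho> v \<mu>"
  then obtain \<rho> v where u: "u = v + vec (\<rho> / r)" and v: "solves_mfg F r \<rho> v \<mu>" by blast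
  have "- r * u $ x + H x (Delta x u) + F x \<mu> = 0" for x
  proof -
    have "r * v $ x + \<rho> = H x (Delta x v) + F x \<mu>" using v by (simp add: solves_mfg_def)
    then show ?thesis unfolding u Delta_add_const using r by (simp add: algebra_simps)
  qed
  then show "discounted_mfg al au f F r u \<mu>"
    using v unfolding discounted_mfg_def u Delta_add_const
    by (simp add: solves_mfg_def invariant_dist_def)
qed

text \<open>The maximum principle in the Hamilton-Jacobi equation, at a maximum and at a minimum of \<open>v\<close>.\<close>

lemma solves_mfg_extremes:
  assumes sol: "solves_mfg F r \<rho> v \<mu>" and B: "\<And>x. \<bar>H x 0 + F x \<mu>\<bar> \<le> B"
  shows "\<And>x. (\<And>y. v $ y \<le> v $ x) \<Longrightarrow> r * v $ x + \<rho> \<le> B - al * real CARD('d) * v $ x"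
    and "\<And>x. (\<And>y. v $ x \<le> v $ y) \<Longrightarrow> - B - al * real CARD('d) * v $ x \<le> r * v $ x + \<rho>"
proof -
  have v: "(\<Sum>y\<in>UNIV. v $ y) = 0" using sol by (simp add: solves_mfg_def zero_sum_def)
  have eq: "r * v $ x + \<rho> = H x (Delta x v) + F x \<mu>" for x using sol by (simp add: solves_mfg_def)
  show "r * v $ x + \<rho> \<le> B - al * real CARD('d) * v $ x" if "\<And>y. v $ y \<le> v $ x" for x
  proof -
    have "\<gamma> x 0 \<bullet> v \<le> al * (0 - real CARD('d) * v $ x)"
      using rate_dot_at_max[OF opt_rate_in that, of 0] v by simp
    then show ?thesis using H_Delta_le[of x v] B[of x] unfolding eq abs_le_iff by (simp add: algebra_simps)
  qed
  show "- B - al * real CARD('d) * v $ x \<le> r * v $ x + \<rho>" if "\<And>y. v $ x \<le> v $ y" for x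
  proof -
    have "al * (0 - real CARD('d) * v $ x) \<le> feedback v x \<bullet> v"
      using rate_dot_at_min[OF opt_rate_in that, of "Delta x v"] v by simp
    then show ?thesis using H_Delta_ge[of x v] B[of x] unfolding eq abs_le_iff by (simp add: algebra_simps)
  qed
qed

text \<open>Subtracting the inequalities at a maximum and at a minimum bounds the oscillation of \<open>v\<close> by
  a constant free of \<open>r\<close>. Everything that is uniform in the discount rate rests on this.\<close>

lemma solves_mfg_osc:
  assumes sol: "solves_mfg F r \<rho> v \<mu>" and B: "\<And>x. \<bar>H x 0 + F x \<mu>\<bar> \<le> B" and r: "0 \<le> r"
  shows "v $ y - v $ y' \<le> 2 * B / (al * real CARD('d))"
proof (rule max_min_component[of v])
  fix x z assume max: "\<And>y. v $ y \<le> v $ x" and min: "\<And>y. v $ z \<le> v $ y"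
  have "(r + al * real CARD('d)) * (v $ x - v $ z) \<le> 2 * B"
    using solves_mfg_extremes(1)[OF sol B max] solves_mfg_extremes(2)[OF sol B min]
    by (simp add: algebra_simps)
  moreover have "0 \<le> r * (v $ x - v $ z)" using r max by simp
  ultimately have "al * real CARD('d) * (v $ x - v $ z) \<le> 2 * B" by (simp add: algebra_simps)
  then have "v $ x - v $ z \<le> 2 * B / (al * real CARD('d))" using al by (simp add: field_simps)
  then show ?thesis using max[of y] min[of y'] by linarith
qed

lemma solves_mfg_value_bound:
  assumes sol: "solves_mfg F r \<rho> v \<mu>" and B: "\<And>x. \<bar>H x 0 + F x \<mu>\<bar> \<le> B" and r: "0 \<le> r"
  shows "\<bar>r * v $ y + \<rho>\<bar> \<le> B"
proof (rule max_min_component[of v])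
  fix x z assume max: "\<And>y. v $ y \<le> v $ x" and min: "\<And>y. v $ z \<le> v $ y"
  have v: "v \<in> zero_sum" using sol by (simp add: solves_mfg_def)
  have "0 \<le> al * real CARD('d) * v $ x" "al * real CARD('d) * v $ z \<le> 0"
    using zero_sum_sign(1)[OF v max] zero_sum_sign(2)[OF v min] al by (auto simp: mult_le_0_iff)
  moreover have "r * v $ y \<le> r * v $ x" "r * v $ z \<le> r * v $ y"
    using max min r by (auto intro: mult_left_mono)
  ultimately show ?thesis
    using solves_mfg_extremes(1)[OF sol B max] solves_mfg_extremes(2)[OF sol B min] by linarith
qed

end

section \<open>Lipschitz bounds on the simplex from one-sided derivatives\<close>

text \<open>A local Lipschitz estimate in which one of the two points is fixed is additive over adjacent
  intervals, so Bolzano's bisection principle makes it global.\<close>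

lemma pointwise_lipschitz_imp_lipschitz:
  fixes g :: "real \<Rightarrow> real"
  assumes ab: "a \<le> b"
    and loc: "\<And>s. a \<le> s \<Longrightarrow> s \<le> b \<Longrightarrow>
      \<exists>\<delta>>0. \<forall>t. a \<le> t \<longrightarrow> t \<le> b \<longrightarrow> \<bar>t - s\<bar> < \<delta> \<longrightarrow> \<bar>g t - g s\<bar> \<le> M * \<bar>t - s\<bar>"
  shows "\<bar>g b - g a\<bar> \<le> M * (b - a)"
proof -
  have "a \<le> a \<longrightarrow> b \<le> b \<longrightarrow> \<bar>g b - g a\<bar> \<le> M * (b - a)"
  proof (rule Bolzano[of a b "\<lambda>s t. a \<le> s \<longrightarrow> t \<le> b \<longrightarrow> \<bar>g t - g s\<bar> \<le> M * (t - s)"])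
    fix s t u :: real
    assume "a \<le> s \<longrightarrow> t \<le> b \<longrightarrow> \<bar>g t - g s\<bar> \<le> M * (t - s)"
      "a \<le> t \<longrightarrow> u \<le> b \<longrightarrow> \<bar>g u - g t\<bar> \<le> M * (u - t)" "s \<le> t" "t \<le> u"
    then show "a \<le> s \<longrightarrow> u \<le> b \<longrightarrow> \<bar>g u - g s\<bar> \<le> M * (u - s)"
      by (auto simp: algebra_simps abs_le_iff)
  next
    fix x assume x: "a \<le> x" "x \<le> b"
    from loc[OF this] obtain \<delta> where \<delta>: "\<delta> > 0"
      and d: "\<And>t. a \<le> t \<Longrightarrow> t \<le> b \<Longrightarrow> \<bar>t - x\<bar> < \<delta> \<Longrightarrow> \<bar>g t - g x\<bar> \<le> M * \<bar>t - x\<bar>" by blast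
    have "\<bar>g t - g s\<bar> \<le> M * (t - s)"
      if "s \<le> x" "x \<le> t" "t - s < \<delta>" "a \<le> s" "t \<le> b" for s t
    proof -
      have "\<bar>g s - g x\<bar> \<le> M * (x - s)" using d[of s] that x by auto
      moreover have "\<bar>g t - g x\<bar> \<le> M * (t - x)" using d[of t] that x by auto
      ultimately show ?thesis by (auto simp: algebra_simps abs_le_iff)
    qed
    then show "\<exists>d>0. \<forall>s t. s \<le> x \<and> x \<le> t \<and> t - s < d \<longrightarrow>
        (a \<le> s \<longrightarrow> t \<le> b \<longrightarrow> \<bar>g t - g s\<bar> \<le> M * (t - s))"
      using \<delta> by blast
  qed (use ab in auto)
  then show ?thesis by simp
qed

lemma right_difference_quotient_bound:
  fixes g :: "real \<Rightarrow> real"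
  assumes lim: "((\<lambda>h. (g h - g 0) / h) \<longlongrightarrow> D) (at_right 0)" and D: "\<bar>D\<bar> < M"
  shows "\<exists>\<delta>>0. \<forall>h. 0 < h \<longrightarrow> h < \<delta> \<longrightarrow> \<bar>g h - g 0\<bar> \<le> M * h"
proof -
  have "((\<lambda>h. \<bar>(g h - g 0) / h\<bar>) \<longlongrightarrow> \<bar>D\<bar>) (at_right 0)" by (rule tendsto_rabs[OF lim])
  from order_tendstoD(2)[OF this D]
  obtain \<delta> where "\<delta> > 0" and \<delta>: "\<And>h. 0 < h \<Longrightarrow> h < \<delta> \<Longrightarrow> \<bar>(g h - g 0) / h\<bar> < M"
    by (auto simp only: eventually_at_right_field)
  moreover have "\<bar>g h - g 0\<bar> \<le> M * h" if "0 < h" "h < \<delta>" for h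
    using \<delta>[OF that] that by (simp add: abs_divide divide_less_eq)
  ultimately show ?thesis by blast
qed

lemma mass_transfer_in_simplex:
  assumes \<eta>: "\<eta> \<in> prob_simplex" and t: "0 \<le> t" "t \<le> \<eta> $ y" and ne: "y \<noteq> z"
  shows "\<eta> + t *\<^sub>R (axis z 1 - axis y 1) \<in> prob_simplex"
proof -
  have "(\<Sum>x\<in>UNIV. \<eta> $ x + t * (axis z 1 $ x - axis y 1 $ x)) = 1"
    using prob_simplexD(2)[OF \<eta>]
    by (simp add: sum.distrib sum_distrib_left[symmetric] sum_subtractf axis_def)
  moreover have "0 \<le> \<eta> $ x + t * (axis z 1 $ x - axis y 1 $ x)" for x
    using prob_simplexD(1)[OF \<eta>, of x] t ne by (auto simp: axis_def)
  ultimately show ?thesis by (simp add: prob_simplex_def)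
qed

lemma has_simplex_derivD:
  assumes "has_simplex_deriv K D" "\<eta> \<in> prob_simplex" "y \<noteq> z" "0 < \<eta> $ y"
  shows "((\<lambda>h. (K (\<eta> + h *\<^sub>R (axis z 1 - axis y 1)) - K \<eta>) / h) \<longlongrightarrow> D y z \<eta>) (at_right 0)"
  by (rule assms(1)[unfolded has_simplex_deriv_def, rule_format, OF assms(2-4)])

text \<open>Along a segment in direction \<open>e\<^sub>z - e\<^sub>y\<close>, the derivative in this direction is available as
  long as mass is left at \<open>y\<close>, that is, at all but the last point; it controls the function to
  the right. The derivative in the opposite direction is available at all but the first point
  and controls the function to the left. Together they give two-sided control at each point of
  the closed segment.\<close>

lemma mass_transfer_lipschitz:
  assumes D: "has_simplex_deriv K D"
    and M: "\<And>y z \<eta>. y \<noteq> z \<Longrightarrow> \<eta> \<in> prob_simplex \<Longrightarrow> \<bar>D y z \<eta>\<bar> < M"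
    and \<eta>: "\<eta> \<in> prob_simplex" and t: "0 \<le> t" "t \<le> \<eta> $ y" and ne: "y \<noteq> z"
  shows "\<bar>K (\<eta> + t *\<^sub>R (axis z 1 - axis y 1)) - K \<eta>\<bar> \<le> M * t"
proof -
  let ?e = "axis z 1 - axis y (1 :: real)"
  let ?g = "\<lambda>s. K (\<eta> + s *\<^sub>R ?e)"
  have in_s: "\<eta> + s *\<^sub>R ?e \<in> prob_simplex" if "0 \<le> s" "s \<le> t" for s
    using mass_transfer_in_simplex[OF \<eta> _ _ ne] that t by simp
  have "\<exists>\<delta>>0. \<forall>t'. 0 \<le> t' \<longrightarrow> t' \<le> t \<longrightarrow> \<bar>t' - s\<bar> < \<delta> \<longrightarrow> \<bar>?g t' - ?g s\<bar> \<le> M * \<bar>t' - s\<bar>"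
    if s: "0 \<le> s" "s \<le> t" for s
  proof -
    let ?\<xi> = "\<eta> + s *\<^sub>R ?e"
    have "\<exists>\<delta>>0. \<forall>h. 0 < h \<longrightarrow> h < \<delta> \<longrightarrow> s < t \<longrightarrow> \<bar>?g (s + h) - ?g s\<bar> \<le> M * h"
    proof (cases "s < t")
      case True
      have "0 < ?\<xi> $ y" using True t ne by (simp add: axis_def)
      then have "((\<lambda>h. (?g (s + h) - ?g (s + 0)) / h) \<longlongrightarrow> D y z ?\<xi>) (at_right 0)"
        using has_simplex_derivD[OF D in_s[OF s] ne] by (simp only: scaleR_add_left add.assoc add_0_right)
      from right_difference_quotient_bound[where g = "\<lambda>h. ?g (s + h)", OF this M[OF ne in_s[OF s]]]
      show ?thesis unfolding add_0_right by blast
    qed (auto intro: exI[of _ 1])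
    then obtain \<delta>1 where \<delta>1: "\<delta>1 > 0" "\<And>h. 0 < h \<Longrightarrow> h < \<delta>1 \<Longrightarrow> s < t \<Longrightarrow> \<bar>?g (s + h) - ?g s\<bar> \<le> M * h"
      by blast
    have "\<exists>\<delta>>0. \<forall>h. 0 < h \<longrightarrow> h < \<delta> \<longrightarrow> 0 < s \<longrightarrow> \<bar>?g (s - h) - ?g s\<bar> \<le> M * h"
    proof (cases "0 < s")
      case True
      have "0 < ?\<xi> $ z" using True prob_simplexD(1)[OF \<eta>, of z] ne
        by (simp add: axis_def add_nonneg_pos)
      moreover have "?\<xi> + h *\<^sub>R (axis y 1 - axis z 1) = \<eta> + (s - h) *\<^sub>R ?e" for h
        by (simp add: algebra_simps)
      ultimately have "((\<lambda>h. (?g (s - h) - ?g (s - 0)) / h) \<longlongrightarrow> D z y ?\<xi>) (at_right 0)"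
        using has_simplex_derivD[OF D in_s[OF s] ne[symmetric]] by (simp only: diff_0_right)
      from right_difference_quotient_bound[where g = "\<lambda>h. ?g (s - h)", OF this M[OF ne[symmetric] in_s[OF s]]]
      show ?thesis unfolding diff_0_right by blast
    qed (auto intro: exI[of _ 1])
    then obtain \<delta>2 where \<delta>2: "\<delta>2 > 0" "\<And>h. 0 < h \<Longrightarrow> h < \<delta>2 \<Longrightarrow> 0 < s \<Longrightarrow> \<bar>?g (s - h) - ?g s\<bar> \<le> M * h"
      by blast
    have "\<bar>?g t' - ?g s\<bar> \<le> M * \<bar>t' - s\<bar>"
      if t': "0 \<le> t'" "t' \<le> t" "\<bar>t' - s\<bar> < min \<delta>1 \<delta>2" for t'
    proof -
      consider "t' = s" | "s < t'" | "t' < s" by linarith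
      then show ?thesis
      proof cases
        case 2
        then show ?thesis using \<delta>1(2)[of "t' - s"] t' by simp
      next
        case 3
        then show ?thesis using \<delta>2(2)[of "s - t'"] t' by simp
      qed simp
    qed
    then show ?thesis using \<delta>1(1) \<delta>2(1) by (intro exI[of _ "min \<delta>1 \<delta>2"]) auto
  qed
  from pointwise_lipschitz_imp_lipschitz[OF t(1) this] show ?thesis by simp
qed

text \<open>Two points of the simplex are joined by transfers of mass from a coordinate that is too
  large to one that is too small. If the amount is the smaller of the two discrepancies, then
  each transfer settles at least one coordinate and shortens the \<open>\<ell>\<^sup>1\<close> distance by twice the
  amount.\<close>

lemma mass_transfer_imp_l1_lipschitz:
  fixes K :: "real ^ 'd::finite \<Rightarrow> real"
  assumes tr: "\<And>y z \<eta> t. y \<noteq> z \<Longrightarrow> \<eta> \<in> prob_simplex \<Longrightarrow> 0 \<le> t \<Longrightarrow> t \<le> \<eta> $ y \<Longrightarrow>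
      \<bar>K (\<eta> + t *\<^sub>R (axis z 1 - axis y 1)) - K \<eta>\<bar> \<le> M * t"
    and \<eta>: "\<eta> \<in> prob_simplex" and \<zeta>: "\<zeta> \<in> prob_simplex"
  shows "\<bar>K \<eta> - K \<zeta>\<bar> \<le> M * (\<Sum>x\<in>UNIV. \<bar>\<eta> $ x - \<zeta> $ x\<bar>)"
  using \<eta>
proof (induction "card {x. \<eta> $ x \<noteq> \<zeta> $ x}" arbitrary: \<eta> rule: less_induct)
  case less
  note \<eta> = less.prems
  show ?case
  proof (cases "\<eta> = \<zeta>")
    case False
    have sum0: "(\<Sum>x\<in>UNIV. \<eta> $ x - \<zeta> $ x) = 0"
      using prob_simplexD(2)[OF \<eta>] prob_simplexD(2)[OF \<zeta>] by (simp add: sum_subtractf)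
    obtain y where y: "\<zeta> $ y < \<eta> $ y"
    proof (rule ccontr)
      assume "\<not> thesis"
      then have le: "\<And>x. \<eta> $ x \<le> \<zeta> $ x" using that not_less by blast
      then have "\<forall>x\<in>UNIV. \<zeta> $ x - \<eta> $ x = 0"
        using sum_nonneg_eq_0_iff[of UNIV "\<lambda>x. \<zeta> $ x - \<eta> $ x"] sum0 by (simp add: sum_subtractf)
      then show False using False by (simp add: vec_eq_iff)
    qed
    obtain z where z: "\<eta> $ z < \<zeta> $ z"
    proof (rule ccontr)
      assume "\<not> thesis"
      then have le: "\<And>x. \<zeta> $ x \<le> \<eta> $ x" using that not_less by blast
      then have "\<forall>x\<in>UNIV. \<eta> $ x - \<zeta> $ x = 0"
        using sum_nonneg_eq_0_iff[of UNIV "\<lambda>x. \<eta> $ x - \<zeta> $ x"] sum0 by simp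
      then show False using False by (simp add: vec_eq_iff)
    qed
    have ne: "y \<noteq> z" using y z by auto
    define t where "t = min (\<eta> $ y - \<zeta> $ y) (\<zeta> $ z - \<eta> $ z)"
    define \<eta>' where "\<eta>' = \<eta> + t *\<^sub>R (axis z 1 - axis y 1)"
    have t: "0 \<le> t" "t \<le> \<eta> $ y" using y z prob_simplexD(1)[OF \<zeta>, of y] by (auto simp: t_def)
    have \<eta>'_nth: "\<eta>' $ x = (if x = y then \<eta> $ y - t else if x = z then \<eta> $ z + t else \<eta> $ x)" for x
      using ne by (auto simp: \<eta>'_def axis_def)
    have \<eta>': "\<eta>' \<in> prob_simplex" unfolding \<eta>'_def by (rule mass_transfer_in_simplex[OF \<eta> t ne])
    have "{x. \<eta>' $ x \<noteq> \<zeta> $ x} \<subset> {x. \<eta> $ x \<noteq> \<zeta> $ x}"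
    proof
      show "{x. \<eta>' $ x \<noteq> \<zeta> $ x} \<subseteq> {x. \<eta> $ x \<noteq> \<zeta> $ x}" using y z by (auto simp: \<eta>'_nth split: if_splits)
      show "{x. \<eta>' $ x \<noteq> \<zeta> $ x} \<noteq> {x. \<eta> $ x \<noteq> \<zeta> $ x}"
      proof (cases "t = \<eta> $ y - \<zeta> $ y")
        case True
        then have "y \<notin> {x. \<eta>' $ x \<noteq> \<zeta> $ x}" "y \<in> {x. \<eta> $ x \<noteq> \<zeta> $ x}" using y by (auto simp: \<eta>'_nth)
        then show ?thesis by blast
      next
        case False
        then have "t = \<zeta> $ z - \<eta> $ z" by (auto simp: t_def min_def split: if_splits)
        then have "z \<notin> {x. \<eta>' $ x \<noteq> \<zeta> $ x}" "z \<in> {x. \<eta> $ x \<noteq> \<zeta> $ x}" using z ne by (auto simp: \<eta>'_nth)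
        then show ?thesis by blast
      qed
    qed
    then have "card {x. \<eta>' $ x \<noteq> \<zeta> $ x} < card {x. \<eta> $ x \<noteq> \<zeta> $ x}"
      by (intro psubset_card_mono) auto
    from less.hyps[OF this \<eta>']
    have IH: "\<bar>K \<eta>' - K \<zeta>\<bar> \<le> M * (\<Sum>x\<in>UNIV. \<bar>\<eta>' $ x - \<zeta> $ x\<bar>)" .
    have step: "\<bar>K \<eta>' - K \<eta>\<bar> \<le> M * t" unfolding \<eta>'_def by (rule tr[OF ne \<eta> t])
    have M: "0 \<le> M * t" using step by linarith
    have "(\<Sum>x\<in>UNIV. \<bar>\<eta>' $ x - \<zeta> $ x\<bar>) =
        (\<Sum>x\<in>UNIV. \<bar>\<eta> $ x - \<zeta> $ x\<bar> - (if x = y then t else 0) - (if x = z then t else 0))"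
      using y z ne by (intro sum.cong refl) (auto simp: \<eta>'_nth t_def)
    also have "\<dots> = (\<Sum>x\<in>UNIV. \<bar>\<eta> $ x - \<zeta> $ x\<bar>) - 2 * t"
      by (simp add: sum_subtractf)
    finally have "M * (\<Sum>x\<in>UNIV. \<bar>\<eta>' $ x - \<zeta> $ x\<bar>) = M * (\<Sum>x\<in>UNIV. \<bar>\<eta> $ x - \<zeta> $ x\<bar>) - 2 * (M * t)"
      by (simp add: right_diff_distrib)
    then show ?thesis using IH step M by linarith
  qed simp
qed

lemma C1_simplex_imp_l1_lipschitz:
  fixes K :: "real ^ 'd::finite \<Rightarrow> real"
  assumes "C1_simplex_lipschitz K"
  obtains M where "0 < M" "\<And>\<eta> \<zeta>. \<eta> \<in> prob_simplex \<Longrightarrow> \<zeta> \<in> prob_simplex \<Longrightarrow>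
     \<bar>K \<eta> - K \<zeta>\<bar> \<le> M * (\<Sum>x\<in>UNIV. \<bar>\<eta> $ x - \<zeta> $ x\<bar>)"
proof -
  obtain D where D: "has_simplex_deriv K D"
    and cont: "\<And>y z. y \<noteq> z \<Longrightarrow> continuous_on prob_simplex (D y z)"
    using assms unfolding C1_simplex_lipschitz_def by (elim exE conjE) (rule that, auto)
  have "\<exists>b. \<forall>\<eta>\<in>prob_simplex. \<bar>D y z \<eta>\<bar> \<le> b" if "y \<noteq> z" for y z
  proof -
    have "bounded (D y z ` prob_simplex)"
      by (intro compact_imp_bounded compact_continuous_image cont[OF that] compact_prob_simplex)
    then show ?thesis by (auto simp: bounded_iff)
  qed
  note bdd = this
  define b where "b y z = (SOME b. \<forall>\<eta>\<in>prob_simplex. \<bar>D y z \<eta>\<bar> \<le> b)" for y z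
  have b: "\<bar>D y z \<eta>\<bar> \<le> b y z" if "y \<noteq> z" "\<eta> \<in> prob_simplex" for y z \<eta>
    using someI_ex[OF bdd[OF that(1)]] that(2) unfolding b_def by blast
  define M where "M = (\<Sum>y\<in>UNIV. \<Sum>z\<in>UNIV. \<bar>b y z\<bar>) + 1"
  have bM: "\<bar>b y z\<bar> < M" for y z
  proof -
    have "\<bar>b y z\<bar> \<le> (\<Sum>z\<in>UNIV. \<bar>b y z\<bar>)" by (rule member_le_sum) auto
    also have "\<dots> \<le> (\<Sum>y\<in>UNIV. \<Sum>z\<in>UNIV. \<bar>b y z\<bar>)"
      by (rule member_le_sum) (auto intro: sum_nonneg)
    finally show ?thesis by (simp add: M_def)
  qed
  have M: "\<bar>D y z \<eta>\<bar> < M" if "y \<noteq> z" "\<eta> \<in> prob_simplex" for y z \<eta>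
    using b[OF that] bM[of y z] by linarith
  have "0 < M" by (auto simp: M_def intro!: add_nonneg_pos sum_nonneg)
  moreover have "\<bar>K \<eta> - K \<zeta>\<bar> \<le> M * (\<Sum>x\<in>UNIV. \<bar>\<eta> $ x - \<zeta> $ x\<bar>)"
    if "\<eta> \<in> prob_simplex" "\<zeta> \<in> prob_simplex" for \<eta> \<zeta>
    using mass_transfer_imp_l1_lipschitz[OF mass_transfer_lipschitz[OF D M]] that by blast
  ultimately show ?thesis by (rule that)
qed

lemma l1_lipschitz_imp_continuous_on:
  fixes K :: "real ^ 'd::finite \<Rightarrow> real"
  assumes M: "0 < M" "\<And>\<eta> \<zeta>. \<eta> \<in> S \<Longrightarrow> \<zeta> \<in> S \<Longrightarrow> \<bar>K \<eta> - K \<zeta>\<bar> \<le> M * (\<Sum>x\<in>UNIV. \<bar>\<eta> $ x - \<zeta> $ x\<bar>)"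
  shows "continuous_on S K"
proof -
  have "(M * real CARD('d))-lipschitz_on S K"
  proof (rule lipschitz_onI)
    fix \<eta> \<zeta> assume "\<eta> \<in> S" "\<zeta> \<in> S"
    then have "\<bar>K \<eta> - K \<zeta>\<bar> \<le> M * (\<Sum>x\<in>UNIV. \<bar>\<eta> $ x - \<zeta> $ x\<bar>)" by (rule M)
    also have "\<dots> \<le> M * (\<Sum>x\<in>(UNIV :: 'd set). dist \<eta> \<zeta>)"
      using M(1) component_le_norm_cart[of "\<eta> - \<zeta>"]
      by (intro mult_left_mono sum_mono) (auto simp: dist_norm)
    finally show "dist (K \<eta>) (K \<zeta>) \<le> M * real CARD('d) * dist \<eta> \<zeta>"
      by (simp add: dist_norm algebra_simps)
  qed (use M in simp)
  then show ?thesis by (rule lipschitz_on_continuous_on)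
qed

lemma C1_family_imp_l1_lipschitz:
  fixes F :: "'d::finite \<Rightarrow> real ^ 'd \<Rightarrow> real"
  assumes "\<And>x. C1_simplex_lipschitz (F x)"
  obtains M where "0 < M" "\<And>x \<eta> \<zeta>. \<eta> \<in> prob_simplex \<Longrightarrow> \<zeta> \<in> prob_simplex \<Longrightarrow>
     \<bar>F x \<eta> - F x \<zeta>\<bar> \<le> M * (\<Sum>x\<in>UNIV. \<bar>\<eta> $ x - \<zeta> $ x\<bar>)"
proof -
  have "\<forall>x. \<exists>M. 0 < M \<and> (\<forall>\<eta>\<in>prob_simplex. \<forall>\<zeta>\<in>prob_simplex.
      \<bar>F x \<eta> - F x \<zeta>\<bar> \<le> M * (\<Sum>x\<in>UNIV. \<bar>\<eta> $ x - \<zeta> $ x\<bar>))"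
    by (rule allI, rule C1_simplex_imp_l1_lipschitz[OF assms]) blast
  from choice[OF this] obtain M where M: "\<And>x. 0 < M x"
    "\<And>x \<eta> \<zeta>. \<eta> \<in> prob_simplex \<Longrightarrow> \<zeta> \<in> prob_simplex \<Longrightarrow>
      \<bar>F x \<eta> - F x \<zeta>\<bar> \<le> M x * (\<Sum>x\<in>UNIV. \<bar>\<eta> $ x - \<zeta> $ x\<bar>)" by blast
  show ?thesis
  proof (rule that)
    show "0 < (\<Sum>x\<in>UNIV. M x)" by (intro sum_pos M) auto
    fix x and \<eta> \<zeta> :: "real ^ 'd" assume "\<eta> \<in> prob_simplex" "\<zeta> \<in> prob_simplex"
    then have "\<bar>F x \<eta> - F x \<zeta>\<bar> \<le> M x * (\<Sum>x\<in>UNIV. \<bar>\<eta> $ x - \<zeta> $ x\<bar>)" by (rule M)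
    also have "\<dots> \<le> (\<Sum>x\<in>UNIV. M x) * (\<Sum>x\<in>UNIV. \<bar>\<eta> $ x - \<zeta> $ x\<bar>)"
      using M(1) by (intro mult_right_mono member_le_sum sum_nonneg) (auto intro: less_imp_le)
    finally show "\<bar>F x \<eta> - F x \<zeta>\<bar> \<le> (\<Sum>x\<in>UNIV. M x) * (\<Sum>x\<in>UNIV. \<bar>\<eta> $ x - \<zeta> $ x\<bar>)" .
  qed
qed

section \<open>Existence of solutions\<close>

lemma zero_sum_abs_le_osc:
  fixes v :: "real ^ 'd::finite"
  assumes v: "v \<in> zero_sum" and osc: "\<And>y. \<bar>v $ y - v $ x\<bar> \<le> K"
  shows "\<bar>v $ x\<bar> \<le> K"
proof -
  have "v $ x - K \<le> v $ y" "v $ y \<le> v $ x + K" for y using osc[of y] by linarith+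
  from zero_sum_sign(2)[OF v this(1)] zero_sum_sign(1)[OF v this(2)] show ?thesis by linarith
qed

lemma continuous_Delta: "continuous_on S (Delta x)"
  unfolding Delta_def by (intro continuous_intros)

lemma compact_zero_sum_osc:
  "compact {v :: real ^ 'd::finite. v \<in> zero_sum \<and> (\<forall>y z. v $ y - v $ z \<le> K)}" (is "compact ?S")
proof -
  have "bounded ?S"
  proof (rule boundedI)
    fix v assume v: "v \<in> ?S"
    have "\<bar>v $ x\<bar> \<le> K" for x
      using v by (intro zero_sum_abs_le_osc) (auto simp: abs_le_iff)
    then have "(\<Sum>x\<in>UNIV. \<bar>v $ x\<bar>) \<le> (\<Sum>x\<in>(UNIV :: 'd set). K)" by (intro sum_mono) auto
    then show "norm v \<le> real CARD('d) * K" using norm_le_l1_cart[of v] by simp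
  qed
  moreover have "closed ?S"
    unfolding zero_sum_def mem_Collect_eq
    by (intro closed_Collect_conj closed_Collect_all closed_Collect_le closed_Collect_eq continuous_intros)
  ultimately show ?thesis by (simp add: compact_eq_bounded_closed)
qed

lemma convex_zero_sum_osc:
  "convex {v :: real ^ 'd::finite. v \<in> zero_sum \<and> (\<forall>y z. v $ y - v $ z \<le> K)}"
proof (rule convexI)
  fix v w :: "real ^ 'd" and s t :: real
  assume v: "v \<in> {v. v \<in> zero_sum \<and> (\<forall>y z. v $ y - v $ z \<le> K)}"
    and w: "w \<in> {v. v \<in> zero_sum \<and> (\<forall>y z. v $ y - v $ z \<le> K)}"
    and st: "0 \<le> s" "0 \<le> t" "s + t = 1"
  have "(s *\<^sub>R v + t *\<^sub>R w) $ y - (s *\<^sub>R v + t *\<^sub>R w) $ z \<le> K" for y z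
  proof -
    have "s * (v $ y - v $ z) + t * (w $ y - w $ z) \<le> s * K + t * K"
      using v w st by (intro add_mono mult_left_mono) auto
    also have "\<dots> = K" using st by (simp add: distrib_right[symmetric])
    finally show ?thesis by (simp add: algebra_simps)
  qed
  moreover have "s *\<^sub>R v + t *\<^sub>R w \<in> zero_sum"
    using v w by (simp add: zero_sum_def sum.distrib sum_distrib_left[symmetric])
  ultimately show "s *\<^sub>R v + t *\<^sub>R w \<in> {v. v \<in> zero_sum \<and> (\<forall>y z. v $ y - v $ z \<le> K)}" by simp
qed

context rate_control
begin

text \<open>Bounds the only part of the data that enters the a priori estimates.\<close>

lemma base_cost_bounded:
  assumes F: "\<And>x. continuous_on prob_simplex (F x)"
  obtains B :: real where "0 \<le> B" "\<And>x \<eta>. \<eta> \<in> prob_simplex \<Longrightarrow> \<bar>H x 0 + F x \<eta>\<bar> \<le> B"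
proof -
  have bdd: "\<exists>b. \<forall>\<eta>\<in>prob_simplex. \<bar>H x 0 + F x \<eta>\<bar> \<le> b" for x :: 'd
  proof -
    have "bounded ((\<lambda>\<eta>. H x 0 + F x \<eta>) ` prob_simplex)"
      by (intro compact_imp_bounded compact_continuous_image compact_prob_simplex continuous_intros F)
    then show ?thesis by (auto simp: bounded_iff)
  qed
  define b where "b x = (SOME b. \<forall>\<eta>\<in>prob_simplex. \<bar>H x 0 + F x \<eta>\<bar> \<le> b)" for x
  have b: "\<bar>H x 0 + F x \<eta>\<bar> \<le> b x" if "\<eta> \<in> prob_simplex" for x \<eta>
    using someI_ex[OF bdd] that unfolding b_def by blast
  have "\<bar>H x 0 + F x \<eta>\<bar> \<le> (\<Sum>x\<in>UNIV. \<bar>b x\<bar>)" if "\<eta> \<in> prob_simplex" for x \<eta>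
    using b[OF that, of x] member_le_sum[of x UNIV "\<lambda>x. \<bar>b x\<bar>"] by auto
  then show ?thesis by (intro that[of "\<Sum>x\<in>UNIV. \<bar>b x\<bar>"]) (auto intro: sum_nonneg)
qed

text \<open>Brouwer's theorem applied to the value function and the distribution simultaneously, on the
  product of the zero-sum vectors of oscillation at most \<open>K\<close> with the simplex. The map is a
  damped step of the Hamilton-Jacobi equation, projected to zero-sum vectors, together with an
  Euler step of the forward equation; at a fixed point the subtracted mean is the constant
  \<open>\<rho>\<close>. With \<open>F\<close> independent of the distribution the lemma also solves the Hamilton-Jacobi
  equation for a given population.\<close>

lemma solves_mfg_exists:
  assumes F: "\<And>x. continuous_on prob_simplex (F x)" and r: "0 \<le> r"
  obtains \<rho> v \<mu> where "solves_mfg F r \<rho> v \<mu>"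
proof (rule base_cost_bounded[OF F])
  fix B :: real assume B0: "0 \<le> B" and B: "\<And>x \<eta>. \<eta> \<in> prob_simplex \<Longrightarrow> \<bar>H x 0 + F x \<eta>\<bar> \<le> B"
  define n where "n = real CARD('d)"
  define K where "K = 2 * B / (al * n)"
  \<comment> \<open>with the step size \<open>1 / R\<close> the step is monotone, and the term in \<open>v $ x\<close>
    cancels in the bounds on \<open>G\<close> below, and \<open>K\<close> solves \<open>2 * B + n * (au - al) * K = n * au * K\<close>\<close>
  define R where "R = r + n * au"
  have n: "0 < n" by (simp add: n_def)
  have K: "0 \<le> K" "n * al * K = 2 * B" using B0 al n by (auto simp: K_def)
  have R: "0 < R" using r n au_pos by (simp add: R_def add_nonneg_pos)
  define V :: "(real ^ 'd) set" where "V = {v. v \<in> zero_sum \<and> (\<forall>y z. v $ y - v $ z \<le> K)}"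
  define G where "G v \<mu> x = H x (Delta x v) + F x \<mu> + n * au * v $ x" for v \<mu> x
  define m where "m v \<mu> = (\<Sum>x\<in>UNIV. G v \<mu> x) / n" for v \<mu>
  define T where "T = (\<lambda>(v, \<mu>). (\<chi> x. (G v \<mu> x - m v \<mu>) / R,
      \<chi> x. \<mu> $ x + 1 / (n * au) * (\<Sum>y\<in>UNIV. \<mu> $ y * feedback v y $ x)))"
  have G_le: "G v \<mu> x - G v \<mu> z \<le> R * K" if v: "v \<in> V" and \<mu>: "\<mu> \<in> prob_simplex" for v \<mu> x z
  proof (rule max_min_component[of v])
    fix a b assume max: "\<And>y. v $ y \<le> v $ a" and min: "\<And>y. v $ b \<le> v $ y"
    have v0: "v \<in> zero_sum" using v by (simp add: V_def)
    have "\<gamma> x 0 \<bullet> v \<le> n * ((au - al) * v $ a - au * v $ x)"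
      unfolding n_def using al by (intro rate_dot_le[OF opt_rate_in v0 max]) simp
    then have le: "G v \<mu> x \<le> B + n * (au - al) * v $ a"
      using H_Delta_le[of x v] B[OF \<mu>, of x] by (simp add: G_def abs_le_iff algebra_simps)
    have "n * ((au - al) * v $ b - au * v $ z) \<le> feedback v z \<bullet> v"
      unfolding n_def using al by (intro rate_dot_ge[OF opt_rate_in v0 min]) simp
    then have ge: "- B + n * (au - al) * v $ b \<le> G v \<mu> z"
      using H_Delta_ge[of z v] B[OF \<mu>, of z] by (simp add: G_def abs_le_iff algebra_simps)
    have "n * (au - al) * (v $ a - v $ b) \<le> n * (au - al) * K"
      using v al n by (intro mult_left_mono) (auto simp: V_def)
    moreover have "0 \<le> r * K" using r K by simp
    ultimately show ?thesis using le ge K(2) unfolding R_def by (simp add: algebra_simps)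
  qed
  obtain p where p: "p \<in> V \<times> prob_simplex" "T p = p"
  proof (rule brouwer[of "V \<times> prob_simplex" T])
    show "compact (V \<times> (prob_simplex :: (real ^ 'd) set))"
      unfolding V_def by (intro compact_Times compact_zero_sum_osc compact_prob_simplex)
    show "convex (V \<times> (prob_simplex :: (real ^ 'd) set))"
      unfolding V_def by (intro convex_Times convex_zero_sum_osc convex_prob_simplex)
    have "0 \<in> V" using K by (simp add: V_def zero_sum_def)
    then show "V \<times> (prob_simplex :: (real ^ 'd) set) \<noteq> {}" using axis_in_prob_simplex by blast
    have cF: "continuous_on (V \<times> prob_simplex) (\<lambda>p. F x (snd p))" for x :: 'd
      by (rule continuous_on_compose2[OF F]) (auto intro!: continuous_on_fst continuous_on_snd continuous_on_id)
    have cD: "continuous_on (V \<times> prob_simplex) (\<lambda>p. Delta x (fst p))" for x :: 'd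
      by (rule continuous_on_compose2[OF continuous_Delta]) (auto intro!: continuous_on_fst continuous_on_snd continuous_on_id)
    have cH: "continuous_on (V \<times> prob_simplex) (\<lambda>p. H x (Delta x (fst p)))" for x :: 'd
      by (rule continuous_on_compose2[OF continuous_H[of UNIV] cD]) auto
    have cg: "continuous_on (V \<times> prob_simplex) (\<lambda>p. \<gamma> x (Delta x (fst p)))" for x :: 'd
      by (rule continuous_on_compose2[OF continuous_opt_rate[of UNIV] cD]) auto
    show "continuous_on (V \<times> prob_simplex) T"
      unfolding T_def case_prod_beta G_def m_def
      by (intro continuous_intros cF cH cg) (use R n in auto)
    show "T \<in> V \<times> prob_simplex \<rightarrow> V \<times> prob_simplex"
    proof
      fix p assume "p \<in> V \<times> (prob_simplex :: (real ^ 'd) set)"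
      then obtain v \<mu> where p: "p = (v, \<mu>)" and v: "v \<in> V" and \<mu>: "\<mu> \<in> prob_simplex" by blast
      have "(\<chi> x. (G v \<mu> x - m v \<mu>) / R) \<in> V"
      proof -
        have "(G v \<mu> y - m v \<mu>) / R - (G v \<mu> z - m v \<mu>) / R \<le> K" for y z
          using G_le[OF v \<mu>, of y z] R by (simp add: field_simps)
        moreover have "(\<Sum>x\<in>UNIV. (G v \<mu> x - m v \<mu>) / R) = 0"
          using n by (simp add: sum_divide_distrib[symmetric] sum_subtractf m_def n_def)
        ultimately show ?thesis by (simp add: V_def zero_sum_def)
      qed
      moreover have "(\<chi> x. \<mu> $ x + 1 / (n * au) * (\<Sum>y\<in>UNIV. \<mu> $ y * feedback v y $ x)) \<in> prob_simplex"
        using al n au_pos by (intro euler_step_in_simplex[OF feedback_controls \<mu>]) (auto simp: n_def)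
      ultimately show "T p \<in> V \<times> prob_simplex" by (simp add: T_def p)
    qed
  qed
  obtain v \<mu> where v\<mu>: "p = (v, \<mu>)" by (cases p)
  from p have v: "v \<in> V" and \<mu>: "\<mu> \<in> prob_simplex" by (auto simp: v\<mu>)
  from p(2) have Tv': "(\<chi> x. (G v \<mu> x - m v \<mu>) / R) = v"
    and T\<mu>': "(\<chi> x. \<mu> $ x + 1 / (n * au) * (\<Sum>y\<in>UNIV. \<mu> $ y * feedback v y $ x)) = \<mu>"
    by (auto simp: T_def v\<mu>)
  have Tv: "(G v \<mu> x - m v \<mu>) / R = v $ x" for x
    using arg_cong[OF Tv', of "\<lambda>w. w $ x"] by simp
  have T\<mu>: "\<mu> $ x + 1 / (n * au) * (\<Sum>y\<in>UNIV. \<mu> $ y * feedback v y $ x) = \<mu> $ x" for x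
    using arg_cong[OF T\<mu>', of "\<lambda>w. w $ x"] by (simp only: vec_lambda_beta)
  have "r * v $ x + m v \<mu> = H x (Delta x v) + F x \<mu>" for x
  proof -
    have "G v \<mu> x - m v \<mu> = R * v $ x" using Tv[of x] R by (simp add: field_simps)
    then show ?thesis by (simp add: G_def R_def algebra_simps)
  qed
  moreover have "(\<Sum>y\<in>UNIV. \<mu> $ y * feedback v y $ x) = 0" for x
    using T\<mu>[of x] n au_pos by simp
  ultimately have "solves_mfg F r (m v \<mu>) v \<mu>"
    using v \<mu> by (simp add: solves_mfg_def V_def invariant_dist_def)
  then show ?thesis by (rule that)
qed

end

section \<open>Comparison of solutions\<close>

lemma Delta_in_box:
  fixes v :: "real ^ 'd::finite"
  assumes "\<And>y y'. v $ y - v $ y' \<le> K"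
  shows "Delta x v \<in> cbox (vec (- K)) (vec K)"
proof -
  have "v $ y - v $ x \<le> K" "- K \<le> v $ y - v $ x" for y using assms[of y x] assms[of x y] by linarith+
  then show ?thesis by (simp add: mem_box_cart Delta_def)
qed

lemma abs_le_norm_Delta:
  fixes w :: "real ^ 'd::finite"
  assumes "w \<in> zero_sum"
  shows "\<bar>w $ x\<bar> \<le> norm (Delta x w)"
proof (rule zero_sum_abs_le_osc[OF assms])
  fix y show "\<bar>w $ y - w $ x\<bar> \<le> norm (Delta x w)"
    using component_le_norm_cart[of "Delta x w" y] by (simp add: Delta_def)
qed

lemma norm_le_sqrt_sum:
  fixes g :: "'d::finite \<Rightarrow> 'a::real_normed_vector"
  shows "norm (g x) \<le> sqrt (\<Sum>x\<in>UNIV. (norm (g x))\<^sup>2)"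
  by (rule real_le_rsqrt) (rule member_le_sum, auto)

lemma weighted_sum_le:
  fixes m :: "real ^ 'd::finite"
  assumes "\<And>x. \<bar>a x\<bar> \<le> (b :: real)"
  shows "(\<Sum>x\<in>UNIV. a x * m $ x) \<le> b * (\<Sum>x\<in>UNIV. \<bar>m $ x\<bar>)"
  unfolding sum_distrib_left
proof (rule sum_mono)
  fix x
  have "a x * m $ x \<le> \<bar>a x\<bar> * \<bar>m $ x\<bar>" by (metis abs_ge_self abs_mult)
  also have "\<dots> \<le> b * \<bar>m $ x\<bar>" by (intro mult_right_mono assms) simp
  finally show "a x * m $ x \<le> b * \<bar>m $ x\<bar>" .
qed

text \<open>The distance of the gradients. On zero-sum vectors it separates points, since two vectors
  with the same gradients differ by a constant.\<close>

definition grad_dist :: "real ^ 'd::finite \<Rightarrow> real ^ 'd \<Rightarrow> real" where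
  "grad_dist v w = sqrt (\<Sum>x\<in>UNIV. (norm (Delta x (v - w)))\<^sup>2)"

context rate_control
begin

lemma solves_mfg_simplex: "solves_mfg F r \<rho> v \<mu> \<Longrightarrow> \<mu> \<in> prob_simplex"
  by (simp add: solves_mfg_def invariant_dist_def)

text \<open>Averaging the strict concavity inequality over the invariant distribution of \<open>feedback v\<close>
  removes the first-order term, because that term is a generator applied to \<open>v' - v\<close>.\<close>

lemma invariant_concavity_gap:
  assumes conc: "\<And>x. H x (Delta x v') \<le> H x (Delta x v)
      + feedback v x \<bullet> (Delta x v' - Delta x v) - C / 2 * (norm (Delta x v' - Delta x v))\<^sup>2"
    and inv: "invariant_dist (feedback v) \<mu>"
  shows "C / 2 * (\<Sum>x\<in>UNIV. \<mu> $ x * (norm (Delta x (v' - v)))\<^sup>2)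
     \<le> (\<Sum>x\<in>UNIV. \<mu> $ x * (H x (Delta x v) - H x (Delta x v')))"
proof -
  have \<mu>: "\<mu> \<in> prob_simplex" using inv by (simp add: invariant_dist_def)
  have D: "Delta x v' - Delta x v = Delta x (v' - v)" for x by (simp add: Delta_def vec_eq_iff)
  have "(\<Sum>x\<in>UNIV. \<mu> $ x * (C / 2 * (norm (Delta x (v' - v)))\<^sup>2)) \<le>
      (\<Sum>x\<in>UNIV. \<mu> $ x * (H x (Delta x v) - H x (Delta x v') + feedback v x \<bullet> Delta x (v' - v)))"
    using conc[unfolded D] prob_simplexD(1)[OF \<mu>]
    by (intro sum_mono mult_left_mono) (auto simp: algebra_simps)
  also have "\<dots> = (\<Sum>x\<in>UNIV. \<mu> $ x * (H x (Delta x v) - H x (Delta x v')))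
      + (\<Sum>x\<in>UNIV. \<mu> $ x * (feedback v x \<bullet> Delta x (v' - v)))"
    by (simp add: distrib_left sum.distrib)
  also have "(\<Sum>x\<in>UNIV. \<mu> $ x * (feedback v x \<bullet> Delta x (v' - v))) = 0"
    by (rule invariant_dist_dot[OF feedback_controls inv])
  finally show ?thesis by (simp add: sum_distrib_left mult.left_commute)
qed

text \<open>The duality argument of Lasry and Lions. The difference of the two Hamilton-Jacobi equations
  is paired with the difference of the distributions: the two concavity gaps are coercive in
  the gradients, the coupling has a sign by monotonicity, and the constants \<open>\<rho>\<close> and \<open>\<rho>'\<close> drop
  out since \<open>\<mu> - \<mu>'\<close> is zero-sum. What is left is the discount term, which is small with \<open>r\<close>.\<close>

lemma mfg_duality_estimate:
  assumes sol: "solves_mfg F r \<rho> v \<mu>" and sol': "solves_mfg F r' \<rho>' v' \<mu>'"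
    and mono: "0 \<le> (\<Sum>x\<in>UNIV. (F x \<mu> - F x \<mu>') * (\<mu> $ x - \<mu>' $ x))"
    and C: "0 \<le> C" and conc: "\<And>x p q. p \<in> {Delta x v, Delta x v'} \<Longrightarrow> q \<in> {Delta x v, Delta x v'} \<Longrightarrow>
      H x q \<le> H x p + \<gamma> x p \<bullet> (q - p) - C / 2 * (norm (q - p))\<^sup>2"
    and c: "\<And>x. c \<le> \<mu> $ x" "\<And>x. c \<le> \<mu>' $ x"
  shows "C * c * (\<Sum>x\<in>UNIV. (norm (Delta x (v - v')))\<^sup>2)
     \<le> (\<Sum>x\<in>UNIV. (r * v $ x - r' * v' $ x) * (\<mu> $ x - \<mu>' $ x))"
proof -
  let ?N = "\<lambda>x. (norm (Delta x (v - v')))\<^sup>2"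
  have N: "(norm (Delta x (v' - v)))\<^sup>2 = ?N x" for x
  proof -
    have "Delta x (v' - v) = - Delta x (v - v')" by (simp add: Delta_def vec_eq_iff)
    then show ?thesis by (metis norm_minus_cancel)
  qed
  have inv: "invariant_dist (feedback v) \<mu>" "invariant_dist (feedback v') \<mu>'"
    using sol sol' by (auto simp: solves_mfg_def)
  have eq: "H x (Delta x v) - H x (Delta x v') = (r * v $ x - r' * v' $ x) + (\<rho> - \<rho>') - (F x \<mu> - F x \<mu>')" for x
  proof -
    have "r * v $ x + \<rho> = H x (Delta x v) + F x \<mu>" "r' * v' $ x + \<rho>' = H x (Delta x v') + F x \<mu>'"
      using sol sol' by (simp_all add: solves_mfg_def)
    then show ?thesis by linarith
  qed
  have sum0: "(\<Sum>x\<in>UNIV. (\<rho> - \<rho>') * (\<mu> $ x - \<mu>' $ x)) = 0"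
    using prob_simplexD(2)[OF solves_mfg_simplex[OF sol]] prob_simplexD(2)[OF solves_mfg_simplex[OF sol']]
    by (simp add: sum_distrib_left[symmetric] sum_subtractf)
  have "C * c * (\<Sum>x\<in>UNIV. ?N x) = C / 2 * (\<Sum>x\<in>UNIV. c * ?N x) + C / 2 * (\<Sum>x\<in>UNIV. c * ?N x)"
    by (simp add: sum_distrib_left[symmetric])
  also have "\<dots> \<le> C / 2 * (\<Sum>x\<in>UNIV. \<mu> $ x * ?N x) + C / 2 * (\<Sum>x\<in>UNIV. \<mu>' $ x * ?N x)"
    using c C by (intro add_mono mult_left_mono sum_mono mult_right_mono) auto
  also have "\<dots> \<le> (\<Sum>x\<in>UNIV. \<mu> $ x * (H x (Delta x v) - H x (Delta x v')))
      + (\<Sum>x\<in>UNIV. \<mu>' $ x * (H x (Delta x v') - H x (Delta x v)))"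
    using invariant_concavity_gap[of v' v C \<mu>, OF conc inv(1)]
      invariant_concavity_gap[of v v' C \<mu>', OF conc inv(2)]
    unfolding N by (intro add_mono) auto
  also have "\<dots> = (\<Sum>x\<in>UNIV. (H x (Delta x v) - H x (Delta x v')) * (\<mu> $ x - \<mu>' $ x))"
    by (simp add: sum.distrib[symmetric] algebra_simps)
  also have "\<dots> = (\<Sum>x\<in>UNIV. (r * v $ x - r' * v' $ x) * (\<mu> $ x - \<mu>' $ x))
      + (\<Sum>x\<in>UNIV. (\<rho> - \<rho>') * (\<mu> $ x - \<mu>' $ x))
      - (\<Sum>x\<in>UNIV. (F x \<mu> - F x \<mu>') * (\<mu> $ x - \<mu>' $ x))"
    unfolding eq by (simp only: sum.distrib[symmetric] sum_subtractf[symmetric] distrib_right left_diff_distrib)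
  finally show ?thesis using mono sum0 by linarith
qed

text \<open>Uniqueness and the rate come from the duality estimate together with the Lipschitz
  dependence of the invariant distribution on the gradient. Write \<open>g\<close> for the gradient
  distance. For two solutions with the same \<open>r\<close> the discount term is at most \<open>r * L * g\<^sup>2\<close>, so
  coercivity \<open>k * g\<^sup>2\<close> forces \<open>g = 0\<close> once \<open>r * L < k\<close>. Between a discounted and an ergodic
  solution it is at most \<open>r * K * L * g\<close>, so \<open>g\<close>, and with it all other differences, is of
  order \<open>r\<close>.\<close>

lemma mfg_uniform_estimates:
  assumes Flip: "0 < M" "\<And>x \<eta> \<zeta>. \<eta> \<in> prob_simplex \<Longrightarrow> \<zeta> \<in> prob_simplex \<Longrightarrow>
      \<bar>F x \<eta> - F x \<zeta>\<bar> \<le> M * (\<Sum>x\<in>UNIV. \<bar>\<eta> $ x - \<zeta> $ x\<bar>)"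
    and mono: "\<And>\<eta> \<eta>'. \<eta> \<in> prob_simplex \<Longrightarrow> \<eta>' \<in> prob_simplex \<Longrightarrow>
               0 \<le> (\<Sum>x\<in>UNIV. (F x \<eta> - F x \<eta>') * (\<eta> $ x - \<eta>' $ x))"
  obtains r1 C :: real where "0 < r1" "0 < C"
    "\<And>r \<rho> v \<mu> \<rho>' v' \<mu>'. 0 \<le> r \<Longrightarrow> r < r1 \<Longrightarrow> solves_mfg F r \<rho> v \<mu> \<Longrightarrow> solves_mfg F r \<rho>' v' \<mu>' \<Longrightarrow>
       \<rho> = \<rho>' \<and> v = v' \<and> \<mu> = \<mu>'"
    "\<And>r \<rho> v \<mu> \<rho>' v' \<mu>'. 0 \<le> r \<Longrightarrow> solves_mfg F r \<rho> v \<mu> \<Longrightarrow> solves_mfg F 0 \<rho>' v' \<mu>' \<Longrightarrow>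
       grad_dist v v' \<le> C * r \<and> norm (\<mu> - \<mu>') \<le> C * r \<and> (\<forall>x. \<bar>r * v $ x + \<rho> - \<rho>'\<bar> \<le> C * r)"
    "\<And>r \<rho> v \<mu> x. 0 \<le> r \<Longrightarrow> solves_mfg F r \<rho> v \<mu> \<Longrightarrow> \<bar>r * v $ x + \<rho>\<bar> \<le> C"
proof -
  have Fcont: "continuous_on prob_simplex (F x)" for x
    by (rule l1_lipschitz_imp_continuous_on[OF Flip])
  obtain B :: real where B0: "0 \<le> B" and B: "\<And>x \<eta>. \<eta> \<in> prob_simplex \<Longrightarrow> \<bar>H x 0 + F x \<eta>\<bar> \<le> B"
    by (rule base_cost_bounded[where F = F, OF Fcont]) (rule that, assumption, blast)
  define n where "n = real CARD('d)"
  \<comment> \<open>the summand \<open>1\<close> only serves to make the radius of the box positive\<close>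
  define K where "K = 2 * B / (al * n) + 1"
  have "0 \<le> 2 * B / (al * n)" using B0 al by (simp add: n_def)
  then have K: "0 < K" by (simp add: K_def)
  obtain L0 where L0: "\<forall>x. L0-lipschitz_on (cbox (vec (- K)) (vec K)) (\<gamma> x)"
    using opt_rate_lipschitz[OF K] by blast
  then have L0_nonneg: "0 \<le> L0" by (auto intro: lipschitz_on_nonneg)
  define L where "L = L0 / al"
  have L: "0 \<le> L" using L0_nonneg al by (simp add: L_def)
  obtain Cc where Cc: "0 < Cc" and conc: "\<And>x p q. p \<in> cbox (vec (- K)) (vec K) \<Longrightarrow>
      q \<in> cbox (vec (- K)) (vec K) \<Longrightarrow> p $ x = 0 \<Longrightarrow> q $ x = 0 \<Longrightarrow>
       H x q \<le> H x p + \<gamma> x p \<bullet> (q - p) - Cc / 2 * (norm (q - p))\<^sup>2"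
    by (rule H_strictly_concave[OF K]) (rule that, assumption, blast)
  define k where "k = Cc * (al / (al + n * au))"
  have "0 < al + n * au" using al au_pos by (simp add: n_def add_pos_nonneg)
  then have k: "0 < k" using Cc al by (simp add: k_def)
  have osc: "v $ y - v $ y' \<le> K" if "solves_mfg F r \<rho> v \<mu>" "0 \<le> r" for r \<rho> v \<mu> y y'
    using solves_mfg_osc[OF that(1) B[OF solves_mfg_simplex[OF that(1)]] that(2), of y y']
    by (simp add: K_def n_def)
  have cmp: "k * (grad_dist v v')\<^sup>2 \<le> (\<Sum>x\<in>UNIV. (r * v $ x - r' * v' $ x) * (\<mu> $ x - \<mu>' $ x))"
      "(\<Sum>x\<in>UNIV. \<bar>\<mu> $ x - \<mu>' $ x\<bar>) \<le> L * grad_dist v v'"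
    if s: "solves_mfg F r \<rho> v \<mu>" "0 \<le> r" and s': "solves_mfg F r' \<rho>' v' \<mu>'" "0 \<le> r'"
    for r \<rho> v \<mu> r' \<rho>' v' \<mu>'
  proof -
    have inv: "invariant_dist (feedback v) \<mu>" "invariant_dist (feedback v') \<mu>'"
      using s s' by (auto simp: solves_mfg_def)
    have box: "Delta x v \<in> cbox (vec (- K)) (vec K)" "Delta x v' \<in> cbox (vec (- K)) (vec K)" for x
      by (rule Delta_in_box, rule osc[OF s], rule Delta_in_box, rule osc[OF s'])
    have z: "Delta x w $ x = 0" for x w by (simp add: Delta_def)
    have "Cc * (al / (al + n * au)) * (\<Sum>x\<in>UNIV. (norm (Delta x (v - v')))\<^sup>2)
        \<le> (\<Sum>x\<in>UNIV. (r * v $ x - r' * v' $ x) * (\<mu> $ x - \<mu>' $ x))"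
    proof (rule mfg_duality_estimate[OF s(1) s'(1)])
      fix x p q assume "p \<in> {Delta x v, Delta x v'}" "q \<in> {Delta x v, Delta x v'}"
      then show "H x q \<le> H x p + \<gamma> x p \<bullet> (q - p) - Cc / 2 * (norm (q - p))\<^sup>2"
        using box z by (intro conc) auto
    qed (use Cc mono solves_mfg_simplex[OF s(1)] solves_mfg_simplex[OF s'(1)] al au_pos
        invariant_dist_lower_bound[OF feedback_controls inv(1)]
        invariant_dist_lower_bound[OF feedback_controls inv(2)] in \<open>auto simp: n_def\<close>)
    then show "k * (grad_dist v v')\<^sup>2 \<le> (\<Sum>x\<in>UNIV. (r * v $ x - r' * v' $ x) * (\<mu> $ x - \<mu>' $ x))"
      by (simp add: k_def grad_dist_def sum_nonneg)
    have "norm (feedback v x - feedback v' x) \<le> L0 * grad_dist v v'" for x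
    proof -
      have "norm (feedback v x - feedback v' x) \<le> L0 * norm (Delta x v - Delta x v')"
        using lipschitz_onD[OF L0[rule_format] box(1) box(2)] by (simp add: dist_norm)
      also have "Delta x v - Delta x v' = Delta x (v - v')" by (simp add: Delta_def vec_eq_iff)
      also have "L0 * norm (Delta x (v - v')) \<le> L0 * grad_dist v v'"
        unfolding grad_dist_def using L0_nonneg norm_le_sqrt_sum[of "\<lambda>x. Delta x (v - v')"]
        by (intro mult_left_mono) auto
      finally show ?thesis .
    qed
    from invariant_dist_stability[OF feedback_controls inv al(1) this]
    show "(\<Sum>x\<in>UNIV. \<bar>\<mu> $ x - \<mu>' $ x\<bar>) \<le> L * grad_dist v v'" by (simp add: L_def)
  qed
  have gd0: "0 \<le> grad_dist v w" for v w by (simp add: grad_dist_def sum_nonneg)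
  have eq: "r * v $ x + \<rho> = H x (Delta x v) + F x \<mu>" if "solves_mfg F r \<rho> v \<mu>" for r \<rho> v \<mu> x
    using that by (simp add: solves_mfg_def)
  define r1 where "r1 = k / (L + 1)"
  define c where "c = K * L / k"
  define C where "C = c + L * c + (2 * n * au * c + M * (L * c)) + B + 1"
  have c: "0 \<le> c" using K L k by (simp add: c_def)
  have nau: "0 \<le> 2 * n * au * c" using c au_pos by (simp add: n_def)
  have Cge: "c \<le> C" "L * c \<le> C" "2 * n * au * c + M * (L * c) \<le> C" "B \<le> C" "0 < C"
    using c L B0 nau Flip(1) by (auto simp: C_def add_nonneg_pos intro!: add_nonneg_nonneg)
  show ?thesis
  proof (rule that)
    show "0 < r1" using k L by (simp add: r1_def)
    show "0 < C" by (rule Cge)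
    fix r \<rho> v \<mu> assume r: "0 \<le> r" and s: "solves_mfg F r \<rho> v \<mu>"
    show "\<bar>r * v $ x + \<rho>\<bar> \<le> C" for x
      using solves_mfg_value_bound[OF s B[OF solves_mfg_simplex[OF s]] r, of x] Cge by linarith
    fix \<rho>' v' \<mu>'
    {
      assume r': "r < r1" and s': "solves_mfg F r \<rho>' v' \<mu>'"
      note cmp = cmp[OF s r s' r]
      have w: "v - v' \<in> zero_sum" using s s' by (simp add: solves_mfg_def zero_sum_def sum_subtractf)
      have wle: "\<bar>(v - v') $ x\<bar> \<le> grad_dist v v'" for x
        using order_trans[OF abs_le_norm_Delta[OF w] norm_le_sqrt_sum[of "\<lambda>x. Delta x (v - v')"]]
        by (simp add: grad_dist_def)
      have "k * (grad_dist v v')\<^sup>2 \<le> r * (\<Sum>x\<in>UNIV. (v - v') $ x * (\<mu> - \<mu>') $ x)"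
        using cmp(1) by (simp add: sum_distrib_left algebra_simps)
      also have "\<dots> \<le> r * (grad_dist v v' * (\<Sum>x\<in>UNIV. \<bar>(\<mu> - \<mu>') $ x\<bar>))"
        by (intro mult_left_mono weighted_sum_le wle r)
      also have "\<dots> \<le> r * (grad_dist v v' * (L * grad_dist v v'))"
        using cmp(2) r gd0 by (intro mult_left_mono) auto
      finally have "(k - r * L) * (grad_dist v v')\<^sup>2 \<le> 0" by (simp add: algebra_simps power2_eq_square)
      moreover have "r * L < k"
      proof -
        have "r * L \<le> r * (L + 1)" using r by (intro mult_left_mono) auto
        also have "\<dots> < k" using r' L by (simp add: r1_def field_simps)
        finally show ?thesis .
      qed
      ultimately have g: "grad_dist v v' = 0" by (simp add: mult_le_0_iff)
      have v: "v = v'" using wle g by (simp add: vec_eq_iff)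
      have "(\<Sum>x\<in>UNIV. \<bar>(\<mu> - \<mu>') $ x\<bar>) \<le> 0" using cmp(2) g by simp
      then have "norm (\<mu> - \<mu>') \<le> 0" by (rule order_trans[OF norm_le_l1_cart])
      then have "\<mu> = \<mu>'" by simp
      then show "\<rho> = \<rho>' \<and> v = v' \<and> \<mu> = \<mu>'" using v eq[OF s] eq[OF s'] by (metis add_left_cancel)
    }
    {
      assume s': "solves_mfg F 0 \<rho>' v' \<mu>'"
      note cmp = cmp[OF s r s' order_refl]
      have v: "v \<in> zero_sum" using s by (simp add: solves_mfg_def)
      have vK: "\<bar>v $ x\<bar> \<le> K" for x
      proof (rule zero_sum_abs_le_osc[OF v])
        show "\<bar>v $ y - v $ x\<bar> \<le> K" for y using osc[OF s r, of y x] osc[OF s r, of x y] by linarith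
      qed
      have "k * (grad_dist v v')\<^sup>2 \<le> r * (\<Sum>x\<in>UNIV. v $ x * (\<mu> - \<mu>') $ x)"
        using cmp(1) by (simp add: sum_distrib_left algebra_simps)
      also have "\<dots> \<le> r * (K * (\<Sum>x\<in>UNIV. \<bar>(\<mu> - \<mu>') $ x\<bar>))"
        by (intro mult_left_mono weighted_sum_le vK r)
      also have "\<dots> \<le> r * (K * (L * grad_dist v v'))"
        using cmp(2) r K by (intro mult_left_mono) auto
      finally have *: "k * (grad_dist v v')\<^sup>2 \<le> r * (K * (L * grad_dist v v'))" .
      have g: "grad_dist v v' \<le> c * r"
      proof (cases "grad_dist v v' = 0")
        case True
        then show ?thesis using c r by simp
      next
        case False
        then have "0 < grad_dist v v'" using gd0[of v v'] by simp
        moreover have "(k * grad_dist v v') * grad_dist v v' \<le> (r * K * L) * grad_dist v v'"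
          using * by (simp add: power2_eq_square algebra_simps)
        ultimately have "k * grad_dist v v' \<le> r * K * L" by simp
        then show ?thesis using k by (simp add: c_def field_simps)
      qed
      have l1: "(\<Sum>x\<in>UNIV. \<bar>\<mu> $ x - \<mu>' $ x\<bar>) \<le> L * c * r"
        using cmp(2) mult_left_mono[OF g L] by (simp add: algebra_simps)
      have up: "a * r \<le> C * r" if "a \<le> C" for a using that r by (rule mult_right_mono)
      have "norm (\<mu> - \<mu>') \<le> C * r"
        using norm_le_l1_cart[of "\<mu> - \<mu>'"] l1 up[OF Cge(2)] by simp
      moreover have "\<bar>r * v $ x + \<rho> - \<rho>'\<bar> \<le> C * r" for x
      proof -
        have "Delta x v - Delta x v' = Delta x (v - v')" by (simp add: Delta_def vec_eq_iff)
        then have "norm (Delta x v - Delta x v') \<le> grad_dist v v'"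
          unfolding grad_dist_def using norm_le_sqrt_sum[of "\<lambda>x. Delta x (v - v')"] by simp
        then have "2 * n * au * norm (Delta x v - Delta x v') \<le> 2 * n * au * (c * r)"
          using g au_pos by (intro mult_left_mono) (auto simp: n_def)
        then have H: "\<bar>H x (Delta x v) - H x (Delta x v')\<bar> \<le> 2 * n * au * (c * r)"
          using H_lipschitz[of x "Delta x v" "Delta x v'"] unfolding n_def by linarith
        have "M * (\<Sum>x\<in>UNIV. \<bar>\<mu> $ x - \<mu>' $ x\<bar>) \<le> M * (L * c * r)"
          using l1 Flip(1) by (intro mult_left_mono) auto
        then have Fd: "\<bar>F x \<mu> - F x \<mu>'\<bar> \<le> M * (L * c * r)"
          using Flip(2)[OF solves_mfg_simplex[OF s] solves_mfg_simplex[OF s'], of x] by linarith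
        have "\<bar>r * v $ x + \<rho> - \<rho>'\<bar> \<le> (2 * n * au * c + M * (L * c)) * r"
          using H Fd eq[OF s, of x] eq[OF s', of x] unfolding abs_le_iff by (simp add: algebra_simps)
        then show ?thesis using up[OF Cge(3)] by linarith
      qed
      ultimately show "grad_dist v v' \<le> C * r \<and> norm (\<mu> - \<mu>') \<le> C * r \<and> (\<forall>x. \<bar>r * v $ x + \<rho> - \<rho>'\<bar> \<le> C * r)"
        using g up[OF Cge(1)] by auto
    }
  qed
qed

end

section \<open>Laws of jump processes\<close>

text \<open>Here \<open>g\<close> is the density of a signed measure relative to \<open>\<pi>\<close>, with mean zero, and the
  left-hand side is the time derivative of its variance under the forward equation. By the
  invariance of \<open>\<pi>\<close> it is minus the Dirichlet form \<open>\<Sum> \<pi> $ y * \<alpha> y $ x * (g x - g y)\<^sup>2\<close>; since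
  all rates are at least \<open>al\<close> and \<open>\<pi> $ x \<le> 1\<close>, this form is at least \<open>2 * al\<close> times the
  variance.\<close>

lemma relative_variance_dissipation:
  fixes \<alpha> :: "'d::finite \<Rightarrow> real ^ 'd"
  assumes \<alpha>: "\<alpha> \<in> controls al au" and \<pi>: "invariant_dist \<alpha> \<pi>" and g0: "(\<Sum>x\<in>UNIV. \<pi> $ x * g x) = 0"
    and al: "0 \<le> al"
  shows "2 * (\<Sum>x\<in>UNIV. g x * (\<Sum>y\<in>UNIV. \<pi> $ y * g y * \<alpha> y $ x)) \<le> - (2 * al) * (\<Sum>x\<in>UNIV. \<pi> $ x * (g x)\<^sup>2)"
proof -
  have \<pi>s: "\<pi> \<in> prob_simplex" using \<pi> by (simp add: invariant_dist_def)
  note p = prob_simplexD[OF \<pi>s]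
  have ax: "\<alpha> y \<in> rate_vectors al au y" for y using \<alpha> by (simp add: controls_def)
  have row: "al * (\<Sum>x\<in>UNIV. \<pi> $ x * (g x - g y)\<^sup>2) \<le>
      \<alpha> y \<bullet> (\<chi> x. (g x)\<^sup>2) - 2 * g y * (\<alpha> y \<bullet> (\<chi> x. g x))" for y
  proof -
    have "al * (\<Sum>x\<in>UNIV. \<pi> $ x * (g x - g y)\<^sup>2) = (\<Sum>x\<in>UNIV - {y}. al * (\<pi> $ x * (g x - g y)\<^sup>2))"
      by (simp add: sum_distrib_left sum.remove[of UNIV y])
    also have "\<dots> \<le> (\<Sum>x\<in>UNIV - {y}. \<alpha> y $ x * (g x - g y)\<^sup>2)"
    proof (rule sum_mono)
      fix x assume x: "x \<in> UNIV - {y}"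
      have "\<pi> $ x * (g x - g y)\<^sup>2 \<le> 1 * (g x - g y)\<^sup>2" using p by (intro mult_right_mono) auto
      then have "al * (\<pi> $ x * (g x - g y)\<^sup>2) \<le> al * (g x - g y)\<^sup>2" using al by (intro mult_left_mono) auto
      also have "\<dots> \<le> \<alpha> y $ x * (g x - g y)\<^sup>2"
        using controls_offdiag(1)[OF \<alpha>, of y x] x by (intro mult_right_mono) auto
      finally show "al * (\<pi> $ x * (g x - g y)\<^sup>2) \<le> \<alpha> y $ x * (g x - g y)\<^sup>2" .
    qed
    also have "\<dots> = \<alpha> y \<bullet> (\<chi> x. (g x)\<^sup>2) - 2 * g y * (\<alpha> y \<bullet> (\<chi> x. g x))"
      unfolding rate_dot_eq_diff[OF ax] sum_distrib_left sum_subtractf[symmetric]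
      by (intro sum.cong refl) (simp add: power2_eq_square algebra_simps)
    finally show ?thesis .
  qed
  have sq: "(\<Sum>x\<in>UNIV. \<pi> $ x * (g x - g y)\<^sup>2) = (\<Sum>x\<in>UNIV. \<pi> $ x * (g x)\<^sup>2) + (g y)\<^sup>2" for y
  proof -
    have "(\<Sum>x\<in>UNIV. \<pi> $ x * (g x - g y)\<^sup>2) =
        (\<Sum>x\<in>UNIV. \<pi> $ x * (g x)\<^sup>2 - 2 * g y * (\<pi> $ x * g x) + (g y)\<^sup>2 * \<pi> $ x)"
      by (intro sum.cong refl) (simp add: power2_eq_square algebra_simps)
    also have "\<dots> = (\<Sum>x\<in>UNIV. \<pi> $ x * (g x)\<^sup>2) + (g y)\<^sup>2"
      using g0 p(2) by (simp add: sum.distrib sum_subtractf sum_distrib_left[symmetric])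
    finally show ?thesis .
  qed
  have "2 * al * (\<Sum>x\<in>UNIV. \<pi> $ x * (g x)\<^sup>2) =
      (\<Sum>y\<in>UNIV. \<pi> $ y * (al * (\<Sum>x\<in>UNIV. \<pi> $ x * (g x - g y)\<^sup>2)))"
  proof -
    have "(\<Sum>y\<in>UNIV. \<pi> $ y * (al * (\<Sum>x\<in>UNIV. \<pi> $ x * (g x - g y)\<^sup>2))) =
        (\<Sum>y\<in>UNIV. al * (\<Sum>x\<in>UNIV. \<pi> $ x * (g x)\<^sup>2) * \<pi> $ y + al * (\<pi> $ y * (g y)\<^sup>2))"
      unfolding sq by (intro sum.cong refl) (simp add: algebra_simps)
    also have "\<dots> = 2 * al * (\<Sum>x\<in>UNIV. \<pi> $ x * (g x)\<^sup>2)"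
      using p(2) by (simp add: sum.distrib sum_distrib_left[symmetric])
    finally show ?thesis by simp
  qed
  also have "\<dots> \<le> (\<Sum>y\<in>UNIV. \<pi> $ y * (\<alpha> y \<bullet> (\<chi> x. (g x)\<^sup>2) - 2 * g y * (\<alpha> y \<bullet> (\<chi> x. g x))))"
    using row p(1) by (intro sum_mono mult_left_mono) auto
  also have "\<dots> = (\<Sum>y\<in>UNIV. \<pi> $ y * (\<alpha> y \<bullet> (\<chi> x. (g x)\<^sup>2)))
      - 2 * (\<Sum>y\<in>UNIV. (\<chi> y. \<pi> $ y * g y) $ y * (\<alpha> y \<bullet> (\<chi> x. g x)))"
    unfolding sum_distrib_left sum_subtractf[symmetric]
    by (intro sum.cong refl) (simp add: algebra_simps)
  also have "\<dots> = - 2 * (\<Sum>x\<in>UNIV. g x * (\<Sum>y\<in>UNIV. \<pi> $ y * g y * \<alpha> y $ x))"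
    using \<pi> unfolding generator_duality by (simp add: invariant_dist_def)
  finally show ?thesis by simp
qed

lemma flow_component_derivative:
  fixes \<mu> :: "real \<Rightarrow> real ^ 'd::finite"
  assumes "\<And>y. ((\<lambda>t. \<mu> t $ y) has_real_derivative \<mu>' $ y) (at t within S)"
  shows "(\<mu> has_vector_derivative \<mu>') (at t within S)"
  unfolding has_vector_derivative_def
proof (subst has_derivative_componentwise_within, rule ballI)
  fix i :: "real ^ 'd" assume "i \<in> Basis"
  then obtain y where i: "i = axis y 1" by (auto simp: Basis_vec_def)
  have "(\<lambda>h. (h *\<^sub>R \<mu>') \<bullet> i) = (*) (\<mu>' $ y)" by (simp add: fun_eq_iff i inner_axis)
  moreover have "(\<lambda>t. \<mu> t \<bullet> i) = (\<lambda>t. \<mu> t $ y)" by (simp add: i inner_axis)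
  ultimately show "((\<lambda>t. \<mu> t \<bullet> i) has_derivative (\<lambda>h. (h *\<^sub>R \<mu>') \<bullet> i)) (at t within S)"
    using assms[of y] by (simp only: has_field_derivative_def)
qed

text \<open>The variance of the density of \<open>p t\<close> relative to \<open>\<pi>\<close> decays like \<open>exp (- 2 * al * t)\<close>, by
  the dissipation inequality.\<close>

lemma kolmogorov_forward_convergence:
  fixes \<alpha> :: "'d::finite \<Rightarrow> real ^ 'd" and p :: "real \<Rightarrow> real ^ 'd"
  assumes \<alpha>: "\<alpha> \<in> controls al au" and \<pi>: "invariant_dist \<alpha> \<pi>" and al: "0 < al" "0 < au"
    and p: "\<And>t. 0 \<le> t \<Longrightarrow> p t \<in> prob_simplex"
    and p': "\<And>t y. 0 \<le> t \<Longrightarrow>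
      ((\<lambda>t. p t $ y) has_real_derivative (\<Sum>x\<in>UNIV. p t $ x * \<alpha> x $ y)) (at t within {0..})"
  shows "(p \<longlongrightarrow> \<pi>) at_top"
proof -
  have \<pi>s: "\<pi> \<in> prob_simplex" using \<pi> by (simp add: invariant_dist_def)
  have \<pi>pos: "0 < \<pi> $ x" for x
  proof -
    have "0 < al / (al + real CARD('d) * au)" using al by (simp add: add_pos_pos)
    also have "\<dots> \<le> \<pi> $ x" using invariant_dist_lower_bound[OF \<alpha> \<pi> al(1)] al by simp
    finally show ?thesis .
  qed
  define g where "g t x = (p t $ x - \<pi> $ x) / \<pi> $ x" for t x
  define V where "V t = (\<Sum>x\<in>UNIV. \<pi> $ x * (g t x)\<^sup>2)" for t
  define V' where "V' t = 2 * (\<Sum>x\<in>UNIV. g t x * (\<Sum>y\<in>UNIV. \<pi> $ y * g t y * \<alpha> y $ x))" for t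
  have \<pi>g: "\<pi> $ x * g t x = p t $ x - \<pi> $ x" for t x
    using \<pi>pos[of x] by (simp add: g_def)
  have gen: "(\<Sum>y\<in>UNIV. \<pi> $ y * g t y * \<alpha> y $ x) = (\<Sum>y\<in>UNIV. p t $ y * \<alpha> y $ x)" for t x
    using \<pi> unfolding \<pi>g by (simp add: left_diff_distrib sum_subtractf invariant_dist_def)
  have dV: "(V has_real_derivative V' t) (at t within {0..})" if t: "0 \<le> t" for t
  proof -
    have dg: "((\<lambda>t. g t x) has_real_derivative (\<Sum>y\<in>UNIV. p t $ y * \<alpha> y $ x) / \<pi> $ x) (at t within {0..})" for x
      unfolding g_def using p'[OF t, of x] \<pi>pos[of x] by (auto intro!: derivative_eq_intros)
    have "((\<lambda>t. \<pi> $ x * (g t x)\<^sup>2) has_real_derivative 2 * (g t x * (\<Sum>y\<in>UNIV. p t $ y * \<alpha> y $ x)))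
        (at t within {0..})" for x
      using dg[of x] \<pi>pos[of x] by (auto intro!: derivative_eq_intros)
    then show ?thesis unfolding V_def[abs_def] V'_def gen sum_distrib_left by (intro DERIV_sum) auto
  qed
  have V'_le: "V' t \<le> - (2 * al) * V t" if t: "0 \<le> t" for t
    unfolding V'_def V_def
  proof (rule relative_variance_dissipation[OF \<alpha> \<pi>])
    show "(\<Sum>x\<in>UNIV. \<pi> $ x * g t x) = 0"
      unfolding \<pi>g using prob_simplexD(2)[OF p[OF t]] prob_simplexD(2)[OF \<pi>s] by (simp add: sum_subtractf)
  qed (use al in simp)
  define W where "W t = exp (2 * al * t) * V t" for t
  have dW: "(W has_real_derivative exp (2 * al * t) * (V' t + 2 * al * V t)) (at t within {0..})"
    if t: "0 \<le> t" for t
    unfolding W_def[abs_def] using dV[OF t] by (auto intro!: derivative_eq_intros simp: algebra_simps)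
  have W_le: "W t \<le> W 0" if t: "0 \<le> t" for t
  proof (rule DERIV_nonpos_imp_decreasing_open[OF t])
    fix s assume s: "0 < s" "s < t"
    have "at s within {0..} = at s" using s by (intro at_within_interior) simp
    then have "(W has_real_derivative exp (2 * al * s) * (V' s + 2 * al * V s)) (at s)" using dW[of s] s by simp
    moreover have "exp (2 * al * s) * (V' s + 2 * al * V s) \<le> 0"
      using V'_le[of s] s by (intro mult_nonneg_nonpos) auto
    ultimately show "\<exists>y. (W has_real_derivative y) (at s) \<and> y \<le> 0" by blast
  next
    have "continuous_on {0..} W"
      using dW by (intro DERIV_continuous_on) auto
    then show "continuous_on {0..t} W" by (rule continuous_on_subset) auto
  qed
  have V_le: "V t \<le> exp (- (2 * al * t)) * W 0" if "0 \<le> t" for t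
    using W_le[OF that] by (simp add: W_def exp_minus field_simps)
  have V0: "0 \<le> V t" for t unfolding V_def using \<pi>pos by (intro sum_nonneg mult_nonneg_nonneg) (auto intro: less_imp_le)
  have "((\<lambda>t. exp (- (2 * al * t)) * W 0) \<longlongrightarrow> 0 * W 0) at_top"
  proof (rule tendsto_mult[OF _ tendsto_const])
    have "filterlim (\<lambda>t. 2 * al * t) at_top at_top"
      using al by (intro filterlim_tendsto_pos_mult_at_top[OF tendsto_const]) (auto simp: filterlim_ident)
    then show "((\<lambda>t. exp (- (2 * al * t))) \<longlongrightarrow> 0) at_top"
      by (intro filterlim_compose[OF exp_at_bot]) (simp add: filterlim_uminus_at_bot)
  qed
  then have lim0: "((\<lambda>t. exp (- (2 * al * t)) * W 0) \<longlongrightarrow> 0) at_top" by simp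
  have V_lim: "(V \<longlongrightarrow> 0) at_top"
    by (rule tendsto_sandwich[OF _ _ tendsto_const lim0])
      (use V0 V_le in \<open>auto intro: eventually_at_top_linorderI[of 0]\<close>)
  show ?thesis
  proof (rule vec_tendstoI)
    fix x
    have le: "(p t $ x - \<pi> $ x)\<^sup>2 \<le> V t" for t
    proof -
      have "(p t $ x - \<pi> $ x)\<^sup>2 = \<pi> $ x * (\<pi> $ x * (g t x)\<^sup>2)"
        unfolding \<pi>g[symmetric] by (simp add: power2_eq_square)
      also have "\<dots> \<le> 1 * (\<pi> $ x * (g t x)\<^sup>2)"
        using prob_simplexD[OF \<pi>s] by (intro mult_right_mono) auto
      also have "1 * (\<pi> $ x * (g t x)\<^sup>2) \<le> V t"
        unfolding V_def mult_1 using prob_simplexD(1)[OF \<pi>s] by (intro member_le_sum) auto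
      finally show ?thesis .
    qed
    have "((\<lambda>t. (p t $ x - \<pi> $ x)\<^sup>2) \<longlongrightarrow> 0) at_top"
      by (rule tendsto_sandwich[OF _ _ tendsto_const V_lim]) (use le in auto)
    then have "((\<lambda>t. sqrt ((p t $ x - \<pi> $ x)\<^sup>2)) \<longlongrightarrow> sqrt 0) at_top" by (rule tendsto_real_sqrt)
    then have "((\<lambda>t. p t $ x - \<pi> $ x) \<longlongrightarrow> 0) at_top"
      by (simp only: real_sqrt_abs real_sqrt_zero) (rule tendsto_rabs_zero_cancel)
    then show "((\<lambda>t. p t $ x) \<longlongrightarrow> \<pi> $ x) at_top"
      by (rule LIM_zero_cancel)
  qed
qed

lemma
  assumes "markov_jump_process M X \<alpha> x0"
  shows markov_jump_prob_space: "prob_space M"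
    and markov_jump_state_sets: "0 \<le> t \<Longrightarrow> {\<omega>\<in>space M. X t \<omega> = x} \<in> sets M"
    and markov_jump_right_continuous:
      "\<omega> \<in> space M \<Longrightarrow> 0 \<le> t \<Longrightarrow> \<forall>\<^sub>F s in at_right t. X s \<omega> = X t \<omega>"
proof -
  show "prob_space M" using assms by (simp add: markov_jump_process_def)
  show "{\<omega>\<in>space M. X t \<omega> = x} \<in> sets M" if "0 \<le> t"
  proof -
    have "X t \<in> measurable M (count_space UNIV)" using assms that by (simp add: markov_jump_process_def)
    from measurable_sets[OF this, of "{x}"] show ?thesis by (simp add: vimage_def Int_def conj_commute)
  qed
  show "\<forall>\<^sub>F s in at_right t. X s \<omega> = X t \<omega>" if "\<omega> \<in> space M" "0 \<le> t"
    using assms that by (simp add: markov_jump_process_def)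
qed

lemma measure_partition_by_state:
  fixes Y :: "'w \<Rightarrow> 'd::finite"
  assumes M: "prob_space M" and A: "A \<in> sets M" and Y: "\<And>x. {\<omega>\<in>space M. Y \<omega> = x} \<in> sets M"
  shows "measure M A = (\<Sum>x\<in>UNIV. measure M (A \<inter> {\<omega>\<in>space M. Y \<omega> = x}))"
proof -
  interpret prob_space M by (rule M)
  have "A = (\<Union>x\<in>UNIV. A \<inter> {\<omega>\<in>space M. Y \<omega> = x})" using sets.sets_into_space[OF A] by auto
  moreover have "measure M (\<Union>x\<in>UNIV. A \<inter> {\<omega>\<in>space M. Y \<omega> = x}) =
      (\<Sum>x\<in>UNIV. measure M (A \<inter> {\<omega>\<in>space M. Y \<omega> = x}))"
    by (rule finite_measure_finite_Union) (use A Y in \<open>auto simp: disjoint_family_on_def\<close>)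
  ultimately show ?thesis by simp
qed

lemma law_flow_in_simplex:
  assumes X: "markov_jump_process M X \<alpha> x0" and t: "0 \<le> t"
  shows "law_flow M X t \<in> prob_simplex"
proof -
  interpret prob_space M by (rule markov_jump_prob_space[OF X])
  have "1 = measure M (space M)" by (simp add: prob_space)
  also have "\<dots> = (\<Sum>x\<in>UNIV. measure M (space M \<inter> {\<omega>\<in>space M. X t \<omega> = x}))"
    by (rule measure_partition_by_state) (use markov_jump_state_sets[OF X t] prob_space_axioms in auto)
  also have "\<dots> = (\<Sum>x\<in>UNIV. law_flow M X t $ x)"
    unfolding law_flow_def vec_lambda_beta by (intro sum.cong arg_cong[where f = "measure M"]) auto
  finally show ?thesis by (simp add: prob_simplex_def law_flow_def)
qed

text \<open>The Markov property for the trivial event is the Chapman-Kolmogorov relation for the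
  one-point marginals.\<close>

lemma law_flow_transition:
  assumes X: "markov_jump_process M X \<alpha> x0"
  obtains P where "\<And>x y. ((\<lambda>h. (P h x y - (if x = y then 1 else 0)) / h) \<longlongrightarrow> \<alpha> x $ y) (at_right 0)"
    "\<And>t h y. 0 \<le> t \<Longrightarrow> 0 < h \<Longrightarrow> law_flow M X (t + h) $ y = (\<Sum>x\<in>UNIV. law_flow M X t $ x * P h x y)"
proof -
  have "\<exists>P. (\<forall>x y. ((\<lambda>h. (P h x y - (if x = y then 1 else 0)) / h) \<longlongrightarrow> \<alpha> x $ y) (at_right 0)) \<and>
        (\<forall>t\<ge>0. \<forall>h>0. \<forall>A\<in>history M X t. \<forall>x y.
           measure M (A \<inter> {\<omega>\<in>space M. X t \<omega> = x \<and> X (t + h) \<omega> = y}) =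
           measure M (A \<inter> {\<omega>\<in>space M. X t \<omega> = x}) * P h x y)"
    using X unfolding markov_jump_process_def by (elim conjE)
  then obtain P where PP: "(\<forall>x y. ((\<lambda>h. (P h x y - (if x = y then 1 else 0)) / h) \<longlongrightarrow> \<alpha> x $ y) (at_right 0)) \<and>
        (\<forall>t\<ge>0. \<forall>h>0. \<forall>A\<in>history M X t. \<forall>x y.
           measure M (A \<inter> {\<omega>\<in>space M. X t \<omega> = x \<and> X (t + h) \<omega> = y}) =
           measure M (A \<inter> {\<omega>\<in>space M. X t \<omega> = x}) * P h x y)"
    by (elim exE)
  have P: "((\<lambda>h. (P h x y - (if x = y then 1 else 0)) / h) \<longlongrightarrow> \<alpha> x $ y) (at_right 0)" for x y
    using PP by (elim conjE) (erule allE, erule allE)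
  have mk: "measure M (A \<inter> {\<omega>\<in>space M. X t \<omega> = x \<and> X (t + h) \<omega> = y}) =
      measure M (A \<inter> {\<omega>\<in>space M. X t \<omega> = x}) * P h x y"
    if "0 \<le> t" "0 < h" "A \<in> history M X t" for t h A x y
    using PP[THEN conjunct2, rule_format, OF that] .
  have "law_flow M X (t + h) $ y = (\<Sum>x\<in>UNIV. law_flow M X t $ x * P h x y)"
    if t: "0 \<le> t" and h: "0 < h" for t h y
  proof -
    have th: "0 \<le> t + h" using t h by simp
    have sp: "space M \<in> history M X t" unfolding history_def by (rule sigma_sets_top)
    have "law_flow M X (t + h) $ y =
        (\<Sum>x\<in>UNIV. measure M ({\<omega>\<in>space M. X (t + h) \<omega> = y} \<inter> {\<omega>\<in>space M. X t \<omega> = x}))"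
      unfolding law_flow_def vec_lambda_beta
      by (rule measure_partition_by_state[OF markov_jump_prob_space[OF X]])
        (rule markov_jump_state_sets[OF X th], rule markov_jump_state_sets[OF X t])
    also have "\<dots> = (\<Sum>x\<in>UNIV. law_flow M X t $ x * P h x y)"
    proof (rule sum.cong[OF refl])
      fix x
      have "{\<omega>\<in>space M. X (t + h) \<omega> = y} \<inter> {\<omega>\<in>space M. X t \<omega> = x} =
          space M \<inter> {\<omega>\<in>space M. X t \<omega> = x \<and> X (t + h) \<omega> = y}"
        "space M \<inter> {\<omega>\<in>space M. X t \<omega> = x} = {\<omega>\<in>space M. X t \<omega> = x}" by auto
      then show "measure M ({\<omega>\<in>space M. X (t + h) \<omega> = y} \<inter> {\<omega>\<in>space M. X t \<omega> = x}) =
          law_flow M X t $ x * P h x y"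
        using mk[OF t h sp, of x y] by (simp add: law_flow_def)
    qed
    finally show ?thesis .
  qed
  with P show ?thesis by (rule that)
qed

text \<open>The assumption on \<open>P\<close> concerns small positive times, so it gives the right derivative at
  once. For the left derivative, the increment over \<open>[t - h, t]\<close> is expressed through the law
  at \<open>t - h\<close>; this law converges to the one at \<open>t\<close>, because the same formula bounds the
  increment by \<open>h\<close> times a convergent quantity.\<close>

lemma law_flow_derivative:
  assumes X: "markov_jump_process M X \<alpha> x0" and t: "0 \<le> t"
  shows "((\<lambda>t. law_flow M X t $ y) has_real_derivative (\<Sum>x\<in>UNIV. law_flow M X t $ x * \<alpha> x $ y))
      (at t within {0..})"
proof (rule law_flow_transition[OF X])
  fix P
  assume P: "\<And>x y. ((\<lambda>h. (P h x y - (if x = y then 1 else 0)) / h) \<longlongrightarrow> \<alpha> x $ y) (at_right 0)"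
    and step: "\<And>t h y. 0 \<le> t \<Longrightarrow> 0 < h \<Longrightarrow>
      law_flow M X (t + h) $ y = (\<Sum>x\<in>UNIV. law_flow M X t $ x * P h x y)"
  define p where "p t y = law_flow M X t $ y" for t y
  define q where "q h x y = (P h x y - (if x = y then 1 else 0)) / h" for h x y
  have q: "((\<lambda>h. q h x y) \<longlongrightarrow> \<alpha> x $ y) (at_right 0)" for x y using P by (simp add: q_def)
  have inc: "p (s + h) y - p s y = h * (\<Sum>x\<in>UNIV. p s x * q h x y)" if "0 \<le> s" "0 < h" for s h y
  proof -
    have hq: "h * q h x y = P h x y - (if x = y then 1 else 0)" for x using that by (simp add: q_def)
    have "h * (\<Sum>x\<in>UNIV. p s x * q h x y) = (\<Sum>x\<in>UNIV. p s x * P h x y - (if x = y then p s x else 0))"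
      unfolding sum_distrib_left mult.left_commute[of h] hq by (intro sum.cong refl) (simp add: algebra_simps)
    then show ?thesis using step[OF that] by (simp add: p_def sum_subtractf)
  qed
  have p01: "0 \<le> p s x" "p s x \<le> 1" if "0 \<le> s" for s x
    using prob_simplexD[OF law_flow_in_simplex[OF X that]] by (auto simp: p_def)
  let ?D = "\<Sum>x\<in>UNIV. p t x * \<alpha> x $ y"
  have right: "((\<lambda>s. (p s y - p t y) / (s - t)) \<longlongrightarrow> ?D) (at_right t)"
    unfolding filterlim_at_right_to_0[of _ _ t]
  proof (rule Lim_transform_eventually)
    show "((\<lambda>h. \<Sum>x\<in>UNIV. p t x * q h x y) \<longlongrightarrow> ?D) (at_right 0)" by (intro tendsto_intros q)
    show "\<forall>\<^sub>F h in at_right 0. (\<Sum>x\<in>UNIV. p t x * q h x y) = (p (h + t) y - p t y) / (h + t - t)"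
      using eventually_at_right_less[of 0]
    proof eventually_elim
      case (elim h) then show ?case using inc[OF t elim, of y] by (simp add: add.commute)
    qed
  qed
  have left: "((\<lambda>s. (p s y - p t y) / (s - t)) \<longlongrightarrow> ?D) (at_left t)" if t0: "0 < t"
  proof -
    have small: "\<forall>\<^sub>F h in at_right 0. 0 < h \<and> h < t"
      unfolding eventually_at_right_field using t0 by auto
    have cont: "((\<lambda>h. p (t - h) x) \<longlongrightarrow> p t x) (at_right 0)" for x
    proof -
      have "((\<lambda>h. h * (\<Sum>z\<in>UNIV. \<bar>q h z x\<bar>)) \<longlongrightarrow> 0 * (\<Sum>z\<in>UNIV. \<bar>\<alpha> z $ x\<bar>)) (at_right 0)"
        by (intro tendsto_intros q)
      then have lim: "((\<lambda>h. h * (\<Sum>z\<in>UNIV. \<bar>q h z x\<bar>)) \<longlongrightarrow> 0) (at_right 0)" by simp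
      have "((\<lambda>h. p (t - h) x - p t x) \<longlongrightarrow> 0) (at_right 0)"
      proof (rule Lim_null_comparison[OF _ lim])
        show "\<forall>\<^sub>F h in at_right 0. norm (p (t - h) x - p t x) \<le> h * (\<Sum>z\<in>UNIV. \<bar>q h z x\<bar>)"
          using small
        proof eventually_elim
          case (elim h)
          have "\<bar>p t x - p (t - h) x\<bar> = h * \<bar>\<Sum>z\<in>UNIV. p (t - h) z * q h z x\<bar>"
            using inc[of "t - h" h x] elim by (simp add: abs_mult)
          also have "\<dots> \<le> h * (\<Sum>z\<in>UNIV. \<bar>p (t - h) z * q h z x\<bar>)"
            using elim by (intro mult_left_mono sum_abs) auto
          also have "\<dots> \<le> h * (\<Sum>z\<in>UNIV. \<bar>q h z x\<bar>)"
            using elim p01[of "t - h"]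
            by (intro mult_left_mono sum_mono) (auto simp: abs_mult intro: mult_left_le_one_le)
          finally show ?case by (simp add: abs_minus_commute)
        qed
      qed
      then show ?thesis by (rule LIM_zero_cancel)
    qed
    show ?thesis
      unfolding filterlim_at_left_to_right[of _ _ t] filterlim_at_right_to_0[of _ _ "- t"]
    proof (rule Lim_transform_eventually)
      show "((\<lambda>h. \<Sum>x\<in>UNIV. p (t - h) x * q h x y) \<longlongrightarrow> ?D) (at_right 0)" by (intro tendsto_intros q cont)
      show "\<forall>\<^sub>F h in at_right 0. (\<Sum>x\<in>UNIV. p (t - h) x * q h x y) =
          (p (- (h + - t)) y - p t y) / (- (h + - t) - t)"
        using small
      proof eventually_elim
        case (elim h) then show ?case using inc[of "t - h" h y] by (simp add: field_simps)
      qed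
    qed
  qed
  have "((\<lambda>s. (p s y - p t y) / (s - t)) \<longlongrightarrow> ?D) (at t within {0..})"
  proof (cases "t = 0")
    case True
    then show ?thesis using right by (simp add: at_within_Ici_at_right)
  next
    case False
    then have "0 < t" using t by simp
    from filterlim_split_at[OF left[OF this] right] show ?thesis
      by (rule tendsto_within_subset) simp
  qed
  then show ?thesis unfolding has_field_derivative_iff p_def .
qed

lemma C1_flow_law_flow:
  assumes X: "markov_jump_process M X \<alpha> x0"
  shows "C1_flow (law_flow M X)"
proof -
  let ?D = "\<lambda>t. \<chi> y. \<Sum>x\<in>UNIV. law_flow M X t $ x * \<alpha> x $ y"
  have d: "(law_flow M X has_vector_derivative ?D t) (at t within {0..})" if "0 \<le> t" for t
    using law_flow_derivative[OF X that] by (intro flow_component_derivative) simp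
  have "continuous_on {0..} (law_flow M X)"
    unfolding continuous_on_eq_continuous_within
    using d by (auto intro: has_vector_derivative_continuous)
  then have "continuous_on {0..} ?D" by (intro continuous_intros)
  then show ?thesis unfolding C1_flow_def
    using law_flow_in_simplex[OF X] d by (intro conjI exI[of _ ?D]) auto
qed

lemma C1_flow_continuous: "C1_flow \<mu> \<Longrightarrow> continuous_on {0..} \<mu>"
  unfolding C1_flow_def continuous_on_eq_continuous_within
  by (auto intro: has_vector_derivative_continuous)

lemma law_flow_tendsto_invariant:
  fixes \<alpha> :: "'d::finite \<Rightarrow> real ^ 'd"
  assumes X: "markov_jump_process M X \<alpha> x0" and \<alpha>: "\<alpha> \<in> controls al au" and \<pi>: "invariant_dist \<alpha> \<pi>"
    and al: "0 < al" "0 < au"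
  shows "(law_flow M X \<longlongrightarrow> \<pi>) at_top"
proof (rule kolmogorov_forward_convergence[OF \<alpha> \<pi> al])
  fix t :: real and y :: 'd assume t: "0 \<le> t"
  show "law_flow M X t \<in> prob_simplex" by (rule law_flow_in_simplex[OF X t])
  show "((\<lambda>t. law_flow M X t $ y) has_real_derivative (\<Sum>x\<in>UNIV. law_flow M X t $ x * \<alpha> x $ y))
      (at t within {0..})" by (rule law_flow_derivative[OF X t])
qed

section \<open>Ergodic costs and equilibria\<close>

text \<open>Right-continuity of the paths makes the process jointly measurable: \<open>X t\<close> is the limit of
  \<open>X\<close> at the next grid point strictly to the right of \<open>t\<close>, and the sampled process takes
  countably many time values.\<close>

lemma state_indicator_measurable:
  fixes X :: "real \<Rightarrow> 'w \<Rightarrow> 'd::finite"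
  assumes X: "markov_jump_process M X \<alpha> x0"
  shows "(\<lambda>z. if 0 \<le> snd z \<and> X (snd z) (fst z) = x then 1 else 0 :: real)
    \<in> borel_measurable (M \<Otimes>\<^sub>M lborel)"
proof -
  define k where "k n t = nat \<lfloor>real (Suc n) * t\<rfloor>" for n t
  define s where "s n j = real (Suc j) / real (Suc n)" for n j
  define A where "A n j = {\<omega>\<in>space M. X (s n j) \<omega> = x}" for n j
  have A: "A n j \<in> sets M" for n j
    unfolding A_def by (rule markov_jump_state_sets[OF X]) (simp add: s_def)
  define u where "u n z = (if 0 \<le> snd z then indicator (A n (k n (snd z))) (fst z) else 0 :: real)" for n z
  show ?thesis
  proof (rule borel_measurable_LIMSEQ_real)
    fix n
    have "(\<lambda>z. indicator (A n (k n (snd z))) (fst z) :: real) \<in> borel_measurable (M \<Otimes>\<^sub>M lborel)"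
    proof (rule measurable_compose_countable[where f = "\<lambda>j z. indicator (A n j) (fst z)" and g = "\<lambda>z. k n (snd z)"])
      show "(\<lambda>z. indicator (A n j) (fst z) :: real) \<in> borel_measurable (M \<Otimes>\<^sub>M lborel)" for j
        using A by (intro measurable_compose[OF measurable_fst borel_measurable_indicator])
      show "(\<lambda>z. k n (snd z)) \<in> measurable (M \<Otimes>\<^sub>M lborel) (count_space UNIV)"
        unfolding k_def by measurable
    qed
    then show "u n \<in> borel_measurable (M \<Otimes>\<^sub>M lborel)"
      unfolding u_def[abs_def] by measurable
  next
    fix z :: "'w \<times> real" assume z: "z \<in> space (M \<Otimes>\<^sub>M lborel)"
    obtain \<omega> t where zt: "z = (\<omega>, t)" by (cases z)
    have \<omega>: "\<omega> \<in> space M" using z by (simp add: zt space_pair_measure)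
    show "(\<lambda>n. u n z) \<longlonglongrightarrow> (if 0 \<le> snd z \<and> X (snd z) (fst z) = x then 1 else 0)"
    proof (cases "0 \<le> t")
      case True
      have gt: "t < s n (k n t)" and le: "s n (k n t) \<le> t + inverse (real (Suc n))" for n
      proof -
        let ?N = "real (Suc n)"
        have N: "0 < ?N" by simp
        then have Ni: "(t + inverse ?N) * ?N = ?N * t + 1"
          by (simp add: field_simps del: of_nat_Suc)
        have "0 \<le> ?N * t" using True by simp
        then have "real (k n t) = of_int \<lfloor>?N * t\<rfloor>" by (simp add: k_def)
        then have "real (k n t) \<le> ?N * t" "?N * t < real (k n t) + 1" by linarith+
        then have "t * ?N < real (Suc (k n t))" "real (Suc (k n t)) \<le> (t + inverse ?N) * ?N"
          using Ni by (simp_all only: mult.commute[of t ?N] of_nat_Suc[of "k n t"])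
        then show "t < s n (k n t)" "s n (k n t) \<le> t + inverse ?N"
          unfolding s_def using N by (auto simp: pos_less_divide_eq pos_divide_le_eq simp del: of_nat_Suc)
      qed
      have "(\<lambda>n. s n (k n t)) \<longlonglongrightarrow> t"
        by (rule tendsto_sandwich[OF _ _ tendsto_const LIMSEQ_inverse_real_of_nat_add])
          (use less_imp_le[OF gt] le in auto)
      then have "filterlim (\<lambda>n. s n (k n t)) (at_right t) sequentially"
        by (rule tendsto_imp_filterlim_at_right) (use gt in auto)
      from eventually_compose_filterlim[OF markov_jump_right_continuous[OF X \<omega> True] this]
      have "\<forall>\<^sub>F n in sequentially. u n z = (if 0 \<le> snd z \<and> X (snd z) (fst z) = x then 1 else 0)"
        by eventually_elim (use True \<omega> in \<open>auto simp: u_def zt A_def\<close>)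
      then show ?thesis by (rule tendsto_eventually)
    qed (simp add: u_def zt)
  qed
qed

lemma expected_running_cost:
  fixes X :: "real \<Rightarrow> 'w \<Rightarrow> 'd::finite"
  assumes X: "markov_jump_process M X \<alpha> x0" and c: "\<And>x. continuous_on {0..} (c x)"
  shows "(\<integral>\<omega>. (LINT t:{0..T}|lborel. c (X t \<omega>) t) \<partial>M) =
    integral {0..T} (\<lambda>t. \<Sum>x\<in>UNIV. law_flow M X t $ x * c x t)"
proof -
  interpret M: prob_space M by (rule markov_jump_prob_space[OF X])
  interpret pair_sigma_finite M lborel ..
  define Y where "Y x z = (if 0 \<le> snd z \<and> X (snd z) (fst z) = x then 1 else 0 :: real)" for x and z :: "'w \<times> real"
  define cT where "cT x t = indicator {0..T} t *\<^sub>R c x t" for x t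
  have cc: "continuous_on {0..T} (c x)" for x by (rule continuous_on_subset[OF c]) auto
  have cT_meas: "cT x \<in> borel_measurable borel" for x
    unfolding cT_def[abs_def] by (rule borel_measurable_continuous_on_indicator[OF _ cc]) simp
  have bdd: "\<exists>b. \<forall>t. \<bar>cT x t\<bar> \<le> b" for x
  proof -
    have "bounded (c x ` {0..T})" by (intro compact_imp_bounded compact_continuous_image cc) simp
    then obtain b where "\<forall>t\<in>{0..T}. \<bar>c x t\<bar> \<le> b" by (auto simp: bounded_iff)
    then have "\<bar>cT x t\<bar> \<le> \<bar>b\<bar>" for t by (auto simp: cT_def indicator_def) (meson abs_ge_self order_trans atLeastAtMost_iff)
    then show ?thesis by blast
  qed
  define b where "b x = (SOME b. \<forall>t. \<bar>cT x t\<bar> \<le> b)" for x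
  have b: "\<bar>cT x t\<bar> \<le> b x" for x t using someI_ex[OF bdd] unfolding b_def by blast
  define G where "G \<omega> t = (\<Sum>x\<in>UNIV. Y x (\<omega>, t) * cT x t)" for \<omega> t
  have G_meas: "case_prod G \<in> borel_measurable (M \<Otimes>\<^sub>M lborel)"
  proof -
    have "(\<lambda>z. \<Sum>x\<in>UNIV. Y x z * cT x (snd z)) \<in> borel_measurable (M \<Otimes>\<^sub>M lborel)"
      unfolding Y_def[abs_def] using cT_meas
      by (intro borel_measurable_sum borel_measurable_times state_indicator_measurable[OF X]
          measurable_compose[OF measurable_snd]) simp
    moreover have "case_prod G = (\<lambda>z. \<Sum>x\<in>UNIV. Y x z * cT x (snd z))"
      by (rule ext) (simp add: G_def case_prod_beta)
    ultimately show ?thesis by simp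
  qed
  have G_bound: "\<bar>G \<omega> t\<bar> \<le> (\<Sum>x\<in>UNIV. b x)" for \<omega> t
  proof -
    have "\<bar>Y x (\<omega>, t) * cT x t\<bar> \<le> b x" for x
      using b[of x t] by (auto simp: Y_def)
    then show ?thesis unfolding G_def by (intro order_trans[OF sum_abs] sum_mono)
  qed
  have "integrable (M \<Otimes>\<^sub>M lborel) (case_prod G)"
  proof (rule integrableI_bounded_set[where A = "space M \<times> {0..T}" and B = "\<Sum>x\<in>UNIV. b x"])
    have "emeasure (M \<Otimes>\<^sub>M lborel) (space M \<times> {0..T}) = emeasure M (space M) * emeasure lborel {0..T}"
      by (intro lborel.emeasure_pair_measure_Times) auto
    also have "\<dots> < \<infinity>" by (simp add: M.emeasure_space_1 emeasure_lborel_Icc_eq)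
    finally show "emeasure (M \<Otimes>\<^sub>M lborel) (space M \<times> {0..T}) < \<infinity>" .
    show "AE z in M \<Otimes>\<^sub>M lborel. z \<notin> space M \<times> {0..T} \<longrightarrow> case_prod G z = 0"
    proof (intro AE_I2 impI)
      fix z assume z: "z \<in> space (M \<Otimes>\<^sub>M lborel)" "z \<notin> space M \<times> {0..T}"
      then have "snd z \<notin> {0..T}" by (cases z) (simp add: space_pair_measure)
      then show "case_prod G z = 0" by (cases z) (simp add: G_def cT_def)
    qed
  qed (use G_meas G_bound in auto)
  from Fubini_integral[OF this]
  have swap: "(\<integral>\<omega>. (\<integral>t. G \<omega> t \<partial>lborel) \<partial>M) = (\<integral>t. (\<integral>\<omega>. G \<omega> t \<partial>M) \<partial>lborel)" by simp
  have "(LINT t:{0..T}|lborel. c (X t \<omega>) t) = (\<integral>t. G \<omega> t \<partial>lborel)" for \<omega>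
  proof -
    have "indicator {0..T} t *\<^sub>R c (X t \<omega>) t = G \<omega> t" for t
    proof (cases "t \<in> {0..T}")
      case True
      then have "G \<omega> t = (\<Sum>x\<in>UNIV. if X t \<omega> = x then c x t else 0)"
        unfolding G_def by (intro sum.cong refl) (simp add: Y_def cT_def)
      then show ?thesis using True by simp
    qed (simp add: G_def cT_def)
    then show ?thesis by (simp add: set_lebesgue_integral_def)
  qed
  then have "(\<integral>\<omega>. (LINT t:{0..T}|lborel. c (X t \<omega>) t) \<partial>M) = (\<integral>t. (\<integral>\<omega>. G \<omega> t \<partial>M) \<partial>lborel)"
    by (simp add: swap)
  also have "\<dots> = (LINT t:{0..T}|lborel. (\<Sum>x\<in>UNIV. law_flow M X t $ x * c x t))"
    unfolding set_lebesgue_integral_def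
  proof (rule arg_cong[where f = "integral\<^sup>L lborel"], rule ext)
    fix t
    show "(\<integral>\<omega>. G \<omega> t \<partial>M) = indicator {0..T} t *\<^sub>R (\<Sum>x\<in>UNIV. law_flow M X t $ x * c x t)"
    proof (cases "t \<in> {0..T}")
      case True
      let ?E = "\<lambda>x. {\<omega>\<in>space M. X t \<omega> = x}"
      have E: "?E x \<in> sets M" for x using markov_jump_state_sets[OF X] True by simp
      have "(\<integral>\<omega>. G \<omega> t \<partial>M) = (\<integral>\<omega>. (\<Sum>x\<in>UNIV. indicator (?E x) \<omega> * c x t) \<partial>M)"
        unfolding G_def using True
        by (intro Bochner_Integration.integral_cong sum.cong refl) (auto simp: Y_def cT_def indicator_def)
      also have "\<dots> = (\<Sum>x\<in>UNIV. (\<integral>\<omega>. indicator (?E x) \<omega> * c x t \<partial>M))"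
        using E by (intro Bochner_Integration.integral_sum integrable_mult_left integrable_real_indicator)
          (auto simp: M.emeasure_eq_measure)
      also have "\<dots> = (\<Sum>x\<in>UNIV. law_flow M X t $ x * c x t)"
      proof (intro sum.cong refl)
        fix x
        have "?E x \<inter> space M = ?E x" by auto
        then show "(\<integral>\<omega>. indicator (?E x) \<omega> * c x t \<partial>M) = law_flow M X t $ x * c x t"
          by (simp add: law_flow_def)
      qed
      finally show ?thesis using True by simp
    qed (simp add: G_def cT_def)
  qed
  also have "\<dots> = integral {0..T} (\<lambda>t. \<Sum>x\<in>UNIV. law_flow M X t $ x * c x t)"
  proof (rule set_borel_integral_eq_integral(2), rule borel_integrable_atLeastAtMost')
    have "continuous_on {0..T} (law_flow M X)"
      by (rule continuous_on_subset[OF C1_flow_continuous[OF C1_flow_law_flow[OF X]]]) auto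
    then show "continuous_on {0..T} (\<lambda>t. \<Sum>x\<in>UNIV. law_flow M X t $ x * c x t)"
      by (intro continuous_intros cc)
  qed
  finally show ?thesis .
qed

text \<open>L'Hospital's rule, with the integrand as derivative of the integral.\<close>

lemma cesaro_integral_limit:
  fixes h :: "real \<Rightarrow> real"
  assumes h: "continuous_on {0..} h" and lim: "(h \<longlongrightarrow> L) at_top"
  shows "((\<lambda>T. integral {0..T} h / T) \<longlongrightarrow> L) at_top"
proof (rule lhospital_at_top_at_top[where f' = h and g' = "\<lambda>_. 1"])
  show "\<forall>\<^sub>F T in at_top. ((\<lambda>T. integral {0..T} h) has_real_derivative h T) (at T)"
    using eventually_gt_at_top[of 0]
  proof eventually_elim
    case (elim T)
    have "((\<lambda>T. integral {0..T} h) has_vector_derivative h T) (at T within {0..T + 1})"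
      by (rule integral_has_vector_derivative[OF continuous_on_subset[OF h]]) (use elim in auto)
    moreover have "at T within {0..T + 1} = at T" using elim by (intro at_within_interior) simp
    ultimately show ?case by (simp add: has_real_derivative_iff_has_vector_derivative)
  qed
  show "LIM T at_top. T :> at_top" by (rule filterlim_ident)
qed (use lim in auto)

text \<open>The upper limit in the cost is a limit, because both the law of the process and the
  population converge. The initial state and the transient behaviour of the population
  disappear from the cost, which leaves a static problem over controls and their invariant
  distributions.\<close>

lemma ergodic_cost_eq_average:
  fixes \<alpha> :: "'d::finite \<Rightarrow> real ^ 'd"
  assumes X: "markov_jump_process M X \<alpha> x0" and \<alpha>: "\<alpha> \<in> controls al au" and \<pi>: "invariant_dist \<alpha> \<pi>"
    and al: "0 < al" "0 < au" and F: "\<And>x. continuous_on prob_simplex (F x)"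
    and \<nu>: "C1_flow \<nu>" and lim: "(\<nu> \<longlongrightarrow> m) at_top" and m: "m \<in> prob_simplex"
  shows "ergodic_cost f F M X \<alpha> \<nu> = ereal (\<Sum>x\<in>UNIV. \<pi> $ x * (f x (\<alpha> x) + F x m))"
proof -
  let ?c = "\<lambda>x t. f x (\<alpha> x) + F x (\<nu> t)"
  let ?h = "\<lambda>t. \<Sum>x\<in>UNIV. law_flow M X t $ x * ?c x t"
  have \<nu>s: "\<nu> t \<in> prob_simplex" if "0 \<le> t" for t using \<nu> that by (simp add: C1_flow_def)
  have c: "continuous_on {0..} (?c x)" for x
    by (intro continuous_intros continuous_on_compose2[OF F C1_flow_continuous[OF \<nu>]]) (use \<nu>s in auto)
  have h: "continuous_on {0..} ?h"
    by (intro continuous_intros c C1_flow_continuous[OF C1_flow_law_flow[OF X]])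
  have "((\<lambda>t. F x (\<nu> t)) \<longlongrightarrow> F x m) at_top" for x
    by (rule continuous_on_tendsto_compose[OF F lim m])
      (use \<nu>s in \<open>auto intro: eventually_at_top_linorderI[of 0]\<close>)
  then have "(?h \<longlongrightarrow> (\<Sum>x\<in>UNIV. \<pi> $ x * (f x (\<alpha> x) + F x m))) at_top"
    by (intro tendsto_intros law_flow_tendsto_invariant[OF X \<alpha> \<pi> al])
  note ces = cesaro_integral_limit[OF h this]
  have E: "(\<integral>\<omega>. (LINT t:{0..T}|lborel. ?c (X t \<omega>) t) \<partial>M) = integral {0..T} ?h" for T
    by (rule expected_running_cost[where c = ?c, OF X c])
  have "((\<lambda>T. ereal ((1 / T) * (\<integral>\<omega>. (LINT t:{0..T}|lborel. ?c (X t \<omega>) t) \<partial>M)))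
      \<longlongrightarrow> ereal (\<Sum>x\<in>UNIV. \<pi> $ x * (f x (\<alpha> x) + F x m))) at_top"
    unfolding E using ces by (intro tendsto_ereal) simp
  then show ?thesis
    unfolding ergodic_cost_def by (intro lim_imp_Limsup) auto
qed

context rate_control
begin

text \<open>Verification identity: the excess of the average cost of a control over \<open>\<rho>\<close> is the average
  of its defects in the minimization that defines the Hamiltonian, since the generator part
  averages to zero. The defects are nonnegative, and vanish only for the optimal feedback, as
  invariant distributions charge every state.\<close>

lemma average_cost_gap:
  assumes \<alpha>: "\<alpha> \<in> controls al au" and \<pi>: "invariant_dist \<alpha> \<pi>"
    and hjb: "\<And>x. \<rho> = H x (Delta x u) + F x m"
  shows "(\<Sum>x\<in>UNIV. \<pi> $ x * (f x (\<alpha> x) + F x m)) - \<rho> =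
    (\<Sum>x\<in>UNIV. \<pi> $ x * (f x (\<alpha> x) + \<alpha> x \<bullet> Delta x u - H x (Delta x u)))"
proof -
  have "(\<Sum>x\<in>UNIV. \<pi> $ x) = 1" using \<pi> prob_simplexD(2) by (auto simp: invariant_dist_def)
  then have "\<rho> = (\<Sum>x\<in>UNIV. \<pi> $ x * \<rho>)" by (simp add: sum_distrib_right[symmetric])
  also have "\<dots> = (\<Sum>x\<in>UNIV. \<pi> $ x * (H x (Delta x u) + F x m))" using hjb by (metis (no_types, lifting))
  finally have \<rho>: "\<rho> = (\<Sum>x\<in>UNIV. \<pi> $ x * (H x (Delta x u) + F x m))" .
  have "(\<Sum>x\<in>UNIV. \<pi> $ x * (f x (\<alpha> x) + F x m)) - \<rho> =
      (\<Sum>x\<in>UNIV. \<pi> $ x * (f x (\<alpha> x) - H x (Delta x u)))"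
    unfolding \<rho> sum_subtractf[symmetric] by (intro sum.cong refl) (simp add: algebra_simps)
  also have "\<dots> = (\<Sum>x\<in>UNIV. \<pi> $ x * (f x (\<alpha> x) - H x (Delta x u)))
      + (\<Sum>x\<in>UNIV. \<pi> $ x * (\<alpha> x \<bullet> Delta x u))"
    using invariant_dist_dot[OF \<alpha> \<pi>] by simp
  also have "\<dots> = (\<Sum>x\<in>UNIV. \<pi> $ x * (f x (\<alpha> x) + \<alpha> x \<bullet> Delta x u - H x (Delta x u)))"
    unfolding sum.distrib[symmetric] by (intro sum.cong refl) (simp add: algebra_simps)
  finally show ?thesis .
qed

lemma average_cost_ge:
  assumes \<alpha>: "\<alpha> \<in> controls al au" and \<pi>: "invariant_dist \<alpha> \<pi>"
    and hjb: "\<And>x. \<rho> = H x (Delta x u) + F x m"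
  shows "\<rho> \<le> (\<Sum>x\<in>UNIV. \<pi> $ x * (f x (\<alpha> x) + F x m))"
proof -
  have "0 \<le> (\<Sum>x\<in>UNIV. \<pi> $ x * (f x (\<alpha> x) + \<alpha> x \<bullet> Delta x u - H x (Delta x u)))"
    using \<alpha> \<pi> prob_simplexD(1) H_le
    by (intro sum_nonneg mult_nonneg_nonneg) (auto simp: invariant_dist_def controls_def)
  then show ?thesis using average_cost_gap[where F = F, OF \<alpha> \<pi> hjb] by linarith
qed

lemma average_cost_feedback:
  assumes \<pi>: "invariant_dist (feedback u) \<pi>" and hjb: "\<And>x. \<rho> = H x (Delta x u) + F x m"
  shows "(\<Sum>x\<in>UNIV. \<pi> $ x * (f x (feedback u x) + F x m)) = \<rho>"
  using average_cost_gap[where F = F, OF feedback_controls \<pi> hjb] by (simp add: H_eq)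

lemma average_cost_minimal_imp_feedback:
  assumes \<alpha>: "\<alpha> \<in> controls al au" and \<pi>: "invariant_dist \<alpha> \<pi>"
    and hjb: "\<And>x. \<rho> = H x (Delta x u) + F x m"
    and le: "(\<Sum>x\<in>UNIV. \<pi> $ x * (f x (\<alpha> x) + F x m)) \<le> \<rho>"
  shows "\<alpha> = feedback u"
proof
  fix x
  let ?g = "\<lambda>x. f x (\<alpha> x) + \<alpha> x \<bullet> Delta x u - H x (Delta x u)"
  have \<pi>s: "\<pi> \<in> prob_simplex" using \<pi> by (simp add: invariant_dist_def)
  have g: "0 \<le> ?g x" for x using H_le[of "\<alpha> x" x "Delta x u"] \<alpha> by (simp add: controls_def)
  have nn: "0 \<le> \<pi> $ x * ?g x" for x using g[of x] prob_simplexD(1)[OF \<pi>s, of x] by (rule mult_nonneg_nonneg[rotated])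
  have "(\<Sum>x\<in>UNIV. \<pi> $ x * ?g x) \<le> 0" using average_cost_gap[where F = F, OF \<alpha> \<pi> hjb] le by linarith
  then have "\<pi> $ x * ?g x \<le> 0" using member_le_sum[of x UNIV "\<lambda>x. \<pi> $ x * ?g x"] nn by force
  moreover have "0 < \<pi> $ x"
  proof -
    have "0 < al / (al + real CARD('d) * au)" using al au_pos by (simp add: add_pos_pos)
    then show ?thesis using invariant_dist_lower_bound[OF \<alpha> \<pi> al(1), of x] au_pos by linarith
  qed
  ultimately have "?g x = 0" using g[of x] by (simp add: mult_le_0_iff)
  then show "\<alpha> x = feedback u x"
    using \<alpha> by (intro H_eq_imp_opt_rate) (auto simp: controls_def)
qed

lemma solution_imp_equilibrium:
  assumes F: "\<And>x. continuous_on prob_simplex (F x)" and sol: "solves_mfg F 0 \<rho> u \<mu>"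
    and X: "player_processes al au M X x0"
  shows "ergodic_equilibrium al au f F M X (feedback u) (law_flow (M (feedback u)) (X (feedback u)))"
proof -
  let ?\<alpha> = "feedback u"
  let ?\<nu> = "law_flow (M ?\<alpha>) (X ?\<alpha>)"
  have inv: "invariant_dist ?\<alpha> \<mu>" and hjb: "\<And>x. \<rho> = H x (Delta x u) + F x \<mu>"
    using sol by (auto simp: solves_mfg_def)
  have mj: "markov_jump_process (M \<alpha>) (X \<alpha>) \<alpha> x0" if "\<alpha> \<in> controls al au" for \<alpha>
    using X that by (simp add: player_processes_def)
  note mja = mj[OF feedback_controls]
  have lim: "(?\<nu> \<longlongrightarrow> \<mu>) at_top"
    by (rule law_flow_tendsto_invariant[OF mja feedback_controls inv al(1) au_pos])
  have cost: "ergodic_cost f F (M \<alpha>) (X \<alpha>) \<alpha> ?\<nu> = ereal (\<Sum>x\<in>UNIV. \<pi> $ x * (f x (\<alpha> x) + F x \<mu>))"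
    if \<alpha>: "\<alpha> \<in> controls al au" and \<pi>: "invariant_dist \<alpha> \<pi>" for \<alpha> \<pi>
    by (rule ergodic_cost_eq_average[OF mj[OF \<alpha>] \<alpha> \<pi> al(1) au_pos F C1_flow_law_flow[OF mja] lim
          solves_mfg_simplex[OF sol]])
  have "ergodic_cost f F (M ?\<alpha>) (X ?\<alpha>) ?\<alpha> ?\<nu> \<le> ergodic_cost f F (M \<alpha>) (X \<alpha>) \<alpha> ?\<nu>"
    if \<alpha>: "\<alpha> \<in> controls al au" for \<alpha>
  proof (rule invariant_dist_exists[OF \<alpha> less_imp_le[OF al(1)] au_pos])
    fix \<pi> assume \<pi>: "invariant_dist \<alpha> \<pi>"
    show ?thesis
      unfolding cost[OF feedback_controls inv] cost[OF \<alpha> \<pi>] average_cost_feedback[where F = F, OF inv hjb]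
      using average_cost_ge[where F = F, OF \<alpha> \<pi> hjb] by simp
  qed
  then show ?thesis
    using C1_flow_law_flow[OF mja] feedback_controls by (simp add: ergodic_equilibrium_def)
qed

text \<open>In an equilibrium the population converges to the invariant distribution \<open>m\<close> of the control.
  Against the constant population \<open>m\<close>, the ergodic control problem has a solution of its
  Hamilton-Jacobi equation, and the equilibrium control attains its value; so it is the
  optimal feedback, and \<open>m\<close> is invariant for it.\<close>

lemma equilibrium_imp_solution:
  assumes F: "\<And>x. continuous_on prob_simplex (F x)" and X: "player_processes al au M X x0"
    and eq: "ergodic_equilibrium al au f F M X \<alpha> \<nu>"
  obtains \<rho> u m where "solves_mfg F 0 \<rho> u m" "\<alpha> = feedback u" "(\<nu> \<longlongrightarrow> m) at_top"
    "ergodic_cost f F (M \<alpha>) (X \<alpha>) \<alpha> \<nu> = ereal \<rho>"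
proof -
  have mj: "markov_jump_process (M \<beta>) (X \<beta>) \<beta> x0" if "\<beta> \<in> controls al au" for \<beta>
    using X that by (simp add: player_processes_def)
  have \<alpha>: "\<alpha> \<in> controls al au" and \<nu>: "C1_flow \<nu>"
    and law: "\<And>t. 0 \<le> t \<Longrightarrow> law_flow (M \<alpha>) (X \<alpha>) t = \<nu> t"
    and opt: "\<And>\<beta>. \<beta> \<in> controls al au \<Longrightarrow>
      ergodic_cost f F (M \<alpha>) (X \<alpha>) \<alpha> \<nu> \<le> ergodic_cost f F (M \<beta>) (X \<beta>) \<beta> \<nu>"
    using eq by (auto simp: ergodic_equilibrium_def)
  obtain m where m: "invariant_dist \<alpha> m"
    by (rule invariant_dist_exists[OF \<alpha> less_imp_le[OF al(1)] au_pos])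
  have ms: "m \<in> prob_simplex" using m by (simp add: invariant_dist_def)
  have lim: "(\<nu> \<longlongrightarrow> m) at_top"
  proof (rule Lim_transform_eventually)
    show "(law_flow (M \<alpha>) (X \<alpha>) \<longlongrightarrow> m) at_top"
      by (rule law_flow_tendsto_invariant[OF mj[OF \<alpha>] \<alpha> m al(1) au_pos])
    show "\<forall>\<^sub>F t in at_top. law_flow (M \<alpha>) (X \<alpha>) t = \<nu> t"
      using law by (auto intro: eventually_at_top_linorderI[of 0])
  qed
  have cost: "ergodic_cost f F (M \<beta>) (X \<beta>) \<beta> \<nu> = ereal (\<Sum>x\<in>UNIV. \<pi> $ x * (f x (\<beta> x) + F x m))"
    if \<beta>: "\<beta> \<in> controls al au" and \<pi>: "invariant_dist \<beta> \<pi>" for \<beta> \<pi>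
    by (rule ergodic_cost_eq_average[OF mj[OF \<beta>] \<beta> \<pi> al(1) au_pos F \<nu> lim ms])
  \<comment> \<open>the coupling is evaluated at \<open>m\<close> throughout, so the distribution \<open>\<mu>\<close> obtained here is not yet known to be \<open>m\<close>\<close>
  have Fm: "continuous_on prob_simplex ((\<lambda>x \<eta>. F x m) x)" for x by simp
  obtain \<rho> u \<mu> where sol: "solves_mfg (\<lambda>x \<eta>. F x m) 0 \<rho> u \<mu>"
    by (rule solves_mfg_exists[where F = "\<lambda>x \<eta>. F x m", OF Fm order_refl])
  have hjb: "\<rho> = H x (Delta x u) + F x m" for x using sol by (simp add: solves_mfg_def)
  have inv: "invariant_dist (feedback u) \<mu>" and u: "u \<in> zero_sum" using sol by (auto simp: solves_mfg_def)
  have "(\<Sum>x\<in>UNIV. m $ x * (f x (\<alpha> x) + F x m)) \<le> \<rho>"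
    using opt[OF feedback_controls, of u]
    unfolding cost[OF \<alpha> m] cost[OF feedback_controls inv] average_cost_feedback[where F = F, OF inv hjb]
    by simp
  from average_cost_minimal_imp_feedback[where F = F, OF \<alpha> m hjb this]
  have \<alpha>u: "\<alpha> = feedback u" .
  have mu: "invariant_dist (feedback u) m" using m \<alpha>u by simp
  have "ergodic_cost f F (M \<alpha>) (X \<alpha>) \<alpha> \<nu> = ereal \<rho>"
    unfolding cost[OF \<alpha> m] using average_cost_feedback[where F = F, OF mu hjb] by (simp add: \<alpha>u)
  moreover have "solves_mfg F 0 \<rho> u m" using u hjb mu by (simp add: solves_mfg_def)
  ultimately show ?thesis using \<alpha>u lim by (intro that)
qed

text \<open>At a minimum of \<open>v\<close> the generator term is nonnegative, and the running cost is positive.\<close>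

lemma solves_mfg_positive_value:
  assumes sol: "solves_mfg F r \<rho> v \<mu>" and r: "0 \<le> r"
    and pos: "\<And>x a. a \<in> rate_vectors al au x \<Longrightarrow> 0 < f x a + F x \<mu>"
  shows "0 < r * v $ x + \<rho>"
proof (rule max_min_component[of v])
  fix z' z assume min: "\<And>y. v $ z \<le> v $ y"
  have v: "v \<in> zero_sum" using sol by (simp add: solves_mfg_def)
  have "al * ((\<Sum>y\<in>UNIV. v $ y) - real CARD('d) * v $ z) \<le> feedback v z \<bullet> v"
    by (rule rate_dot_at_min[OF opt_rate_in min])
  moreover have "al * (real CARD('d) * v $ z) \<le> 0"
    using zero_sum_sign(2)[OF v min] al by (simp add: mult_le_0_iff)
  ultimately have "0 \<le> feedback v z \<bullet> v" using v by (simp add: zero_sum_def)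
  moreover have "r * v $ z + \<rho> = f z (feedback v z) + feedback v z \<bullet> v + F z \<mu>"
    using sol by (simp add: solves_mfg_def H_eq rate_dot_Delta[OF opt_rate_in])
  moreover have "0 < f z (feedback v z) + F z \<mu>" by (rule pos[OF opt_rate_in])
  moreover have "r * v $ z \<le> r * v $ x" using min r by (intro mult_left_mono) auto
  ultimately show ?thesis by linarith
qed

lemma discounted_mfg_cases:
  assumes "0 < r" "discounted_mfg al au f F r u \<mu>"
  obtains \<rho> v where "solves_mfg F r \<rho> v \<mu>" "u = v + vec (\<rho> / r)" "\<And>x. r * u $ x = r * v $ x + \<rho>"
proof -
  obtain \<rho> v where u: "u = v + vec (\<rho> / r)" and s: "solves_mfg F r \<rho> v \<mu>"
    using assms(2) unfolding discounted_mfg_iff[OF assms(1)] by blast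
  from s u show ?thesis using assms(1) by (intro that) (auto simp: algebra_simps)
qed

end

section \<open>The stationary discounted and ergodic systems\<close>

theorem proposition2p1:
  fixes al au :: real
    and f :: "'d::finite \<Rightarrow> real ^ 'd \<Rightarrow> real"
    and F :: "'d \<Rightarrow> real ^ 'd \<Rightarrow> real"
  assumes card: "2 \<le> CARD('d)"
    and f_meas: "\<And>x. f x \<in> borel_measurable (restrict_space borel (action_domain al au x))"
    and f_diag: "\<And>x a b. a \<in> action_domain al au x \<Longrightarrow> b \<in> action_domain al au x \<Longrightarrow>
                   (\<forall>y. y \<noteq> x \<longrightarrow> a $ y = b $ y) \<Longrightarrow> f x a = f x b"
    and F_meas: "\<And>x. F x \<in> borel_measurable (restrict_space borel prob_simplex)"
    and A1: "0 < al" "al < au"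
    and A2: "\<And>x p. \<exists>!a. is_opt_rate al au f x p a"
            "\<And>x. opt_rate al au f x \<in> borel_measurable borel"
    and A3: "\<And>x. C1_simplex_lipschitz (F x)"
    and A4: "\<And>\<eta> \<eta>'. \<eta> \<in> prob_simplex \<Longrightarrow> \<eta>' \<in> prob_simplex \<Longrightarrow>
               0 \<le> (\<Sum>x\<in>UNIV. (F x \<eta> - F x \<eta>') * (\<eta> $ x - \<eta>' $ x))"
    and A5: "regular_hamiltonian (hamiltonian al au f)"
  shows "\<exists>r0>0.
    \<comment> \<open>(i)\<close>
    (\<forall>r\<in>{0<..<r0}. \<exists>!s. case s of (u, \<mu>) \<Rightarrow> discounted_mfg al au f F r u \<mu>) \<and>
    ((\<forall>x. \<forall>a\<in>rate_vectors al au x. \<forall>\<eta>\<in>prob_simplex. 0 < f x a + F x \<eta>) \<longrightarrow>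
      (\<forall>r\<in>{0<..<r0}. \<forall>u \<mu>. discounted_mfg al au f F r u \<mu> \<longrightarrow> (\<forall>x. 0 < u $ x))) \<and>
    (\<exists>C>0. \<forall>r\<in>{0<..<r0}. \<forall>u \<mu>. discounted_mfg al au f F r u \<mu> \<longrightarrow>
      norm (r *\<^sub>R u) \<le> C \<and> (\<forall>x. inverse C \<le> \<mu> $ x)) \<and>
    \<comment> \<open>(ii)\<close>
    (\<exists>\<rho> u \<mu>. ergodic_mfg al au f F \<rho> u \<mu> \<and>
      (\<forall>\<rho>' u' \<mu>'. ergodic_mfg al au f F \<rho>' u' \<mu>' \<longrightarrow> \<rho>' = \<rho> \<and> u' = u \<and> \<mu>' = \<mu>) \<and>
      (\<exists>C>0. \<forall>r\<in>{0<..<r0}. \<forall>ur \<mu>r. discounted_mfg al au f F r ur \<mu>r \<longrightarrow>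
        (MAX x\<in>UNIV. \<bar>r * ur $ x - \<rho>\<bar>) + sqrt (\<Sum>x\<in>UNIV. (norm (Delta x (ur - u)))\<^sup>2)
          + norm (\<mu>r - \<mu>) \<le> C * r powr (1 / 2)) \<and>
      (\<forall>x. 0 < \<mu> $ x) \<and>
      (0 < \<rho> \<longrightarrow>
        (\<forall>r\<in>{0<..<r0}. \<forall>ur \<mu>r. discounted_mfg al au f F r ur \<mu>r \<longrightarrow> (\<forall>x. 0 < ur $ x))) \<and>
      \<comment> \<open>(iii)\<close>
      (\<forall>(x0 :: 'd) (M :: ('d \<Rightarrow> real ^ 'd) \<Rightarrow> 'w measure) (X :: ('d \<Rightarrow> real ^ 'd) \<Rightarrow> real \<Rightarrow> 'w \<Rightarrow> 'd).
        player_processes al au M X x0 \<longrightarrow>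
          (let \<alpha> = (\<lambda>x. opt_rate al au f x (Delta x u))
           in ergodic_equilibrium al au f F M X \<alpha> (law_flow (M \<alpha>) (X \<alpha>))) \<and>
          (\<forall>\<alpha> \<nu>. ergodic_equilibrium al au f F M X \<alpha> \<nu> \<longrightarrow>
             \<alpha> = (\<lambda>x. opt_rate al au f x (Delta x u)) \<and>
             (\<nu> \<longlongrightarrow> \<mu>) at_top \<and>
             ereal \<rho> = ergodic_cost f F (M \<alpha>) (X \<alpha>) \<alpha> \<nu>)))"
proof -
  interpret rate_control al au f
    by unfold_locales (use A1 A2(1) A5 in auto)
  obtain M where Flip: "0 < M" "\<And>x \<eta> \<zeta>. \<eta> \<in> prob_simplex \<Longrightarrow> \<zeta> \<in> prob_simplex \<Longrightarrow>
     \<bar>F x \<eta> - F x \<zeta>\<bar> \<le> M * (\<Sum>x\<in>UNIV. \<bar>\<eta> $ x - \<zeta> $ x\<bar>)"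
    by (rule C1_family_imp_l1_lipschitz[where F = F, OF A3]) (rule that, assumption, blast)
  have Fcont: "continuous_on prob_simplex (F x)" for x
    by (rule l1_lipschitz_imp_continuous_on[OF Flip])
  obtain r1 C :: real where r1: "0 < r1" and C: "0 < C"
    and uniq: "\<And>r \<rho> v \<mu> \<rho>' v' \<mu>'. 0 \<le> r \<Longrightarrow> r < r1 \<Longrightarrow> solves_mfg F r \<rho> v \<mu> \<Longrightarrow>
       solves_mfg F r \<rho>' v' \<mu>' \<Longrightarrow> \<rho> = \<rho>' \<and> v = v' \<and> \<mu> = \<mu>'"
    and rate: "\<And>r \<rho> v \<mu> \<rho>' v' \<mu>'. 0 \<le> r \<Longrightarrow> solves_mfg F r \<rho> v \<mu> \<Longrightarrow> solves_mfg F 0 \<rho>' v' \<mu>' \<Longrightarrow>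
       grad_dist v v' \<le> C * r \<and> norm (\<mu> - \<mu>') \<le> C * r \<and> (\<forall>x. \<bar>r * v $ x + \<rho> - \<rho>'\<bar> \<le> C * r)"
    and bound: "\<And>r \<rho> v \<mu> x. 0 \<le> r \<Longrightarrow> solves_mfg F r \<rho> v \<mu> \<Longrightarrow> \<bar>r * v $ x + \<rho>\<bar> \<le> C"
    using mfg_uniform_estimates[where F = F, OF Flip A4] by blast
  obtain \<rho> u \<mu> where sol: "solves_mfg F 0 \<rho> u \<mu>"
    by (rule solves_mfg_exists[where F = F, OF Fcont order_refl])
  have erg_uniq: "\<rho>' = \<rho> \<and> u' = u \<and> \<mu>' = \<mu>" if "solves_mfg F 0 \<rho>' u' \<mu>'" for \<rho>' u' \<mu>'
    using uniq[OF order_refl r1 that sol] by simp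
  define n where "n = real CARD('d)"
  define c0 where "c0 = al / (al + n * au)"
  have n: "0 < n" by (simp add: n_def)
  have c0: "0 < c0" using al au_pos n by (simp add: c0_def add_pos_pos)
  have lower: "c0 \<le> \<eta> $ x" if "solves_mfg F r \<rho>' v \<eta>" for r \<rho>' v \<eta> x
    unfolding c0_def n_def using that al au_pos
    by (intro invariant_dist_lower_bound[OF feedback_controls]) (auto simp: solves_mfg_def)
  \<comment> \<open>\<open>r1\<close> for uniqueness; \<open>1\<close> so that \<open>r\<close> is at most its square root; \<open>\<rho> / C\<close> so that a positive \<open>\<rho>\<close> exceeds
    the distance to the discounted values\<close>
  define r0 where "r0 = min 1 (min r1 (if 0 < \<rho> then \<rho> / C else 1))"
  have r0: "0 < r0" using r1 C by (simp add: r0_def)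
  have r0D: "0 < r" "r < 1" "r < r1" "0 < \<rho> \<Longrightarrow> C * r < \<rho>" if "r \<in> {0<..<r0}" for r
    using that C by (auto simp: r0_def field_simps)

  have unique: "\<exists>!s. case s of (u, \<mu>) \<Rightarrow> discounted_mfg al au f F r u \<mu>" if r: "r \<in> {0<..<r0}" for r
  proof -
    obtain \<rho>r v \<mu>r where s: "solves_mfg F r \<rho>r v \<mu>r"
      by (rule solves_mfg_exists[where F = F, OF Fcont less_imp_le[OF r0D(1)[OF r]]])
    show ?thesis
    proof (rule ex1I[of _ "(v + vec (\<rho>r / r), \<mu>r)"])
      show "case (v + vec (\<rho>r / r), \<mu>r) of (u, \<mu>) \<Rightarrow> discounted_mfg al au f F r u \<mu>"
        using s by (auto simp: discounted_mfg_iff[OF r0D(1)[OF r]])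
      fix s' assume "case s' of (u, \<mu>) \<Rightarrow> discounted_mfg al au f F r u \<mu>"
      then obtain u' \<mu>' where s': "s' = (u', \<mu>')" and d: "discounted_mfg al au f F r u' \<mu>'"
        by (cases s') simp
      show "s' = (v + vec (\<rho>r / r), \<mu>r)"
      proof (rule discounted_mfg_cases[OF r0D(1)[OF r] d])
        fix \<rho>' v' assume "solves_mfg F r \<rho>' v' \<mu>'" and u': "u' = v' + vec (\<rho>' / r)"
        from uniq[OF less_imp_le[OF r0D(1)[OF r]] r0D(3)[OF r] this(1) s]
        show ?thesis by (simp add: s' u')
      qed
    qed
  qed

  have positive: "0 < u $ x"
    if pos: "\<forall>x. \<forall>a\<in>rate_vectors al au x. \<forall>\<eta>\<in>prob_simplex. 0 < f x a + F x \<eta>"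
      and r: "r \<in> {0<..<r0}" and d: "discounted_mfg al au f F r u \<mu>" for r u \<mu> x
  proof (rule discounted_mfg_cases[OF r0D(1)[OF r] d])
    fix \<rho>' v assume s: "solves_mfg F r \<rho>' v \<mu>" and ru: "\<And>x. r * u $ x = r * v $ x + \<rho>'"
    have "0 < r * v $ x + \<rho>'"
      using pos solves_mfg_simplex[OF s] r0D(1)[OF r]
      by (intro solves_mfg_positive_value[OF s]) auto
    then show ?thesis using r0D(1)[OF r] unfolding ru[symmetric] by (simp add: zero_less_mult_iff)
  qed

  define C1 where "C1 = n * C + 1 / c0"
  have C1: "0 < C1" "n * C \<le> C1" "inverse C1 \<le> c0"
  proof -
    have "0 < n * C" "0 < 1 / c0" using n C c0 by auto
    then show "0 < C1" "n * C \<le> C1" unfolding C1_def by linarith+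
    have "inverse C1 \<le> inverse (1 / c0)"
      using \<open>0 < n * C\<close> \<open>0 < 1 / c0\<close> unfolding C1_def by (intro le_imp_inverse_le) linarith+
    then show "inverse C1 \<le> c0" by simp
  qed
  have bounds: "norm (r *\<^sub>R u) \<le> C1 \<and> (\<forall>x. inverse C1 \<le> \<mu> $ x)"
    if r: "r \<in> {0<..<r0}" and d: "discounted_mfg al au f F r u \<mu>" for r u \<mu>
  proof (rule discounted_mfg_cases[OF r0D(1)[OF r] d])
    fix \<rho>' v assume s: "solves_mfg F r \<rho>' v \<mu>" and ru: "\<And>x. r * u $ x = r * v $ x + \<rho>'"
    have "norm (r *\<^sub>R u) \<le> (\<Sum>x\<in>UNIV. \<bar>r * u $ x\<bar>)" using norm_le_l1_cart[of "r *\<^sub>R u"] by simp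
    also have "\<dots> \<le> (\<Sum>x\<in>(UNIV :: 'd set). C)"
      unfolding ru using bound[OF less_imp_le[OF r0D(1)[OF r]] s] by (intro sum_mono) auto
    also have "\<dots> = n * C" by (simp add: n_def)
    finally show ?thesis using C1 lower[OF s] by (meson order_trans)
  qed

  have convergence: "(\<forall>x. \<bar>r * ur $ x - \<rho>\<bar> \<le> C * r) \<and>
      sqrt (\<Sum>x\<in>UNIV. (norm (Delta x (ur - u)))\<^sup>2) \<le> C * r \<and> norm (\<mu>r - \<mu>) \<le> C * r"
    if r: "r \<in> {0<..<r0}" and d: "discounted_mfg al au f F r ur \<mu>r" for r ur \<mu>r
  proof (rule discounted_mfg_cases[OF r0D(1)[OF r] d])
    fix \<rho>' v assume s: "solves_mfg F r \<rho>' v \<mu>r" and ur: "ur = v + vec (\<rho>' / r)"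
      and ru: "\<And>x. r * ur $ x = r * v $ x + \<rho>'"
    have "Delta x (ur - u) = Delta x (v - u)" for x
      using Delta_add_const[of x "v - u" "\<rho>' / r"] by (simp add: ur algebra_simps)
    then show ?thesis
      using rate[OF less_imp_le[OF r0D(1)[OF r]] s sol] by (simp add: grad_dist_def ru)
  qed
  have sqrt_rate: "(MAX x\<in>UNIV. \<bar>r * ur $ x - \<rho>\<bar>) + sqrt (\<Sum>x\<in>UNIV. (norm (Delta x (ur - u)))\<^sup>2)
          + norm (\<mu>r - \<mu>) \<le> (3 * C) * r powr (1 / 2)"
    if r: "r \<in> {0<..<r0}" and d: "discounted_mfg al au f F r ur \<mu>r" for r ur \<mu>r
  proof -
    have "(MAX x\<in>UNIV. \<bar>r * ur $ x - \<rho>\<bar>) \<le> C * r"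
      using convergence[OF r d] by (intro Max.boundedI) auto
    then have "(MAX x\<in>UNIV. \<bar>r * ur $ x - \<rho>\<bar>) + sqrt (\<Sum>x\<in>UNIV. (norm (Delta x (ur - u)))\<^sup>2)
          + norm (\<mu>r - \<mu>) \<le> (3 * C) * r"
      using convergence[OF r d] by linarith
    also have "\<dots> \<le> (3 * C) * r powr (1 / 2)"
    proof (rule mult_left_mono)
      have "r = r powr 1" using r0D(1)[OF r] by simp
      also have "\<dots> \<le> r powr (1 / 2)" using r0D(1,2)[OF r] by (intro powr_mono') auto
      finally show "r \<le> r powr (1 / 2)" .
    qed (use C in simp)
    finally show ?thesis .
  qed
  have positive_ergodic: "0 < ur $ x"
    if "0 < \<rho>" and r: "r \<in> {0<..<r0}" and d: "discounted_mfg al au f F r ur \<mu>r" for r ur \<mu>r x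
  proof -
    have "\<bar>r * ur $ x - \<rho>\<bar> \<le> C * r" using convergence[OF r d] by blast
    then have "0 < r * ur $ x" using r0D(4)[OF r that(1)] by linarith
    then show ?thesis using r0D(1)[OF r] by (simp add: zero_less_mult_iff)
  qed

  have equilibria: "(let \<alpha> = (\<lambda>x. opt_rate al au f x (Delta x u))
           in ergodic_equilibrium al au f F M X \<alpha> (law_flow (M \<alpha>) (X \<alpha>))) \<and>
          (\<forall>\<alpha> \<nu>. ergodic_equilibrium al au f F M X \<alpha> \<nu> \<longrightarrow>
             \<alpha> = (\<lambda>x. opt_rate al au f x (Delta x u)) \<and>
             (\<nu> \<longlongrightarrow> \<mu>) at_top \<and>
             ereal \<rho> = ergodic_cost f F (M \<alpha>) (X \<alpha>) \<alpha> \<nu>)"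
    if X: "player_processes al au M X x0"
    for x0 and M :: "('d \<Rightarrow> real ^ 'd) \<Rightarrow> 'w measure" and X :: "('d \<Rightarrow> real ^ 'd) \<Rightarrow> real \<Rightarrow> 'w \<Rightarrow> 'd"
  proof (intro conjI allI impI)
    show "let \<alpha> = feedback u in ergodic_equilibrium al au f F M X \<alpha> (law_flow (M \<alpha>) (X \<alpha>))"
      unfolding Let_def by (rule solution_imp_equilibrium[where F = F, OF Fcont sol X])
    fix \<alpha> \<nu> assume "ergodic_equilibrium al au f F M X \<alpha> \<nu>"
    from equilibrium_imp_solution[where F = F, OF Fcont X this] erg_uniq
    have "\<alpha> = feedback u \<and> (\<nu> \<longlongrightarrow> \<mu>) at_top \<and> ereal \<rho> = ergodic_cost f F (M \<alpha>) (X \<alpha>) \<alpha> \<nu>"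
      by metis
    then show "\<alpha> = feedback u" "(\<nu> \<longlongrightarrow> \<mu>) at_top"
      "ereal \<rho> = ergodic_cost f F (M \<alpha>) (X \<alpha>) \<alpha> \<nu>" by blast+
  qed

  have \<mu>_pos: "0 < \<mu> $ x" for x using c0 lower[OF sol] by (rule less_le_trans)
  show ?thesis
  proof (rule exI[of _ r0], intro conjI)
    show "0 < r0" by (rule r0)
    show "\<forall>r\<in>{0<..<r0}. \<exists>!s. case s of (u, \<mu>) \<Rightarrow> discounted_mfg al au f F r u \<mu>"
      using unique by blast
    show "(\<forall>x. \<forall>a\<in>rate_vectors al au x. \<forall>\<eta>\<in>prob_simplex. 0 < f x a + F x \<eta>) \<longrightarrow>
      (\<forall>r\<in>{0<..<r0}. \<forall>u \<mu>. discounted_mfg al au f F r u \<mu> \<longrightarrow> (\<forall>x. 0 < u $ x))"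
      by (intro impI ballI allI) (rule positive)
    show "\<exists>C>0. \<forall>r\<in>{0<..<r0}. \<forall>u \<mu>. discounted_mfg al au f F r u \<mu> \<longrightarrow>
      norm (r *\<^sub>R u) \<le> C \<and> (\<forall>x. inverse C \<le> \<mu> $ x)"
      using C1(1) bounds by (intro exI[of _ C1] conjI ballI allI impI) blast+
    show "\<exists>\<rho> u \<mu>. ergodic_mfg al au f F \<rho> u \<mu> \<and>
      (\<forall>\<rho>' u' \<mu>'. ergodic_mfg al au f F \<rho>' u' \<mu>' \<longrightarrow> \<rho>' = \<rho> \<and> u' = u \<and> \<mu>' = \<mu>) \<and>
      (\<exists>C>0. \<forall>r\<in>{0<..<r0}. \<forall>ur \<mu>r. discounted_mfg al au f F r ur \<mu>r \<longrightarrow>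
        (MAX x\<in>UNIV. \<bar>r * ur $ x - \<rho>\<bar>) + sqrt (\<Sum>x\<in>UNIV. (norm (Delta x (ur - u)))\<^sup>2)
          + norm (\<mu>r - \<mu>) \<le> C * r powr (1 / 2)) \<and>
      (\<forall>x. 0 < \<mu> $ x) \<and>
      (0 < \<rho> \<longrightarrow>
        (\<forall>r\<in>{0<..<r0}. \<forall>ur \<mu>r. discounted_mfg al au f F r ur \<mu>r \<longrightarrow> (\<forall>x. 0 < ur $ x))) \<and>
      (\<forall>(x0 :: 'd) (M :: ('d \<Rightarrow> real ^ 'd) \<Rightarrow> 'w measure) (X :: ('d \<Rightarrow> real ^ 'd) \<Rightarrow> real \<Rightarrow> 'w \<Rightarrow> 'd).
        player_processes al au M X x0 \<longrightarrow>
          (let \<alpha> = (\<lambda>x. opt_rate al au f x (Delta x u))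
           in ergodic_equilibrium al au f F M X \<alpha> (law_flow (M \<alpha>) (X \<alpha>))) \<and>
          (\<forall>\<alpha> \<nu>. ergodic_equilibrium al au f F M X \<alpha> \<nu> \<longrightarrow>
             \<alpha> = (\<lambda>x. opt_rate al au f x (Delta x u)) \<and>
             (\<nu> \<longlongrightarrow> \<mu>) at_top \<and>
             ereal \<rho> = ergodic_cost f F (M \<alpha>) (X \<alpha>) \<alpha> \<nu>))"
      (is "\<exists>\<rho> u \<mu>. ?Q \<rho> u \<mu>")
    proof -
      have Q: "?Q \<rho> u \<mu>"
      proof (intro conjI)
        show "ergodic_mfg al au f F \<rho> u \<mu>" using sol by (simp only: ergodic_mfg_iff)
        show "\<forall>\<rho>' u' \<mu>'. ergodic_mfg al au f F \<rho>' u' \<mu>' \<longrightarrow> \<rho>' = \<rho> \<and> u' = u \<and> \<mu>' = \<mu>"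
          unfolding ergodic_mfg_iff using erg_uniq by blast
        show "\<exists>C>0. \<forall>r\<in>{0<..<r0}. \<forall>ur \<mu>r. discounted_mfg al au f F r ur \<mu>r \<longrightarrow>
            (MAX x\<in>UNIV. \<bar>r * ur $ x - \<rho>\<bar>) + sqrt (\<Sum>x\<in>UNIV. (norm (Delta x (ur - u)))\<^sup>2)
              + norm (\<mu>r - \<mu>) \<le> C * r powr (1 / 2)"
          using C by (intro exI[of _ "3 * C"] conjI ballI allI impI sqrt_rate) auto
        show "\<forall>x. 0 < \<mu> $ x" using \<mu>_pos by blast
        show "0 < \<rho> \<longrightarrow> (\<forall>r\<in>{0<..<r0}. \<forall>ur \<mu>r. discounted_mfg al au f F r ur \<mu>r \<longrightarrow> (\<forall>x. 0 < ur $ x))"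
          by (intro impI ballI allI) (rule positive_ergodic)
      qed (intro allI impI, rule equilibria)
      show ?thesis by (rule exI[of _ \<rho>], rule exI[of _ u], rule exI[of _ \<mu>], rule Q)
    qed
  qed
qed

end
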